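(* Let $X$ be a set, $\mathcal{C}$ a simplicial complex on $X$, $\mathcal{L}$ a language of regular logic whose variables include $X$, and $\vdash$ a regular theory in $\mathcal{L}$ satisfying condition ( * ): for any $\Gamma\subseteq\Phi_{\mathcal{C}}$ and each $U\in\mathcal{C}$ there is a finite $\Delta_U\subseteq\Gamma_U$ with $\Delta_U\vdash\varphi$ for all $\varphi\in\Gamma_U$. Then for any $\Gamma\subseteq\Phi_{\mathcal{C}}$ and $\varphi\in\Phi_{\mathcal{C}}$: $\Gamma\vdash_{\mathcal{C}}\varphi$ if and only if $A\vDash\varphi$ for every no-signalling model $A$ of $\Gamma$ in every model $[\![-]\!]$ of $\vdash$ in any regular category.
   Context: A simplicial complex on $X$ is a family $\mathcal{C}$ of finite subsets of $X$ closed under subsets with $\bigcup\mathcal{C}=X$. $\mathcal{L}$ is a language of regular first-order logic (with $\top$, $\wedge$, $\exists$) whose variables include $X$; each $x\in X$ has a type $T_x$. $\Phi_U$ ($U\subseteq X$) is the set of formulas in context $U$; $\Phi_{\mathcal{C}}=\bigcup_{U\in\mathcal{C}}\Phi_U$; $\Gamma_U=\Gamma\cap\Phi_U$. $\vdash$ is an entailment relation between sets of formulas and formulas. The inchworm fragment $\vdash_{\mathcal{C}}$ is defined inductively: (i) $\Gamma\vdash_{\mathcal{C}}\varphi$ if some $U\in\mathcal{C}$ has $\varphi\in\Phi_U$ and $\Gamma_U\vdash\varphi$; (ii) if $\Gamma\vdash_{\mathcal{C}}\varphi$ and $\Delta\cup\{\varphi\}\vdash_{\mathcal{C}}\psi$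 then $\Gamma\cup\Delta\vdash_{\mathcal{C}}\psi$. An interpretation $[\![-]\!]$ of $\mathcal{L}$ in a regular category $\mathbf{S}$ gives $F_U=\prod_{x\in U}[\![T_x]\!]$ with projections $F_{U\subseteq V}:F_V\to F_U$, and subobjects $[\![\varphi]\!]_U\rightarrowtail F_U$ for $\varphi\in\Phi_U$; it is a model of $\vdash$ if whenever $\Gamma\vdash\varphi$ some finite $\Delta\subseteq\Gamma$ has $\bigwedge_{\psi\in\Delta}[\![\psi]\!]_U\leqslant[\![\varphi]\!]_U$. A subpresheaf $A$ of $F$ is a family of subobjects $A_U\rightarrowtail F_U$ ($U\in\mathcal{C}$) such that each $F_{U\subseteq V}$ restricts to $A_{U\subseteq V}:A_V\to A_U$; it is no-signalling if every $A_{U\subseteq V}$ is a regular epimorphism. $A\vDash\varphi$ means $A_U\leqslant[\![\varphi]\!]_U$ for every $U\in\mathcal{C}$ with $\varphi\in\Phi_U$. A no-signalling model of $\Gamma$ is a no-signalling subpresheaf $A$ of $F$ with $A\vDash\psi$ for all $\psi\in\Gamma$. *)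

theory Defs
  imports Main
begin

section \<open>Languages of regular logic\<close>

datatype ('f, 'v) tm = Var 'v | Fun 'f "('f, 'v) tm list"

datatype ('f, 'r, 'v) fm =
    Top
  | Rel 'r "('f, 'v) tm list"
  | Eq "('f, 'v) tm" "('f, 'v) tm"
  | And "('f, 'r, 'v) fm" "('f, 'r, 'v) fm"
  | Ex 'v "('f, 'r, 'v) fm"

text \<open>
  A many-sorted signature. Equality belongs to some presentations of regular logic and not to
  others; equations are formulas of the language exactly when \<open>has_eq\<close> holds.
\<close>

record ('s, 'f, 'r, 'v) signature =
  sorts :: "'s set"
  vars :: "'v set"
  vsort :: "'v \<Rightarrow> 's"
  funs :: "'f set"
  fdom :: "'f \<Rightarrow> 's list"
  fcod :: "'f \<Rightarrow> 's"
  rels :: "'r set"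
  rdom :: "'r \<Rightarrow> 's list"
  has_eq :: bool

text \<open>As usual in first-order logic, there are infinitely many variables of each sort.\<close>

locale language =
  fixes L :: "('s, 'f, 'r, 'v) signature"
  assumes vsort_in: "x \<in> vars L \<Longrightarrow> vsort L x \<in> sorts L"
    and fdom_in: "f \<in> funs L \<Longrightarrow> set (fdom L f) \<subseteq> sorts L"
    and fcod_in: "f \<in> funs L \<Longrightarrow> fcod L f \<in> sorts L"
    and rdom_in: "r \<in> rels L \<Longrightarrow> set (rdom L r) \<subseteq> sorts L"
    and infinite_vars: "s \<in> sorts L \<Longrightarrow> infinite {x \<in> vars L. vsort L x = s}"

fun tm_fv :: "('f, 'v) tm \<Rightarrow> 'v set" where
  "tm_fv (Var x) = {x}"
| "tm_fv (Fun f ts) = (\<Union>t\<in>set ts. tm_fv t)"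

fun tm_sort :: "('s, 'f, 'r, 'v) signature \<Rightarrow> ('f, 'v) tm \<Rightarrow> 's" where
  "tm_sort L (Var x) = vsort L x"
| "tm_sort L (Fun f ts) = fcod L f"

fun tm_wf :: "('s, 'f, 'r, 'v) signature \<Rightarrow> ('f, 'v) tm \<Rightarrow> bool" where
  "tm_wf L (Var x) \<longleftrightarrow> x \<in> vars L"
| "tm_wf L (Fun f ts) \<longleftrightarrow>
     f \<in> funs L \<and> (\<forall>t\<in>set ts. tm_wf L t) \<and> map (tm_sort L) ts = fdom L f"

primrec fv :: "('f, 'r, 'v) fm \<Rightarrow> 'v set" where
  "fv Top = {}"
| "fv (Rel r ts) = (\<Union>t\<in>set ts. tm_fv t)"
| "fv (Eq s t) = tm_fv s \<union> tm_fv t"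
| "fv (And \<phi> \<psi>) = fv \<phi> \<union> fv \<psi>"
| "fv (Ex x \<phi>) = fv \<phi> - {x}"

primrec fm_wf :: "('s, 'f, 'r, 'v) signature \<Rightarrow> ('f, 'r, 'v) fm \<Rightarrow> bool" where
  "fm_wf L Top \<longleftrightarrow> True"
| "fm_wf L (Rel r ts) \<longleftrightarrow>
     r \<in> rels L \<and> (\<forall>t\<in>set ts. tm_wf L t) \<and> map (tm_sort L) ts = rdom L r"
| "fm_wf L (Eq s t) \<longleftrightarrow> has_eq L \<and> tm_wf L s \<and> tm_wf L t \<and> tm_sort L s = tm_sort L t"
| "fm_wf L (And \<phi> \<psi>) \<longleftrightarrow> fm_wf L \<phi> \<and> fm_wf L \<psi>"
| "fm_wf L (Ex x \<phi>) \<longleftrightarrow> x \<in> vars L \<and> fm_wf L \<phi>"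

definition is_ctx :: "('s, 'f, 'r, 'v) signature \<Rightarrow> 'v set \<Rightarrow> bool" where
  "is_ctx L U \<longleftrightarrow> finite U \<and> U \<subseteq> vars L"

text \<open>Formulas in context \<open>U\<close>, and formulas in some context of a family \<open>K\<close>.\<close>

definition fms :: "('s, 'f, 'r, 'v) signature \<Rightarrow> 'v set \<Rightarrow> ('f, 'r, 'v) fm set" where
  "fms L U = {\<phi>. fm_wf L \<phi> \<and> fv \<phi> \<subseteq> U}"

definition fms_over :: "('s, 'f, 'r, 'v) signature \<Rightarrow> 'v set set \<Rightarrow> ('f, 'r, 'v) fm set" where
  "fms_over L K = (\<Union>U\<in>K. fms L U)"

fun tm_subst :: "('v \<Rightarrow> ('f, 'v) tm) \<Rightarrow> ('f, 'v) tm \<Rightarrow> ('f, 'v) tm" where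
  "tm_subst \<sigma> (Var x) = \<sigma> x"
| "tm_subst \<sigma> (Fun f ts) = Fun f (map (tm_subst \<sigma>) ts)"

text \<open>
  Substitution does not rename bound variables; it is used only together with the side
  condition \<open>free_for\<close>, which says that no variable is captured.
\<close>

primrec subst :: "('v \<Rightarrow> ('f, 'v) tm) \<Rightarrow> ('f, 'r, 'v) fm \<Rightarrow> ('f, 'r, 'v) fm" where
  "subst \<sigma> Top = Top"
| "subst \<sigma> (Rel r ts) = Rel r (map (tm_subst \<sigma>) ts)"
| "subst \<sigma> (Eq s t) = Eq (tm_subst \<sigma> s) (tm_subst \<sigma> t)"
| "subst \<sigma> (And \<phi> \<psi>) = And (subst \<sigma> \<phi>) (subst \<sigma> \<psi>)"
| "subst \<sigma> (Ex x \<phi>) = Ex x (subst (\<sigma>(x := Var x)) \<phi>)"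

primrec free_for :: "('v \<Rightarrow> ('f, 'v) tm) \<Rightarrow> ('f, 'r, 'v) fm \<Rightarrow> bool" where
  "free_for \<sigma> Top \<longleftrightarrow> True"
| "free_for \<sigma> (Rel r ts) \<longleftrightarrow> True"
| "free_for \<sigma> (Eq s t) \<longleftrightarrow> True"
| "free_for \<sigma> (And \<phi> \<psi>) \<longleftrightarrow> free_for \<sigma> \<phi> \<and> free_for \<sigma> \<psi>"
| "free_for \<sigma> (Ex x \<phi>) \<longleftrightarrow>
     (\<forall>y \<in> fv (Ex x \<phi>). x \<notin> tm_fv (\<sigma> y)) \<and> free_for (\<sigma>(x := Var x)) \<phi>"


section \<open>Regular theories and the inchworm fragment\<close>

text \<open>
  \<open>E U \<Gamma> \<phi>\<close> is the entailment of \<open>\<phi>\<close> by \<open>\<Gamma>\<close> in context \<open>U\<close>. Sorts may be interpreted by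
  objects without global support, so in general the context matters: with
  \<open>x \<in> U\<close>, \<open>\<exists>x. \<top>\<close> holds in context \<open>U\<close> but not necessarily in the empty context.
  An entailment relation that ignores contexts is the special case in which
  \<open>E U \<Gamma> \<phi>\<close> is \<open>\<Gamma> \<turnstile> \<phi>\<close> for every context \<open>U\<close> of \<open>\<Gamma>\<close> and \<open>\<phi>\<close>.

  In \<open>ex\<close> the side formulas \<open>\<Gamma>\<close> provide the Frobenius law. In \<open>substitution\<close> the case of
  \<open>\<sigma> = Var\<close> and \<open>U \<subseteq> V\<close> is the weakening of contexts.
\<close>

locale regular_theory = language L
  for L :: "('s, 'f, 'r, 'v) signature" +
  fixes E :: "'v set \<Rightarrow> ('f, 'r, 'v) fm set \<Rightarrow> ('f, 'r, 'v) fm \<Rightarrow> bool"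
  assumes in_context: "E U \<Gamma> \<phi> \<Longrightarrow> is_ctx L U \<and> \<Gamma> \<subseteq> fms L U \<and> \<phi> \<in> fms L U"
    and finitary: "E U \<Gamma> \<phi> \<Longrightarrow> \<exists>\<Delta>. finite \<Delta> \<and> \<Delta> \<subseteq> \<Gamma> \<and> E U \<Delta> \<phi>"
    and identity: "is_ctx L U \<Longrightarrow> \<Gamma> \<subseteq> fms L U \<Longrightarrow> \<phi> \<in> \<Gamma> \<Longrightarrow> E U \<Gamma> \<phi>"
    and weakening: "E U \<Gamma> \<phi> \<Longrightarrow> \<Gamma> \<subseteq> \<Delta> \<Longrightarrow> \<Delta> \<subseteq> fms L U \<Longrightarrow> E U \<Delta> \<phi>"
    and cut: "E U \<Gamma> \<phi> \<Longrightarrow> E U (insert \<phi> \<Delta>) \<psi> \<Longrightarrow> E U (\<Gamma> \<union> \<Delta>) \<psi>"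
    and substitution:
      "E U \<Gamma> \<phi> \<Longrightarrow> is_ctx L V \<Longrightarrow>
       (\<And>x. x \<in> U \<Longrightarrow>
          tm_wf L (\<sigma> x) \<and> tm_sort L (\<sigma> x) = vsort L x \<and> tm_fv (\<sigma> x) \<subseteq> V) \<Longrightarrow>
       (\<And>\<psi>. \<psi> \<in> insert \<phi> \<Gamma> \<Longrightarrow> free_for \<sigma> \<psi>) \<Longrightarrow>
       E V (subst \<sigma> ` \<Gamma>) (subst \<sigma> \<phi>)"
    and top: "is_ctx L U \<Longrightarrow> E U {} Top"
    and conjI: "is_ctx L U \<Longrightarrow> \<phi> \<in> fms L U \<Longrightarrow> \<psi> \<in> fms L U \<Longrightarrow> E U {\<phi>, \<psi>} (And \<phi> \<psi>)"
    and conjD1: "is_ctx L U \<Longrightarrow> \<phi> \<in> fms L U \<Longrightarrow> \<psi> \<in> fms L U \<Longrightarrow> E U {And \<phi> \<psi>} \<phi>"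
    and conjD2: "is_ctx L U \<Longrightarrow> \<phi> \<in> fms L U \<Longrightarrow> \<psi> \<in> fms L U \<Longrightarrow> E U {And \<phi> \<psi>} \<psi>"
    and ex:
      "is_ctx L U \<Longrightarrow> x \<in> vars L \<Longrightarrow> x \<notin> U \<Longrightarrow> \<phi> \<in> fms L (insert x U) \<Longrightarrow>
       \<Gamma> \<subseteq> fms L U \<Longrightarrow> \<psi> \<in> fms L U \<Longrightarrow>
       E U (insert (Ex x \<phi>) \<Gamma>) \<psi> \<longleftrightarrow> E (insert x U) (insert \<phi> \<Gamma>) \<psi>"
    and eq_refl: "has_eq L \<Longrightarrow> is_ctx L U \<Longrightarrow> x \<in> U \<Longrightarrow> E U {} (Eq (Var x) (Var x))"
    and eq_subst:
      "has_eq L \<Longrightarrow> is_ctx L U \<Longrightarrow> x \<in> U \<Longrightarrow> y \<in> U \<Longrightarrow> vsort L x = vsort L y \<Longrightarrow>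
       \<phi> \<in> fms L U \<Longrightarrow> free_for (Var(x := Var y)) \<phi> \<Longrightarrow>
       E U {Eq (Var x) (Var y), \<phi>} (subst (Var(x := Var y)) \<phi>)"

definition simplicial_complex :: "'v set \<Rightarrow> 'v set set \<Rightarrow> bool" where
  "simplicial_complex X K \<longleftrightarrow>
     (\<forall>U\<in>K. finite U \<and> U \<subseteq> X) \<and> (\<forall>V\<in>K. \<forall>U. U \<subseteq> V \<longrightarrow> U \<in> K) \<and> \<Union>K = X"

inductive inchworm ::
  "('s, 'f, 'r, 'v) signature \<Rightarrow> ('v set \<Rightarrow> ('f, 'r, 'v) fm set \<Rightarrow> ('f, 'r, 'v) fm \<Rightarrow> bool) \<Rightarrow>
   'v set set \<Rightarrow> ('f, 'r, 'v) fm set \<Rightarrow> ('f, 'r, 'v) fm \<Rightarrow> bool"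
  for L E K where
  local: "U \<in> K \<Longrightarrow> \<phi> \<in> fms L U \<Longrightarrow> E U (\<Gamma> \<inter> fms L U) \<phi> \<Longrightarrow> inchworm L E K \<Gamma> \<phi>"
| cut: "inchworm L E K \<Gamma> \<phi> \<Longrightarrow> inchworm L E K (\<Delta> \<union> {\<phi>}) \<psi> \<Longrightarrow> inchworm L E K (\<Gamma> \<union> \<Delta>) \<psi>"


section \<open>Regular categories\<close>

record ('o, 'm) cat =
  Obj :: "'o set"
  Arr :: "'m set"
  Dom :: "'m \<Rightarrow> 'o"
  Cod :: "'m \<Rightarrow> 'o"
  Ide :: "'o \<Rightarrow> 'm"
  Cmp :: "'m \<Rightarrow> 'm \<Rightarrow> 'm"  (infixl \<open>\<cdot>\<index>\<close> 70)

definition Hom :: "('o, 'm) cat \<Rightarrow> 'o \<Rightarrow> 'o \<Rightarrow> 'm set" where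
  "Hom S a b = {f \<in> Arr S. Dom S f = a \<and> Cod S f = b}"

locale category =
  fixes S :: "('o, 'm) cat" (structure)
  assumes Dom_in: "f \<in> Arr S \<Longrightarrow> Dom S f \<in> Obj S"
    and Cod_in: "f \<in> Arr S \<Longrightarrow> Cod S f \<in> Obj S"
    and Ide_in: "a \<in> Obj S \<Longrightarrow> Ide S a \<in> Hom S a a"
    and Cmp_in: "f \<in> Hom S a b \<Longrightarrow> g \<in> Hom S b c \<Longrightarrow> g \<cdot> f \<in> Hom S a c"
    and Cmp_Ide: "f \<in> Hom S a b \<Longrightarrow> f \<cdot> Ide S a = f"
    and Ide_Cmp: "f \<in> Hom S a b \<Longrightarrow> Ide S b \<cdot> f = f"
    and assoc: "f \<in> Hom S a b \<Longrightarrow> g \<in> Hom S b c \<Longrightarrow> h \<in> Hom S c d \<Longrightarrow>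
      h \<cdot> (g \<cdot> f) = (h \<cdot> g) \<cdot> f"

definition is_terminal :: "('o, 'm) cat \<Rightarrow> 'o \<Rightarrow> bool" where
  "is_terminal S t \<longleftrightarrow> t \<in> Obj S \<and> (\<forall>a\<in>Obj S. \<exists>!f. f \<in> Hom S a t)"

definition is_product ::
  "('o, 'm) cat \<Rightarrow> 'i set \<Rightarrow> ('i \<Rightarrow> 'o) \<Rightarrow> 'o \<Rightarrow> ('i \<Rightarrow> 'm) \<Rightarrow> bool" where
  "is_product S I D P p \<longleftrightarrow>
     P \<in> Obj S \<and> (\<forall>i\<in>I. p i \<in> Hom S P (D i)) \<and>
     (\<forall>Q\<in>Obj S. \<forall>q. (\<forall>i\<in>I. q i \<in> Hom S Q (D i)) \<longrightarrow>
        (\<exists>!h. h \<in> Hom S Q P \<and> (\<forall>i\<in>I. p i \<cdot>\<^bsub>S\<^esub> h = q i)))"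

text \<open>\<open>p\<close> is the pullback of \<open>g\<close> along \<open>f\<close>, and \<open>q\<close> that of \<open>f\<close> along \<open>g\<close>.\<close>

definition is_pullback :: "('o, 'm) cat \<Rightarrow> 'm \<Rightarrow> 'm \<Rightarrow> 'm \<Rightarrow> 'm \<Rightarrow> bool" where
  "is_pullback S f g p q \<longleftrightarrow>
     f \<in> Arr S \<and> g \<in> Arr S \<and> Cod S f = Cod S g \<and>
     (\<exists>P. p \<in> Hom S P (Dom S f) \<and> q \<in> Hom S P (Dom S g) \<and> f \<cdot>\<^bsub>S\<^esub> p = g \<cdot>\<^bsub>S\<^esub> q \<and>
        (\<forall>Q\<in>Obj S. \<forall>u\<in>Hom S Q (Dom S f). \<forall>v\<in>Hom S Q (Dom S g). f \<cdot>\<^bsub>S\<^esub> u = g \<cdot>\<^bsub>S\<^esub> v \<longrightarrow>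
           (\<exists>!h. h \<in> Hom S Q P \<and> p \<cdot>\<^bsub>S\<^esub> h = u \<and> q \<cdot>\<^bsub>S\<^esub> h = v)))"

definition is_equalizer :: "('o, 'm) cat \<Rightarrow> 'm \<Rightarrow> 'm \<Rightarrow> 'm \<Rightarrow> bool" where
  "is_equalizer S f g e \<longleftrightarrow>
     f \<in> Arr S \<and> g \<in> Hom S (Dom S f) (Cod S f) \<and>
     e \<in> Arr S \<and> Cod S e = Dom S f \<and> f \<cdot>\<^bsub>S\<^esub> e = g \<cdot>\<^bsub>S\<^esub> e \<and>
     (\<forall>u\<in>Arr S. Cod S u = Dom S f \<and> f \<cdot>\<^bsub>S\<^esub> u = g \<cdot>\<^bsub>S\<^esub> u \<longrightarrow>
        (\<exists>!h. h \<in> Hom S (Dom S u) (Dom S e) \<and> e \<cdot>\<^bsub>S\<^esub> h = u))"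

definition is_coequalizer :: "('o, 'm) cat \<Rightarrow> 'm \<Rightarrow> 'm \<Rightarrow> 'm \<Rightarrow> bool" where
  "is_coequalizer S f g e \<longleftrightarrow>
     f \<in> Arr S \<and> g \<in> Hom S (Dom S f) (Cod S f) \<and>
     e \<in> Arr S \<and> Dom S e = Cod S f \<and> e \<cdot>\<^bsub>S\<^esub> f = e \<cdot>\<^bsub>S\<^esub> g \<and>
     (\<forall>u\<in>Arr S. Dom S u = Cod S f \<and> u \<cdot>\<^bsub>S\<^esub> f = u \<cdot>\<^bsub>S\<^esub> g \<longrightarrow>
        (\<exists>!h. h \<in> Hom S (Cod S e) (Cod S u) \<and> h \<cdot>\<^bsub>S\<^esub> e = u))"

definition regular_epi :: "('o, 'm) cat \<Rightarrow> 'm \<Rightarrow> bool" where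
  "regular_epi S e \<longleftrightarrow> (\<exists>f g. is_coequalizer S f g e)"

locale regular_category = category +
  assumes terminal: "\<exists>t. is_terminal S t"
    and pullbacks: "f \<in> Arr S \<Longrightarrow> g \<in> Arr S \<Longrightarrow> Cod S f = Cod S g \<Longrightarrow> \<exists>p q. is_pullback S f g p q"
    and kernel_pair_coequalizer: "is_pullback S f f p q \<Longrightarrow> \<exists>e. is_coequalizer S p q e"
    and regular_epi_stable: "is_pullback S f e p q \<Longrightarrow> regular_epi S e \<Longrightarrow> regular_epi S p"


section \<open>Subobjects\<close>

text \<open>
  A subobject is given by a representing monomorphism; \<open>sub_le\<close> is the preorder whose
  induced partial order is the order of subobjects, and the operations below return
  some representative of the subobject that they determine.
\<close>

definition mono_into :: "('o, 'm) cat \<Rightarrow> 'o \<Rightarrow> 'm \<Rightarrow> bool" where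
  "mono_into S b m \<longleftrightarrow> m \<in> Arr S \<and> Cod S m = b \<and>
     (\<forall>a\<in>Obj S. \<forall>u\<in>Hom S a (Dom S m). \<forall>v\<in>Hom S a (Dom S m). m \<cdot>\<^bsub>S\<^esub> u = m \<cdot>\<^bsub>S\<^esub> v \<longrightarrow> u = v)"

definition factors :: "('o, 'm) cat \<Rightarrow> 'm \<Rightarrow> 'm \<Rightarrow> bool" where
  "factors S f n \<longleftrightarrow> (\<exists>k \<in> Hom S (Dom S f) (Dom S n). n \<cdot>\<^bsub>S\<^esub> k = f)"

abbreviation sub_le :: "('o, 'm) cat \<Rightarrow> 'm \<Rightarrow> 'm \<Rightarrow> bool" where
  "sub_le \<equiv> factors"

definition sub_Inf :: "('o, 'm) cat \<Rightarrow> 'o \<Rightarrow> 'm set \<Rightarrow> 'm" where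
  "sub_Inf S b M = (SOME m. mono_into S b m \<and> (\<forall>n\<in>M. sub_le S m n) \<and>
     (\<forall>k. mono_into S b k \<and> (\<forall>n\<in>M. sub_le S k n) \<longrightarrow> sub_le S k m))"

definition sub_pullback :: "('o, 'm) cat \<Rightarrow> 'm \<Rightarrow> 'm \<Rightarrow> 'm" where
  "sub_pullback S f m = (SOME p. \<exists>q. is_pullback S f m p q)"

definition sub_equalizer :: "('o, 'm) cat \<Rightarrow> 'm \<Rightarrow> 'm \<Rightarrow> 'm" where
  "sub_equalizer S f g = (SOME e. is_equalizer S f g e)"

definition sub_image :: "('o, 'm) cat \<Rightarrow> 'm \<Rightarrow> 'm" where
  "sub_image S f = (SOME m. mono_into S (Cod S f) m \<and> factors S f m \<and>
     (\<forall>n. mono_into S (Cod S f) n \<and> factors S f n \<longrightarrow> sub_le S m n))"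


section \<open>Interpretations and models\<close>

text \<open>
  \<open>ctx_obj I U\<close> with the projections \<open>ctx_proj I U x\<close>, \<open>x \<in> U\<close>, is the product of the sorts
  of the variables in \<open>U\<close>; \<open>ar_obj\<close> and \<open>ar_proj\<close> do the same for lists of sorts.
\<close>

record ('o, 'm, 's, 'f, 'r, 'v) interp =
  sort_obj :: "'s \<Rightarrow> 'o"
  ctx_obj :: "'v set \<Rightarrow> 'o"
  ctx_proj :: "'v set \<Rightarrow> 'v \<Rightarrow> 'm"
  ar_obj :: "'s list \<Rightarrow> 'o"
  ar_proj :: "'s list \<Rightarrow> nat \<Rightarrow> 'm"
  fun_arr :: "'f \<Rightarrow> 'm"
  rel_sub :: "'r \<Rightarrow> 'm"

definition is_interp ::
  "('o, 'm) cat \<Rightarrow> ('s, 'f, 'r, 'v) signature \<Rightarrow> ('o, 'm, 's, 'f, 'r, 'v) interp \<Rightarrow> bool" where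
  "is_interp S L I \<longleftrightarrow>
     (\<forall>s\<in>sorts L. sort_obj I s \<in> Obj S) \<and>
     (\<forall>U. is_ctx L U \<longrightarrow>
        is_product S U (\<lambda>x. sort_obj I (vsort L x)) (ctx_obj I U) (ctx_proj I U)) \<and>
     (\<forall>ss. set ss \<subseteq> sorts L \<longrightarrow>
        is_product S {..<length ss} (\<lambda>i. sort_obj I (ss ! i)) (ar_obj I ss) (ar_proj I ss)) \<and>
     (\<forall>f\<in>funs L. fun_arr I f \<in> Hom S (ar_obj I (fdom L f)) (sort_obj I (fcod L f))) \<and>
     (\<forall>r\<in>rels L. mono_into S (ar_obj I (rdom L r)) (rel_sub I r))"

text \<open>The projection from the context \<open>V\<close> to a smaller context \<open>U\<close>.\<close>

definition restrict ::
  "('o, 'm) cat \<Rightarrow> ('o, 'm, 's, 'f, 'r, 'v) interp \<Rightarrow> 'v set \<Rightarrow> 'v set \<Rightarrow> 'm" where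
  "restrict S I U V = (THE h. h \<in> Hom S (ctx_obj I V) (ctx_obj I U) \<and>
     (\<forall>x\<in>U. ctx_proj I U x \<cdot>\<^bsub>S\<^esub> h = ctx_proj I V x))"

definition ar_tuple ::
  "('o, 'm) cat \<Rightarrow> ('o, 'm, 's, 'f, 'r, 'v) interp \<Rightarrow> 'o \<Rightarrow> 's list \<Rightarrow> 'm list \<Rightarrow> 'm" where
  "ar_tuple S I a ss hs = (THE h. h \<in> Hom S a (ar_obj I ss) \<and>
     (\<forall>i<length ss. ar_proj I ss i \<cdot>\<^bsub>S\<^esub> h = hs ! i))"

fun tm_sem ::
  "('o, 'm) cat \<Rightarrow> ('s, 'f, 'r, 'v) signature \<Rightarrow> ('o, 'm, 's, 'f, 'r, 'v) interp \<Rightarrow>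
   'v set \<Rightarrow> ('f, 'v) tm \<Rightarrow> 'm" where
  "tm_sem S L I U (Var x) = ctx_proj I U x"
| "tm_sem S L I U (Fun f ts) =
     fun_arr I f \<cdot>\<^bsub>S\<^esub> ar_tuple S I (ctx_obj I U) (fdom L f) (map (tm_sem S L I U) ts)"

text \<open>
  In the clause for \<open>Ex\<close>, the bound variable may itself belong to the context \<open>U\<close>. The image is
  therefore taken along the projection to the context \<open>U - {x}\<close> and pulled back to \<open>U\<close>. If
  \<open>x \<notin> U\<close>, this is just the image along the projection to \<open>U\<close>.
\<close>

primrec sem ::
  "('o, 'm) cat \<Rightarrow> ('s, 'f, 'r, 'v) signature \<Rightarrow> ('o, 'm, 's, 'f, 'r, 'v) interp \<Rightarrow>
   ('f, 'r, 'v) fm \<Rightarrow> 'v set \<Rightarrow> 'm" where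
  "sem S L I Top = (\<lambda>U. Ide S (ctx_obj I U))"
| "sem S L I (Rel r ts) = (\<lambda>U. sub_pullback S
     (ar_tuple S I (ctx_obj I U) (rdom L r) (map (tm_sem S L I U) ts)) (rel_sub I r))"
| "sem S L I (Eq s t) = (\<lambda>U. sub_equalizer S (tm_sem S L I U s) (tm_sem S L I U t))"
| "sem S L I (And \<phi> \<psi>) = (\<lambda>U. sub_Inf S (ctx_obj I U) {sem S L I \<phi> U, sem S L I \<psi> U})"
| "sem S L I (Ex x \<phi>) = (\<lambda>U. sub_pullback S (restrict S I (U - {x}) U)
     (sub_image S (restrict S I (U - {x}) (insert x U) \<cdot>\<^bsub>S\<^esub> sem S L I \<phi> (insert x U))))"

definition model ::
  "('o, 'm) cat \<Rightarrow> ('s, 'f, 'r, 'v) signature \<Rightarrow>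
   ('v set \<Rightarrow> ('f, 'r, 'v) fm set \<Rightarrow> ('f, 'r, 'v) fm \<Rightarrow> bool) \<Rightarrow>
   ('o, 'm, 's, 'f, 'r, 'v) interp \<Rightarrow> bool" where
  "model S L E I \<longleftrightarrow> is_interp S L I \<and>
     (\<forall>U \<Gamma> \<phi>. E U \<Gamma> \<phi> \<longrightarrow>
        (\<exists>\<Delta>. finite \<Delta> \<and> \<Delta> \<subseteq> \<Gamma> \<and>
           sub_le S (sub_Inf S (ctx_obj I U) ((\<lambda>\<psi>. sem S L I \<psi> U) ` \<Delta>)) (sem S L I \<phi> U)))"


section \<open>No-signalling subpresheaves\<close>

definition subpresheaf ::
  "('o, 'm) cat \<Rightarrow> ('o, 'm, 's, 'f, 'r, 'v) interp \<Rightarrow> 'v set set \<Rightarrow> ('v set \<Rightarrow> 'm) \<Rightarrow> bool" where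
  "subpresheaf S I K A \<longleftrightarrow>
     (\<forall>U\<in>K. mono_into S (ctx_obj I U) (A U)) \<and>
     (\<forall>V\<in>K. \<forall>U\<in>K. U \<subseteq> V \<longrightarrow> factors S (restrict S I U V \<cdot>\<^bsub>S\<^esub> A V) (A U))"

definition sub_restrict ::
  "('o, 'm) cat \<Rightarrow> ('o, 'm, 's, 'f, 'r, 'v) interp \<Rightarrow> ('v set \<Rightarrow> 'm) \<Rightarrow> 'v set \<Rightarrow> 'v set \<Rightarrow> 'm" where
  "sub_restrict S I A U V = (THE k. k \<in> Hom S (Dom S (A V)) (Dom S (A U)) \<and>
     A U \<cdot>\<^bsub>S\<^esub> k = restrict S I U V \<cdot>\<^bsub>S\<^esub> A V)"

definition no_signalling ::
  "('o, 'm) cat \<Rightarrow> ('o, 'm, 's, 'f, 'r, 'v) interp \<Rightarrow> 'v set set \<Rightarrow> ('v set \<Rightarrow> 'm) \<Rightarrow> bool" where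
  "no_signalling S I K A \<longleftrightarrow> subpresheaf S I K A \<and>
     (\<forall>V\<in>K. \<forall>U\<in>K. U \<subseteq> V \<longrightarrow> regular_epi S (sub_restrict S I A U V))"

definition satisfies ::
  "('o, 'm) cat \<Rightarrow> ('s, 'f, 'r, 'v) signature \<Rightarrow> ('o, 'm, 's, 'f, 'r, 'v) interp \<Rightarrow>
   'v set set \<Rightarrow> ('v set \<Rightarrow> 'm) \<Rightarrow> ('f, 'r, 'v) fm \<Rightarrow> bool" where
  "satisfies S L I K A \<phi> \<longleftrightarrow> (\<forall>U\<in>K. \<phi> \<in> fms L U \<longrightarrow> sub_le S (A U) (sem S L I \<phi> U))"

definition no_signalling_model ::
  "('o, 'm) cat \<Rightarrow> ('s, 'f, 'r, 'v) signature \<Rightarrow> ('o, 'm, 's, 'f, 'r, 'v) interp \<Rightarrow>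
   'v set set \<Rightarrow> ('f, 'r, 'v) fm set \<Rightarrow> ('v set \<Rightarrow> 'm) \<Rightarrow> bool" where
  "no_signalling_model S L I K \<Gamma> A \<longleftrightarrow>
     no_signalling S I K A \<and> (\<forall>\<psi>\<in>\<Gamma>. satisfies S L I K A \<psi>)"

text \<open>
  Validity in the regular categories whose objects and arrows are elements of the types
  \<^typ>\<open>'o\<close> and \<^typ>\<open>'m\<close>; a formula cannot quantify over types. If the types are at least as
  large as the set of sets of formulas, there are enough categories to refute everything
  that is not derivable.
\<close>

definition ns_valid ::
  "('o, 'm) cat itself \<Rightarrow> ('s, 'f, 'r, 'v) signature \<Rightarrow>
   ('v set \<Rightarrow> ('f, 'r, 'v) fm set \<Rightarrow> ('f, 'r, 'v) fm \<Rightarrow> bool) \<Rightarrow>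
   'v set set \<Rightarrow> ('f, 'r, 'v) fm set \<Rightarrow> ('f, 'r, 'v) fm \<Rightarrow> bool" where
  "ns_valid (_ :: ('o, 'm) cat itself) L E K \<Gamma> \<phi> \<longleftrightarrow>
     (\<forall>(S :: ('o, 'm) cat) I A. regular_category S \<and> model S L E I \<and>
        no_signalling_model S L I K \<Gamma> A \<longrightarrow> satisfies S L I K A \<phi>)"

end

theory Submission
  imports Defs
begin

text \<open>
  Soundness: no-signalling moves validity of a formula between any two contexts \<open>U\<close>, \<open>V\<close> of the
  complex that contain its variables. Validity over \<open>U\<close> restricts to \<open>U \<inter> V\<close>, because \<open>A\<^sub>U\<close> covers
  \<open>A\<close> over \<open>U \<inter> V\<close> and regular epimorphisms lift against the monomorphism
  of the formula, and from \<open>U \<inter> V\<close> it pulls back to \<open>V\<close>.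

  Completeness: let \<open>C\<close> be the set of inchworm consequences of \<open>\<Gamma>\<close>. In any set-valued model \<open>M\<close> of the
  theory, the assignments on \<open>U\<close> that satisfy the formulas of \<open>C\<close> in context \<open>U\<close> form a
  no-signalling model: by the finiteness condition these formulas amount over \<open>V\<close> to one formula \<open>\<theta>\<close>, and
  \<open>\<exists>x. \<theta>\<close> belongs to \<open>C\<close>, so assignments extend one variable at a time.
  If \<open>\<phi>\<close> is not in \<open>C\<close>, then it does not follow from the part of \<open>C\<close> in a context of \<open>\<phi>\<close>, and a Henkin
  model provides an \<open>M\<close> and an assignment that refute \<open>\<phi>\<close>. Sets of terms over names, where the names
  are formulas, form a regular category small enough for the given types.
\<close>

section \<open>Subobjects in regular categories\<close>

text \<open>The subobject operations are Hilbert choices, so \<open>sem\<close> is known only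
  through universal properties. Subobjects are therefore compared by generalized elements:
  \<open>classifies\<close> describes which arrows factor through a representative, and the clauses
  of \<open>sem\<close> become forcing clauses, with a cover for each existential. The obstacle in
  the completeness proof is size. The symbols of the language may outnumber its variables, so Henkin
  witnesses cannot all be variables. A witness is instead a formula that records the existential
  fact it serves. Terms over such names code into formulas again, hence sets of terms and functions
  between them fit into the types that the statement assumes. The entailment relation knows only
  variables, however; finite sets of names reach it through renamings, which must avoid capture
  because substitution never renames bound variables. Sorts may be empty and contexts matter, so the
  model contains only terms over the generic names of one context and over witnesses already
  introduced.\<close>

definition classifies :: "('o, 'm) cat \<Rightarrow> 'o \<Rightarrow> 'm \<Rightarrow> ('m \<Rightarrow> bool) \<Rightarrow> bool" where
  "classifies S b m P \<longleftrightarrow> mono_into S b m \<and> (\<forall>Q. \<forall>h\<in>Hom S Q b. factors S h m \<longleftrightarrow> P h)"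

lemma classifiesD:
  assumes "classifies S b m P"
  shows "mono_into S b m" "h \<in> Hom S Q b \<Longrightarrow> factors S h m \<longleftrightarrow> P h"
  using assms by (auto simp: classifies_def)

lemma Hom_iff: "f \<in> Hom S a b \<longleftrightarrow> f \<in> Arr S \<and> Dom S f = a \<and> Cod S f = b"
  by (simp add: Hom_def)

lemma mono_into_Hom: "mono_into S b m \<Longrightarrow> m \<in> Hom S (Dom S m) b"
  by (simp add: mono_into_def Hom_def)

context category
begin

lemma Hom_Obj: "f \<in> Hom S a b \<Longrightarrow> a \<in> Obj S \<and> b \<in> Obj S"
  using Dom_in Cod_in by (auto simp: Hom_def)

lemma mono_cancel:
  "mono_into S b m \<Longrightarrow> u \<in> Hom S a (Dom S m) \<Longrightarrow> v \<in> Hom S a (Dom S m) \<Longrightarrow> m \<cdot> u = m \<cdot> v \<Longrightarrow> u = v"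
  unfolding mono_into_def using Hom_Obj by blast

lemma mono_intoI:
  assumes "m \<in> Hom S d b"
    and "\<And>a u v. u \<in> Hom S a d \<Longrightarrow> v \<in> Hom S a d \<Longrightarrow> m \<cdot> u = m \<cdot> v \<Longrightarrow> u = v"
  shows "mono_into S b m"
  using assms unfolding mono_into_def Hom_def by blast

lemma factors_Cmp:
  assumes "factors S f n" "f \<in> Hom S a b" "n \<in> Hom S c b" "g \<in> Hom S q a"
  shows "factors S (f \<cdot> g) n"
proof -
  obtain k where k: "k \<in> Hom S a c" "n \<cdot> k = f"
    using assms by (auto simp: factors_def Hom_iff)
  have "k \<cdot> g \<in> Hom S q c" "n \<cdot> (k \<cdot> g) = f \<cdot> g" "f \<cdot> g \<in> Hom S q b"
    using Cmp_in[OF assms(4) k(1)] assoc[OF assms(4) k(1) assms(3)] k(2) Cmp_in[OF assms(4,2)] by simp_all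
  then show ?thesis
    using assms by (auto simp: factors_def Hom_iff)
qed

lemma factors_trans:
  assumes "factors S f n" "sub_le S n m" "f \<in> Hom S a b" "n \<in> Hom S c b" "m \<in> Hom S d b"
  shows "factors S f m"
proof -
  obtain k where k: "k \<in> Hom S a c" "n \<cdot> k = f"
    using assms by (auto simp: factors_def Hom_iff)
  with factors_Cmp[OF assms(2,4,5) k(1)] show ?thesis by simp
qed

lemma factors_refl: "m \<in> Hom S a b \<Longrightarrow> factors S m m"
  unfolding factors_def using Ide_in Cmp_Ide Hom_Obj by (metis Hom_iff)

text \<open>Transfers a description from a representative constructed by hand to the one that a
  Hilbert choice returns, which is known only to be equivalent to it.\<close>

lemma classifies_unique:
  assumes m: "classifies S b m P" and n: "mono_into S b n" "sub_le S n m" "sub_le S m n"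
  shows "classifies S b n P"
  unfolding classifies_def
proof (intro conjI n(1) allI ballI)
  fix Q h assume h: "h \<in> Hom S Q b"
  have "factors S h n \<longleftrightarrow> factors S h m"
    using factors_trans[OF _ n(2) h] factors_trans[OF _ n(3) h]
      mono_into_Hom[OF n(1)] mono_into_Hom[OF classifiesD(1)[OF m]] by blast
  then show "factors S h n \<longleftrightarrow> P h"
    using classifiesD(2)[OF m h] by simp
qed

section \<open>Regular epimorphisms and pullbacks by generalized elements\<close>

lemma coequalizer_lift:
  assumes "is_coequalizer S f g e" "e \<in> Hom S a b" "u \<in> Hom S a c" "u \<cdot> f = u \<cdot> g"
  shows "\<exists>!h. h \<in> Hom S b c \<and> h \<cdot> e = u"
proof -
  have "u \<in> Arr S" "Dom S u = Cod S f" "Cod S e = b" "Cod S u = c"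
    using assms by (auto simp: is_coequalizer_def Hom_iff)
  then show ?thesis using assms(1,4) unfolding is_coequalizer_def by blast
qed

text \<open>A regular epimorphism is epic: \<open>u\<close> and \<open>v\<close> both mediate the
  same map out of the coequalizer.\<close>

lemma regular_epi_cancel:
  assumes "regular_epi S e" "e \<in> Hom S a b" "u \<in> Hom S b c" "v \<in> Hom S b c" "u \<cdot> e = v \<cdot> e"
  shows "u = v"
proof -
  obtain f g where fg: "is_coequalizer S f g e" using assms by (auto simp: regular_epi_def)
  then have f: "f \<in> Hom S (Dom S f) a" "g \<in> Hom S (Dom S f) a" "e \<cdot> f = e \<cdot> g"
    using assms by (auto simp: is_coequalizer_def Hom_iff)
  have ue: "u \<cdot> e \<in> Hom S a c" using Cmp_in assms by blast
  have "(u \<cdot> e) \<cdot> f = (u \<cdot> e) \<cdot> g"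
    using assoc[OF f(1) assms(2,3)] assoc[OF f(2) assms(2,3)] f(3) by simp
  then have "\<exists>!h. h \<in> Hom S b c \<and> h \<cdot> e = u \<cdot> e"
    using coequalizer_lift[OF fg assms(2) ue] by blast
  then show ?thesis using assms(3-5) by metis
qed

text \<open>Orthogonality of regular epimorphisms and monomorphisms. The factorization
  \<open>k\<close> of \<open>h \<cdot> e\<close> identifies the pair coequalized by
  \<open>e\<close>, because \<open>h \<cdot> e\<close> does and \<open>n\<close> is monic; so
  \<open>k\<close> descends along \<open>e\<close>.\<close>

lemma regular_epi_lift:
  assumes e: "regular_epi S e" "e \<in> Hom S q' q" and n: "mono_into S b n"
    and h: "h \<in> Hom S q b" and fact: "factors S (h \<cdot> e) n"
  shows "factors S h n"
proof -
  obtain f g where fg: "is_coequalizer S f g e" using e by (auto simp: regular_epi_def)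
  then have f: "f \<in> Hom S (Dom S f) q'" "g \<in> Hom S (Dom S f) q'" "e \<cdot> f = e \<cdot> g"
    using e by (auto simp: is_coequalizer_def Hom_iff)
  have n': "n \<in> Hom S (Dom S n) b" using mono_into_Hom[OF n] .
  have he: "h \<cdot> e \<in> Hom S q' b" using Cmp_in[OF e(2) h] .
  obtain k where k: "k \<in> Hom S q' (Dom S n)" "n \<cdot> k = h \<cdot> e"
    using fact he by (auto simp: factors_def Hom_iff)
  have "n \<cdot> (k \<cdot> f) = n \<cdot> (k \<cdot> g)"
    using assoc[OF f(1) k(1) n'] assoc[OF f(2) k(1) n'] k(2)
      assoc[OF f(1) e(2) h] assoc[OF f(2) e(2) h] f(3) by simp
  then have "k \<cdot> f = k \<cdot> g"
    using mono_cancel[OF n] Cmp_in[OF f(1) k(1)] Cmp_in[OF f(2) k(1)] by blast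
  then have "\<exists>!u. u \<in> Hom S q (Dom S n) \<and> u \<cdot> e = k"
    using coequalizer_lift[OF fg e(2) k(1)] by blast
  then obtain u where u: "u \<in> Hom S q (Dom S n)" "u \<cdot> e = k" by blast
  have "(n \<cdot> u) \<cdot> e = h \<cdot> e"
    using assoc[OF e(2) u(1) n'] u(2) k(2) by simp
  then have "n \<cdot> u = h"
    using regular_epi_cancel[OF e] Cmp_in[OF u(1) n'] h by blast
  then show ?thesis using u h by (auto simp: factors_def Hom_iff)
qed

lemma is_pullbackD:
  assumes "is_pullback S f g p q" "f \<in> Hom S a c" "g \<in> Hom S b c"
  shows "p \<in> Hom S (Dom S p) a" "q \<in> Hom S (Dom S p) b" "f \<cdot> p = g \<cdot> q"
    and "u \<in> Hom S Q a \<Longrightarrow> v \<in> Hom S Q b \<Longrightarrow> f \<cdot> u = g \<cdot> v \<Longrightarrow>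
       \<exists>!h. h \<in> Hom S Q (Dom S p) \<and> p \<cdot> h = u \<and> q \<cdot> h = v"
proof -
  have ab: "Dom S f = a" "Dom S g = b" using assms by (auto simp: Hom_iff)
  with assms(1) obtain P where P: "p \<in> Hom S P a" "q \<in> Hom S P b" "f \<cdot> p = g \<cdot> q"
    "\<forall>Q\<in>Obj S. \<forall>u\<in>Hom S Q a. \<forall>v\<in>Hom S Q b. f \<cdot> u = g \<cdot> v \<longrightarrow>
           (\<exists>!h. h \<in> Hom S Q P \<and> p \<cdot> h = u \<and> q \<cdot> h = v)"
    unfolding is_pullback_def by auto
  have d: "Dom S p = P" using P(1) by (simp add: Hom_iff)
  show "p \<in> Hom S (Dom S p) a" "q \<in> Hom S (Dom S p) b" "f \<cdot> p = g \<cdot> q"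
    using P d by simp_all
  show "\<exists>!h. h \<in> Hom S Q (Dom S p) \<and> p \<cdot> h = u \<and> q \<cdot> h = v"
    if "u \<in> Hom S Q a" "v \<in> Hom S Q b" "f \<cdot> u = g \<cdot> v"
  proof -
    have "Q \<in> Obj S" using Hom_Obj that(1) by blast
    then show ?thesis using P(4) that d by blast
  qed
qed

lemma pullback_of_mono_classifies:
  assumes pb: "is_pullback S f m p q" and f: "f \<in> Hom S a b" and m: "mono_into S b m"
  shows "classifies S a p (\<lambda>h. factors S (f \<cdot> h) m)"
proof -
  note m' = mono_into_Hom[OF m]
  define P where "P = Dom S p"
  note P = is_pullbackD(1-3)[OF pb f m', folded P_def]
    and lift = is_pullbackD(4)[OF pb f m', folded P_def]
  have mono: "mono_into S a p"
  proof (rule mono_intoI[OF P(1)])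
    fix c u v assume uv: "u \<in> Hom S c P" "v \<in> Hom S c P" and eq: "p \<cdot> u = p \<cdot> v"
    have "m \<cdot> (q \<cdot> u) = m \<cdot> (q \<cdot> v)"
      using assoc[OF uv(1) P(2) m'] assoc[OF uv(2) P(2) m'] P(3)
        assoc[OF uv(1) P(1) f] assoc[OF uv(2) P(1) f] eq by simp
    then have q: "q \<cdot> u = q \<cdot> v"
      using mono_cancel[OF m] Cmp_in uv P(2) by blast
    have "f \<cdot> (p \<cdot> u) = m \<cdot> (q \<cdot> u)"
      using assoc[OF uv(1) P(2) m'] P(3) assoc[OF uv(1) P(1) f] by simp
    from lift[OF Cmp_in[OF uv(1) P(1)] Cmp_in[OF uv(1) P(2)] this]
    show "u = v" using uv eq q by metis
  qed
  have "factors S h p \<longleftrightarrow> factors S (f \<cdot> h) m" if h: "h \<in> Hom S Q a" for Q h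
  proof
    assume "factors S h p"
    then obtain k where k: "k \<in> Hom S Q P" "p \<cdot> k = h"
      using h P by (auto simp: factors_def Hom_iff)
    have "f \<cdot> h = m \<cdot> (q \<cdot> k)"
      using assoc[OF k(1) P(1) f] assoc[OF k(1) P(2) m'] k(2) P(3) by simp
    then show "factors S (f \<cdot> h) m"
      using Cmp_in[OF h f] Cmp_in[OF k(1) P(2)] by (auto simp: factors_def Hom_iff)
  next
    assume "factors S (f \<cdot> h) m"
    then obtain k where k: "k \<in> Hom S Q (Dom S m)" "m \<cdot> k = f \<cdot> h"
      using Cmp_in[OF h f] by (auto simp: factors_def Hom_iff)
    from lift[OF h k(1)] k(2) obtain u where "u \<in> Hom S Q P" "p \<cdot> u = h" by metis
    then show "factors S h p"
      using h P by (auto simp: factors_def Hom_iff)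
  qed
  with mono show ?thesis by (simp add: classifies_def)
qed

end

section \<open>Images, meets and equalizers in a regular category\<close>

context regular_category
begin

lemma pullback_exists:
  assumes "f \<in> Hom S a c" "g \<in> Hom S b c"
  obtains p q where "is_pullback S f g p q"
  using pullbacks[of f g] assms that by (auto simp: Hom_iff)

lemma regular_epi_pullback:
  assumes e: "regular_epi S e" "e \<in> Hom S b c" and u: "u \<in> Hom S a c"
  obtains P r v where "r \<in> Hom S P a" "v \<in> Hom S P b" "u \<cdot> r = e \<cdot> v" "regular_epi S r"
proof -
  obtain p q where pb: "is_pullback S u e p q" using pullback_exists[OF u e(2)] .
  then show ?thesis
    using that[OF is_pullbackD(1-3)[OF pb u e(2)]] regular_epi_stable[OF pb e(1)] by blast
qed

text \<open>The image is the coequalizer of the kernel pair. That the induced \<open>m\<close> is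
  monic rests on the stability of regular epimorphisms under pullback.\<close>

lemma image_factorization:
  assumes f: "f \<in> Hom S a b"
  obtains c e m where "e \<in> Hom S a c" "regular_epi S e" "mono_into S b m" "m \<in> Hom S c b" "m \<cdot> e = f"
proof -
  obtain p q where pb: "is_pullback S f f p q" using pullback_exists[OF f f] .
  define P where "P = Dom S p"
  note P = is_pullbackD(1-3)[OF pb f f, folded P_def]
    and lift = is_pullbackD(4)[OF pb f f, folded P_def]
  obtain e where co: "is_coequalizer S p q e" using kernel_pair_coequalizer[OF pb] by blast
  then have re: "regular_epi S e" by (auto simp: regular_epi_def)
  obtain c where e: "e \<in> Hom S a c" and epq: "e \<cdot> p = e \<cdot> q"
    using co P by (auto simp: is_coequalizer_def Hom_iff)
  have "\<exists>!m. m \<in> Hom S c b \<and> m \<cdot> e = f"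
    using coequalizer_lift[OF co e f P(3)] .
  then obtain m where m: "m \<in> Hom S c b" "m \<cdot> e = f" by blast
  have "mono_into S b m"
  proof (rule mono_intoI[OF m(1)])
    fix z u v assume uv: "u \<in> Hom S z c" "v \<in> Hom S z c" and eq: "m \<cdot> u = m \<cdot> v"
    \<comment> \<open>\<open>u\<close> and \<open>v\<close> need not lift along \<open>e\<close>,
      but they do on a cover: \<open>z1\<close> serves \<open>u\<close>, and \<open>z2\<close> over
      it serves \<open>v\<close>. There the lifts \<open>u' \<cdot> r2\<close> and \<open>v'\<close>
      agree under \<open>f\<close>, so they come from the kernel pair and \<open>e\<close>
      identifies them.\<close>
    obtain z1 r1 u' where 1: "r1 \<in> Hom S z1 z" "u' \<in> Hom S z1 a" "u \<cdot> r1 = e \<cdot> u'" "regular_epi S r1"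
      using regular_epi_pullback[OF re e uv(1)] .
    have vr: "v \<cdot> r1 \<in> Hom S z1 c" "u \<cdot> r1 \<in> Hom S z1 c" using Cmp_in[OF 1(1)] uv by auto
    obtain z2 r2 v' where 2: "r2 \<in> Hom S z2 z1" "v' \<in> Hom S z2 a" "(v \<cdot> r1) \<cdot> r2 = e \<cdot> v'" "regular_epi S r2"
      using regular_epi_pullback[OF re e vr(1)] .
    have ur: "u' \<cdot> r2 \<in> Hom S z2 a" using Cmp_in[OF 2(1) 1(2)] .
    have "f \<cdot> (u' \<cdot> r2) = m \<cdot> (e \<cdot> (u' \<cdot> r2))" using assoc[OF ur e m(1)] m(2) by simp
    also have "e \<cdot> (u' \<cdot> r2) = (u \<cdot> r1) \<cdot> r2" using assoc[OF 2(1) 1(2) e] 1(3) by simp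
    also have "m \<cdot> \<dots> = (m \<cdot> (u \<cdot> r1)) \<cdot> r2" using assoc[OF 2(1) vr(2) m(1)] .
    also have "m \<cdot> (u \<cdot> r1) = m \<cdot> (v \<cdot> r1)"
      using assoc[OF 1(1) uv(1) m(1)] assoc[OF 1(1) uv(2) m(1)] eq by simp
    also have "\<dots> \<cdot> r2 = m \<cdot> (e \<cdot> v')" using assoc[OF 2(1) vr(1) m(1)] 2(3) by simp
    also have "\<dots> = f \<cdot> v'" using assoc[OF 2(2) e m(1)] m(2) by simp
    finally obtain h where h: "h \<in> Hom S z2 P" "p \<cdot> h = u' \<cdot> r2" "q \<cdot> h = v'"
      using lift[OF ur 2(2)] by metis
    have "(u \<cdot> r1) \<cdot> r2 = e \<cdot> (p \<cdot> h)" using assoc[OF 2(1) 1(2) e] 1(3) h(2) by simp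
    also have "\<dots> = e \<cdot> (q \<cdot> h)" using assoc[OF h(1) P(1) e] assoc[OF h(1) P(2) e] epq by simp
    also have "\<dots> = (v \<cdot> r1) \<cdot> r2" using 2(3) h(3) by simp
    finally have "u \<cdot> r1 = v \<cdot> r1" using regular_epi_cancel[OF 2(4,1) vr(2,1)] by simp
    then show "u = v" using regular_epi_cancel[OF 1(4,1) uv] by simp
  qed
  then show ?thesis using that[OF e re _ m] by blast
qed

lemma sub_pullback_classifies:
  assumes f: "f \<in> Hom S a b" and m: "mono_into S b m"
  shows "classifies S a (sub_pullback S f m) (\<lambda>h. factors S (f \<cdot> h) m)"
proof -
  obtain p q where "is_pullback S f m p q" using pullback_exists[OF f mono_into_Hom[OF m]] .
  then have "\<exists>q. is_pullback S f m (sub_pullback S f m) q"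
    unfolding sub_pullback_def by (intro someI_ex[of "\<lambda>p. \<exists>q. is_pullback S f m p q"]) blast
  then show ?thesis using pullback_of_mono_classifies f m by blast
qed

lemma finite_meet_classifies:
  assumes "finite M" "\<And>n. n \<in> M \<Longrightarrow> mono_into S b n" and b: "b \<in> Obj S"
  shows "\<exists>m. classifies S b m (\<lambda>h. \<forall>n\<in>M. factors S h n)"
  using assms(1,2)
proof (induction M)
  case empty
  have i: "Ide S b \<in> Hom S b b" using Ide_in[OF b] .
  have "mono_into S b (Ide S b)"
    by (rule mono_intoI[OF i]) (metis Ide_Cmp)
  moreover have "factors S h (Ide S b)" if "h \<in> Hom S Q b" for Q h
    using that i Ide_Cmp[OF that] by (auto simp: factors_def Hom_iff)
  ultimately have "classifies S b (Ide S b) (\<lambda>h. \<forall>n\<in>{}. factors S h n)"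
    by (auto simp: classifies_def)
  then show ?case by blast
next
  case (insert n M)
  then obtain m where m: "classifies S b m (\<lambda>h. \<forall>n\<in>M. factors S h n)" by blast
  note mm = classifiesD(1)[OF m] and n = insert.prems[of n, simplified]
  note m' = mono_into_Hom[OF mm] and n' = mono_into_Hom[OF n]
  \<comment> \<open>The new meet is \<open>m \<cdot> p\<close>, with \<open>p\<close> the pullback
    of \<open>n\<close> along the meet \<open>m\<close> of the other subobjects.\<close>
  obtain p q where pb: "is_pullback S m n p q" using pullback_exists[OF m' n'] .
  have p: "classifies S (Dom S m) p (\<lambda>h. factors S (m \<cdot> h) n)"
    using pullback_of_mono_classifies[OF pb m' n] .
  note pm = classifiesD(1)[OF p]
  note p' = mono_into_Hom[OF pm]
  have mp: "m \<cdot> p \<in> Hom S (Dom S p) b" using Cmp_in[OF p' m'] .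
  have "mono_into S b (m \<cdot> p)"
  proof (rule mono_intoI[OF mp])
    fix c u v assume uv: "u \<in> Hom S c (Dom S p)" "v \<in> Hom S c (Dom S p)" and "m \<cdot> p \<cdot> u = m \<cdot> p \<cdot> v"
    then have "m \<cdot> (p \<cdot> u) = m \<cdot> (p \<cdot> v)" using assoc[OF uv(1) p' m'] assoc[OF uv(2) p' m'] by simp
    then have "p \<cdot> u = p \<cdot> v"
      using mono_cancel[OF mm] Cmp_in[OF uv(1) p'] Cmp_in[OF uv(2) p'] by blast
    then show "u = v" using mono_cancel[OF pm] uv by blast
  qed
  moreover have "factors S h (m \<cdot> p) \<longleftrightarrow> (\<forall>k\<in>insert n M. factors S h k)" if h: "h \<in> Hom S Q b" for Q h
  proof -
    have "factors S h (m \<cdot> p) \<longleftrightarrow> factors S h m \<and> factors S h n"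
    proof
      assume "factors S h (m \<cdot> p)"
      then obtain k where k: "k \<in> Hom S Q (Dom S p)" "m \<cdot> p \<cdot> k = h"
        using h mp by (auto simp: factors_def Hom_iff)
      have pk: "p \<cdot> k \<in> Hom S Q (Dom S m)" using Cmp_in[OF k(1) p'] .
      have hm: "m \<cdot> (p \<cdot> k) = h" using assoc[OF k(1) p' m'] k(2) by simp
      have "factors S (p \<cdot> k) p" using pk k(1) by (auto simp: factors_def Hom_iff)
      then have "factors S h n" using classifiesD(2)[OF p pk] hm by simp
      then show "factors S h m \<and> factors S h n"
        using hm pk h by (auto simp: factors_def Hom_iff)
    next
      assume a: "factors S h m \<and> factors S h n"
      then obtain k where k: "k \<in> Hom S Q (Dom S m)" "m \<cdot> k = h"
        using h by (auto simp: factors_def Hom_iff)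
      then have "factors S k p" using classifiesD(2)[OF p k(1)] a by simp
      then obtain l where l: "l \<in> Hom S Q (Dom S p)" "p \<cdot> l = k"
        using k by (auto simp: factors_def Hom_iff)
      have "m \<cdot> p \<cdot> l = h" using assoc[OF l(1) p' m'] l(2) k(2) by simp
      then show "factors S h (m \<cdot> p)" using l mp h by (auto simp: factors_def Hom_iff)
    qed
    then show ?thesis using classifiesD(2)[OF m h] by auto
  qed
  ultimately have "classifies S b (m \<cdot> p) (\<lambda>h. \<forall>k\<in>insert n M. factors S h k)"
    by (simp add: classifies_def)
  then show ?case by blast
qed

lemma sub_Inf_classifies:
  assumes M: "finite M" "\<And>n. n \<in> M \<Longrightarrow> mono_into S b n" and b: "b \<in> Obj S"
  shows "classifies S b (sub_Inf S b M) (\<lambda>h. \<forall>n\<in>M. factors S h n)"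
proof -
  obtain m where m: "classifies S b m (\<lambda>h. \<forall>n\<in>M. factors S h n)"
    using finite_meet_classifies[OF M b] by blast
  let ?P = "\<lambda>m. mono_into S b m \<and> (\<forall>n\<in>M. sub_le S m n) \<and>
     (\<forall>k. mono_into S b k \<and> (\<forall>n\<in>M. sub_le S k n) \<longrightarrow> sub_le S k m)"
  note mm = classifiesD(1)[OF m]
  have lb: "\<forall>n\<in>M. sub_le S m n"
    using classifiesD(2)[OF m mono_into_Hom[OF mm]] factors_refl[OF mono_into_Hom[OF mm]] by simp
  have gr: "sub_le S k m" if "mono_into S b k" "\<forall>n\<in>M. sub_le S k n" for k
    using classifiesD(2)[OF m mono_into_Hom[OF that(1)]] that(2) by simp
  have "?P m" using mm lb gr by blast
  then have P: "?P (sub_Inf S b M)" unfolding sub_Inf_def by (rule someI[of ?P])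
  show ?thesis
    using P lb mm gr by (intro classifies_unique[OF m]) blast+
qed

text \<open>Finite limits are given by a terminal object and pullbacks only. The product of
  \<open>a\<close> and \<open>b\<close> is a pullback over the terminal object, and the equalizer is
  the pullback of the graphs \<open>u\<close> of \<open>f\<close> and \<open>v\<close> of
  \<open>g\<close>. Its two legs agree since \<open>p\<close> retracts both graphs.\<close>

lemma equalizer_exists:
  assumes f: "f \<in> Hom S a b" and g: "g \<in> Hom S a b"
  shows "\<exists>e. is_equalizer S f g e"
proof -
  have obj: "a \<in> Obj S" "b \<in> Obj S" using Hom_Obj[OF f] by auto
  obtain t where t: "is_terminal S t" using terminal by blast
  then obtain ta tb where ta: "ta \<in> Hom S a t" and tb: "tb \<in> Hom S b t"
    using obj unfolding is_terminal_def by metis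
  obtain p q where pb: "is_pullback S ta tb p q" using pullback_exists[OF ta tb] .
  define P where "P = Dom S p"
  note P = is_pullbackD(1-3)[OF pb ta tb, folded P_def]
    and lift = is_pullbackD(4)[OF pb ta tb, folded P_def]
  have pair: "\<exists>!h. h \<in> Hom S Q P \<and> p \<cdot> h = u \<and> q \<cdot> h = v"
    if "u \<in> Hom S Q a" "v \<in> Hom S Q b" for Q u v
  proof -
    have "ta \<cdot> u \<in> Hom S Q t" "tb \<cdot> v \<in> Hom S Q t" "Q \<in> Obj S"
      using Cmp_in that ta tb Hom_Obj by blast+
    then have "ta \<cdot> u = tb \<cdot> v" using t unfolding is_terminal_def by blast
    then show ?thesis using lift that by blast
  qed
  have i: "Ide S a \<in> Hom S a a" using Ide_in obj by blast
  obtain u where u: "u \<in> Hom S a P" "p \<cdot> u = Ide S a" "q \<cdot> u = f" using pair[OF i f] by blast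
  obtain v where v: "v \<in> Hom S a P" "p \<cdot> v = Ide S a" "q \<cdot> v = g" using pair[OF i g] by blast
  obtain r s where pb2: "is_pullback S u v r s" using pullback_exists[OF u(1) v(1)] .
  define R where "R = Dom S r"
  note R = is_pullbackD(1-3)[OF pb2 u(1) v(1), folded R_def]
    and lift2 = is_pullbackD(4)[OF pb2 u(1) v(1), folded R_def]
  have pw: "p \<cdot> (u \<cdot> k) = k" "q \<cdot> (u \<cdot> k) = f \<cdot> k" "p \<cdot> (v \<cdot> k) = k" "q \<cdot> (v \<cdot> k) = g \<cdot> k"
    if k: "k \<in> Hom S Q a" for Q k
    using assoc[OF k u(1) P(1)] assoc[OF k u(1) P(2)] assoc[OF k v(1) P(1)] assoc[OF k v(1) P(2)]
      u v Ide_Cmp[OF k] by simp_all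
  have rs: "r = s" using pw(1)[OF R(1)] pw(3)[OF R(2)] R(3) by simp
  have "f \<cdot> r = g \<cdot> r" using pw(2)[OF R(1)] pw(4)[OF R(2)] R(3) rs by simp
  moreover have "\<exists>!h. h \<in> Hom S Q R \<and> r \<cdot> h = k" if k: "k \<in> Hom S Q a" and eq: "f \<cdot> k = g \<cdot> k" for Q k
  proof -
    have fk: "f \<cdot> k \<in> Hom S Q b" using Cmp_in[OF k f] .
    have "u \<cdot> k \<in> Hom S Q P" "v \<cdot> k \<in> Hom S Q P" using Cmp_in k u(1) v(1) by blast+
    then have "u \<cdot> k = v \<cdot> k" using pair[OF k fk] pw[OF k] eq by metis
    then show ?thesis using lift2[OF k k] rs by simp
  qed
  ultimately have "is_equalizer S f g r"
    unfolding is_equalizer_def using f g R by (auto simp: Hom_iff)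
  then show ?thesis by blast
qed

lemma sub_equalizer_classifies:
  assumes f: "f \<in> Hom S a b" and g: "g \<in> Hom S a b"
  shows "classifies S a (sub_equalizer S f g) (\<lambda>h. f \<cdot> h = g \<cdot> h)"
proof -
  define e where "e = sub_equalizer S f g"
  have "is_equalizer S f g e"
    unfolding e_def sub_equalizer_def using equalizer_exists[OF f g] by (rule someI_ex)
  then have e: "e \<in> Hom S (Dom S e) a" "f \<cdot> e = g \<cdot> e"
    and lift: "\<And>Q u. u \<in> Hom S Q a \<Longrightarrow> f \<cdot> u = g \<cdot> u \<Longrightarrow> \<exists>!h. h \<in> Hom S Q (Dom S e) \<and> e \<cdot> h = u"
    using f by (auto simp: is_equalizer_def Hom_iff)
  have fe: "f \<cdot> (e \<cdot> u) = g \<cdot> (e \<cdot> u)" if "u \<in> Hom S Q (Dom S e)" for Q u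
    using assoc[OF that e(1) f] assoc[OF that e(1) g] e(2) by simp
  have "mono_into S a e"
    by (rule mono_intoI[OF e(1)]) (metis lift fe Cmp_in e(1))
  moreover have "factors S h e \<longleftrightarrow> f \<cdot> h = g \<cdot> h" if h: "h \<in> Hom S Q a" for Q h
  proof -
    have "Dom S h = Q" using h by (simp add: Hom_iff)
    then show ?thesis unfolding factors_def using lift[OF h] fe by metis
  qed
  ultimately show ?thesis by (simp add: classifies_def e_def)
qed

text \<open>Existence is local in a regular category: an element of the image comes from
  \<open>a\<close> only on a cover, obtained by pulling back the regular epimorphism of the
  factorization. Conversely, a factorization on a cover descends by
  \<open>regular_epi_lift\<close>.\<close>

lemma sub_image_classifies:
  assumes f: "f \<in> Hom S a b"
  shows "classifies S b (sub_image S f)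
    (\<lambda>h. \<exists>e k. regular_epi S e \<and> e \<in> Hom S (Dom S e) (Dom S h) \<and> k \<in> Hom S (Dom S e) a \<and> f \<cdot> k = h \<cdot> e)"
    (is "classifies S b _ ?Q")
proof -
  let ?P = "\<lambda>m. mono_into S (Cod S f) m \<and> factors S f m \<and>
     (\<forall>n. mono_into S (Cod S f) n \<and> factors S f n \<longrightarrow> sub_le S m n)"
  have cod: "Cod S f = b" using f by (simp add: Hom_iff)
  obtain c e m where e: "e \<in> Hom S a c" "regular_epi S e" and mm: "mono_into S b m"
    and m: "m \<in> Hom S c b" "m \<cdot> e = f"
    using image_factorization[OF f] .
  have fm: "factors S f m" using f m e by (auto simp: factors_def Hom_iff)
  have min: "sub_le S m n" if "mono_into S b n" "factors S f n" for n
    using regular_epi_lift[OF e(2,1) that(1) m(1)] that(2) m(2) by simp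
  have "?P m" using mm fm min cod by blast
  then have P: "?P (sub_image S f)" unfolding sub_image_def by (rule someI[of ?P])
  have "factors S h m \<longleftrightarrow> ?Q h" if h: "h \<in> Hom S Q b" for Q h
  proof
    assume "factors S h m"
    then obtain l where l: "l \<in> Hom S Q c" "m \<cdot> l = h" using h m by (auto simp: factors_def Hom_iff)
    obtain R r v where r: "r \<in> Hom S R Q" "v \<in> Hom S R a" "l \<cdot> r = e \<cdot> v" "regular_epi S r"
      using regular_epi_pullback[OF e(2,1) l(1)] .
    have "f \<cdot> v = h \<cdot> r" using assoc[OF r(1) l(1) m(1)] assoc[OF r(2) e(1) m(1)] r(3) m(2) l(2) by simp
    then show "?Q h" using r h by (auto simp: Hom_iff)
  next
    assume "?Q h"
    then obtain r k where r: "regular_epi S r" "r \<in> Hom S (Dom S r) Q" "k \<in> Hom S (Dom S r) a" "f \<cdot> k = h \<cdot> r"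
      using h by (auto simp: Hom_iff)
    have "factors S (h \<cdot> r) m" using factors_Cmp[OF fm f m(1) r(3)] r(4) by simp
    then show "factors S h m" using regular_epi_lift[OF r(1,2) mm h] by blast
  qed
  then have "classifies S b m ?Q" using mm by (simp add: classifies_def)
  then show ?thesis by (rule classifies_unique) (use P cod mm fm min in blast)+
qed

end

section \<open>Generalized elements of formulas\<close>

lemma (in category) product_eqI:
  assumes "is_product S J D P p" "h \<in> Hom S Q P" "h' \<in> Hom S Q P"
    and "\<And>i. i \<in> J \<Longrightarrow> p i \<cdot> h = p i \<cdot> h'"
  shows "h = h'"
proof -
  have "\<forall>i\<in>J. p i \<in> Hom S P (D i)" using assms(1) by (simp add: is_product_def)
  then have "\<forall>i\<in>J. p i \<cdot> h \<in> Hom S Q (D i)" using Cmp_in assms(2) by blast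
  then have "\<exists>!k. k \<in> Hom S Q P \<and> (\<forall>i\<in>J. p i \<cdot> k = p i \<cdot> h)"
    using assms(1) Hom_Obj[OF assms(2)] by (simp add: is_product_def)
  then show ?thesis using assms by metis
qed

lemma (in category) product_tuple:
  assumes "is_product S J D P p" "Q \<in> Obj S" "\<And>i. i \<in> J \<Longrightarrow> q i \<in> Hom S Q (D i)"
  obtains h where "h \<in> Hom S Q P" "\<And>i. i \<in> J \<Longrightarrow> p i \<cdot> h = q i"
  using assms unfolding is_product_def by blast

locale interpretation_of = regular_category S + language L
  for S :: "('o, 'm) cat" (structure) and L :: "('s, 'f, 'r, 'v) signature" +
  fixes I :: "('o, 'm, 's, 'f, 'r, 'v) interp"
  assumes interp: "is_interp S L I"
begin

section \<open>Contexts, tuples and terms\<close>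

lemma ctx_subset: "is_ctx L V \<Longrightarrow> U \<subseteq> V \<Longrightarrow> is_ctx L U"
  by (auto simp: is_ctx_def intro: finite_subset)

lemma ctx_insert: "is_ctx L U \<Longrightarrow> x \<in> vars L \<Longrightarrow> is_ctx L (insert x U)"
  by (auto simp: is_ctx_def)

lemma ctx_product:
  "is_ctx L U \<Longrightarrow> is_product S U (\<lambda>x. sort_obj I (vsort L x)) (ctx_obj I U) (ctx_proj I U)"
  using interp by (simp add: is_interp_def)

lemma ctx_obj_in: "is_ctx L U \<Longrightarrow> ctx_obj I U \<in> Obj S"
  using ctx_product by (auto simp: is_product_def)

lemma ctx_proj_in: "is_ctx L U \<Longrightarrow> x \<in> U \<Longrightarrow> ctx_proj I U x \<in> Hom S (ctx_obj I U) (sort_obj I (vsort L x))"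
  using ctx_product by (auto simp: is_product_def)

lemma restrict_props:
  assumes V: "is_ctx L V" and "U \<subseteq> V"
  shows restrict_in: "restrict S I U V \<in> Hom S (ctx_obj I V) (ctx_obj I U)"
    and proj_restrict: "\<And>x. x \<in> U \<Longrightarrow> ctx_proj I U x \<cdot> restrict S I U V = ctx_proj I V x"
proof -
  have U: "is_ctx L U" using ctx_subset assms .
  have "\<exists>!h. h \<in> Hom S (ctx_obj I V) (ctx_obj I U) \<and> (\<forall>x\<in>U. ctx_proj I U x \<cdot> h = ctx_proj I V x)"
    using ctx_product[OF U] ctx_obj_in[OF V] ctx_proj_in[OF V] assms(2)
    unfolding is_product_def by blast
  from theI'[OF this] show "restrict S I U V \<in> Hom S (ctx_obj I V) (ctx_obj I U)"
    "\<And>x. x \<in> U \<Longrightarrow> ctx_proj I U x \<cdot> restrict S I U V = ctx_proj I V x"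
    unfolding restrict_def by blast+
qed

lemma proj_restrict_Cmp:
  assumes "is_ctx L V" "U \<subseteq> V" "h \<in> Hom S Q (ctx_obj I V)" "x \<in> U"
  shows "ctx_proj I U x \<cdot> (restrict S I U V \<cdot> h) = ctx_proj I V x \<cdot> h"
  using assoc[OF assms(3) restrict_in[OF assms(1,2)] ctx_proj_in[OF ctx_subset[OF assms(1,2)] assms(4)]]
    proj_restrict[OF assms(1,2,4)] by simp

lemma ar_product:
  "set ss \<subseteq> sorts L \<Longrightarrow>
   is_product S {..<length ss} (\<lambda>i. sort_obj I (ss ! i)) (ar_obj I ss) (ar_proj I ss)"
  using interp by (simp add: is_interp_def)

lemma ar_tuple_props:
  assumes ss: "set ss \<subseteq> sorts L" and a: "a \<in> Obj S"
    and hs: "\<And>i. i < length ss \<Longrightarrow> hs ! i \<in> Hom S a (sort_obj I (ss ! i))"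
  shows ar_tuple_in: "ar_tuple S I a ss hs \<in> Hom S a (ar_obj I ss)"
    and proj_ar_tuple: "\<And>i. i < length ss \<Longrightarrow> ar_proj I ss i \<cdot> ar_tuple S I a ss hs = hs ! i"
proof -
  have "\<exists>!h. h \<in> Hom S a (ar_obj I ss) \<and> (\<forall>i\<in>{..<length ss}. ar_proj I ss i \<cdot> h = hs ! i)"
    using ar_product[OF ss] a hs unfolding is_product_def by blast
  then have "\<exists>!h. h \<in> Hom S a (ar_obj I ss) \<and> (\<forall>i<length ss. ar_proj I ss i \<cdot> h = hs ! i)"
    unfolding Ball_def lessThan_iff .
  from theI'[OF this] show "ar_tuple S I a ss hs \<in> Hom S a (ar_obj I ss)"
    "\<And>i. i < length ss \<Longrightarrow> ar_proj I ss i \<cdot> ar_tuple S I a ss hs = hs ! i"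
    unfolding ar_tuple_def by blast+
qed

lemma ar_proj_in:
  "set ss \<subseteq> sorts L \<Longrightarrow> i < length ss \<Longrightarrow> ar_proj I ss i \<in> Hom S (ar_obj I ss) (sort_obj I (ss ! i))"
  using ar_product by (auto simp: is_product_def)

lemma tm_sem_in:
  assumes U: "is_ctx L U"
  shows "tm_wf L t \<Longrightarrow> tm_fv t \<subseteq> U \<Longrightarrow> tm_sem S L I U t \<in> Hom S (ctx_obj I U) (sort_obj I (tm_sort L t))"
proof (induction t)
  case (Var x)
  then show ?case using ctx_proj_in[OF U] by simp
next
  case (Fun f ts)
  then have f: "f \<in> funs L" and ts: "map (tm_sort L) ts = fdom L f" by auto
  have len: "length ts = length (fdom L f)" using arg_cong[OF ts, of length] by simp
  have "fun_arr I f \<in> Hom S (ar_obj I (fdom L f)) (sort_obj I (fcod L f))"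
    using interp f by (simp add: is_interp_def)
  moreover have "map (tm_sem S L I U) ts ! i \<in> Hom S (ctx_obj I U) (sort_obj I (fdom L f ! i))"
    if i: "i < length (fdom L f)" for i
  proof -
    have "ts ! i \<in> set ts" using i len by simp
    moreover have "fdom L f ! i = tm_sort L (ts ! i)" using i len ts by (metis nth_map)
    moreover have "tm_fv (ts ! i) \<subseteq> U" using calculation(1) Fun.prems(2) by auto
    ultimately show ?thesis using Fun i len by auto
  qed
  ultimately show ?case
    using Cmp_in[OF ar_tuple_in[OF fdom_in[OF f] ctx_obj_in[OF U]]] by simp
qed

lemma args_in:
  assumes U: "is_ctx L U" and ts: "\<And>t. t \<in> set ts \<Longrightarrow> tm_wf L t \<and> tm_fv t \<subseteq> U"
    and ss: "map (tm_sort L) ts = ss" and i: "i < length ss"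
  shows "map (tm_sem S L I U) ts ! i \<in> Hom S (ctx_obj I U) (sort_obj I (ss ! i))"
    and "length ts = length ss" and "ts ! i \<in> set ts"
proof -
  show len: "length ts = length ss" using arg_cong[OF ss, of length] by simp
  show t: "ts ! i \<in> set ts" using i len by simp
  moreover have "ss ! i = tm_sort L (ts ! i)" using i len ss by (metis nth_map)
  ultimately show "map (tm_sem S L I U) ts ! i \<in> Hom S (ctx_obj I U) (sort_obj I (ss ! i))"
    using tm_sem_in[OF U] ts i len by simp
qed

lemma args_tuple_in:
  assumes "is_ctx L U" "\<And>t. t \<in> set ts \<Longrightarrow> tm_wf L t \<and> tm_fv t \<subseteq> U"
    and "map (tm_sort L) ts = ss" "set ss \<subseteq> sorts L"
  shows "ar_tuple S I (ctx_obj I U) ss (map (tm_sem S L I U) ts) \<in> Hom S (ctx_obj I U) (ar_obj I ss)"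
  using ar_tuple_in[OF assms(4) ctx_obj_in[OF assms(1)]] args_in(1)[OF assms(1-3)] by simp

lemma proj_args_tuple_Cmp:
  assumes "is_ctx L U" "\<And>t. t \<in> set ts \<Longrightarrow> tm_wf L t \<and> tm_fv t \<subseteq> U"
    and "map (tm_sort L) ts = ss" "set ss \<subseteq> sorts L" "h \<in> Hom S Q (ctx_obj I U)" "i < length ss"
  shows "ar_proj I ss i \<cdot> (ar_tuple S I (ctx_obj I U) ss (map (tm_sem S L I U) ts) \<cdot> h) =
    tm_sem S L I U (ts ! i) \<cdot> h"
proof -
  let ?t = "ar_tuple S I (ctx_obj I U) ss (map (tm_sem S L I U) ts)"
  have "ar_proj I ss i \<cdot> ?t = map (tm_sem S L I U) ts ! i"
    using proj_ar_tuple[OF assms(4) ctx_obj_in[OF assms(1)] _ assms(6)] args_in(1)[OF assms(1-3)] by simp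
  also have "\<dots> = tm_sem S L I U (ts ! i)"
    using args_in(2)[OF assms(1-3,6)] assms(6) by simp
  finally show ?thesis
    using assoc[OF assms(5) args_tuple_in[OF assms(1-4)] ar_proj_in[OF assms(4,6)]] by simp
qed

lemma args_tuple_cong:
  assumes U: "is_ctx L U" and V: "is_ctx L V"
    and h: "h \<in> Hom S Q (ctx_obj I U)" and h': "h' \<in> Hom S Q (ctx_obj I V)"
    and ts: "\<And>t. t \<in> set ts \<Longrightarrow> tm_wf L t \<and> tm_fv t \<subseteq> U \<inter> V"
    and ss: "map (tm_sort L) ts = ss" "set ss \<subseteq> sorts L"
    and eq: "\<And>t. t \<in> set ts \<Longrightarrow> tm_sem S L I U t \<cdot> h = tm_sem S L I V t \<cdot> h'"
  shows "ar_tuple S I (ctx_obj I U) ss (map (tm_sem S L I U) ts) \<cdot> h =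
    ar_tuple S I (ctx_obj I V) ss (map (tm_sem S L I V) ts) \<cdot> h'" (is "?l = ?r")
proof (rule product_eqI[OF ar_product[OF ss(2)]])
  have tU: "\<And>t. t \<in> set ts \<Longrightarrow> tm_wf L t \<and> tm_fv t \<subseteq> U"
    and tV: "\<And>t. t \<in> set ts \<Longrightarrow> tm_wf L t \<and> tm_fv t \<subseteq> V" using ts by auto
  show "?l \<in> Hom S Q (ar_obj I ss)" using Cmp_in[OF h args_tuple_in[OF U tU ss]] .
  show "?r \<in> Hom S Q (ar_obj I ss)" using Cmp_in[OF h' args_tuple_in[OF V tV ss]] .
  fix i assume "i \<in> {..<length ss}"
  then have i: "i < length ss" by simp
  show "ar_proj I ss i \<cdot> ?l = ar_proj I ss i \<cdot> ?r"
    using proj_args_tuple_Cmp[OF U tU ss h i] proj_args_tuple_Cmp[OF V tV ss h' i]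
      eq args_in(3)[OF U tU ss(1) i] by simp
qed

lemma tm_sem_cong:
  assumes U: "is_ctx L U" and V: "is_ctx L V"
    and h: "h \<in> Hom S Q (ctx_obj I U)" and h': "h' \<in> Hom S Q (ctx_obj I V)"
  shows "tm_wf L t \<Longrightarrow> tm_fv t \<subseteq> U \<inter> V \<Longrightarrow>
    (\<And>x. x \<in> tm_fv t \<Longrightarrow> ctx_proj I U x \<cdot> h = ctx_proj I V x \<cdot> h') \<Longrightarrow>
    tm_sem S L I U t \<cdot> h = tm_sem S L I V t \<cdot> h'"
proof (induction t)
  case (Var x)
  then show ?case by simp
next
  case (Fun f ts)
  then have f: "f \<in> funs L" and ss: "map (tm_sort L) ts = fdom L f" by auto
  have ts: "tm_wf L t \<and> tm_fv t \<subseteq> U \<inter> V" if "t \<in> set ts" for t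
    using that Fun.prems by auto
  then have tU: "\<And>t. t \<in> set ts \<Longrightarrow> tm_wf L t \<and> tm_fv t \<subseteq> U"
    and tV: "\<And>t. t \<in> set ts \<Longrightarrow> tm_wf L t \<and> tm_fv t \<subseteq> V" by auto
  have fa: "fun_arr I f \<in> Hom S (ar_obj I (fdom L f)) (sort_obj I (fcod L f))"
    using interp f by (simp add: is_interp_def)
  have IH: "tm_sem S L I U t \<cdot> h = tm_sem S L I V t \<cdot> h'" if t: "t \<in> set ts" for t
    using Fun.IH[OF t] ts[OF t] Fun.prems(3) t by auto
  have "ar_tuple S I (ctx_obj I U) (fdom L f) (map (tm_sem S L I U) ts) \<cdot> h =
    ar_tuple S I (ctx_obj I V) (fdom L f) (map (tm_sem S L I V) ts) \<cdot> h'"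
    using args_tuple_cong[OF U V h h' ts ss fdom_in[OF f] IH] by blast
  then show ?case
    using assoc[OF h args_tuple_in[OF U tU ss fdom_in[OF f]] fa]
      assoc[OF h' args_tuple_in[OF V tV ss fdom_in[OF f]] fa] by simp
qed

section \<open>Forcing clauses for formulas\<close>

lemma fms_simps:
  "Rel r ts \<in> fms L U \<longleftrightarrow>
     r \<in> rels L \<and> (\<forall>t\<in>set ts. tm_wf L t \<and> tm_fv t \<subseteq> U) \<and> map (tm_sort L) ts = rdom L r"
  "Eq s t \<in> fms L U \<longleftrightarrow> has_eq L \<and> tm_wf L s \<and> tm_wf L t \<and> tm_sort L s = tm_sort L t \<and>
     tm_fv s \<subseteq> U \<and> tm_fv t \<subseteq> U"
  "And \<phi> \<psi> \<in> fms L U \<longleftrightarrow> \<phi> \<in> fms L U \<and> \<psi> \<in> fms L U"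
  "Ex x \<phi> \<in> fms L U \<longleftrightarrow> x \<in> vars L \<and> \<phi> \<in> fms L (insert x U)"
  by (auto simp: fms_def)

lemma rel_sub_mono: "r \<in> rels L \<Longrightarrow> mono_into S (ar_obj I (rdom L r)) (rel_sub I r)"
  using interp by (simp add: is_interp_def)

lemma classifies_sem_Rel:
  assumes U: "is_ctx L U" and fm: "Rel r ts \<in> fms L U"
  shows "classifies S (ctx_obj I U) (sem S L I (Rel r ts) U)
    (\<lambda>h. factors S (ar_tuple S I (ctx_obj I U) (rdom L r) (map (tm_sem S L I U) ts) \<cdot> h) (rel_sub I r))"
proof -
  have "ar_tuple S I (ctx_obj I U) (rdom L r) (map (tm_sem S L I U) ts) \<in>
    Hom S (ctx_obj I U) (ar_obj I (rdom L r))"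
    using args_tuple_in[OF U, of ts] fm rdom_in[of r] by (simp add: fms_simps)
  then show ?thesis using sub_pullback_classifies rel_sub_mono fm by (simp add: fms_simps)
qed

lemma classifies_sem_Eq:
  assumes U: "is_ctx L U" and fm: "Eq s t \<in> fms L U"
  shows "classifies S (ctx_obj I U) (sem S L I (Eq s t) U)
    (\<lambda>h. tm_sem S L I U s \<cdot> h = tm_sem S L I U t \<cdot> h)"
  using sub_equalizer_classifies[of "tm_sem S L I U s"] tm_sem_in[OF U, of s] tm_sem_in[OF U, of t] fm
  by (simp add: fms_simps)

text \<open>The forcing clause for the existential. Agreement is required on \<open>U - {x}\<close>
  only, since \<open>x\<close> may already belong to \<open>U\<close>; its old value is then
  discarded, just as \<open>sem\<close> first projects to \<open>U - {x}\<close>.\<close>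

lemma classifies_sem_Ex:
  assumes U: "is_ctx L U" and x: "x \<in> vars L" and m: "mono_into S (ctx_obj I (insert x U)) (sem S L I \<phi> (insert x U))"
  shows "classifies S (ctx_obj I U) (sem S L I (Ex x \<phi>) U)
    (\<lambda>h. \<exists>e k. regular_epi S e \<and> e \<in> Hom S (Dom S e) (Dom S h) \<and>
       k \<in> Hom S (Dom S e) (ctx_obj I (insert x U)) \<and> factors S k (sem S L I \<phi> (insert x U)) \<and>
       (\<forall>y\<in>U - {x}. ctx_proj I (insert x U) y \<cdot> k = ctx_proj I U y \<cdot> (h \<cdot> e)))"
    (is "classifies S _ _ ?Q")
proof -
  let ?m = "sem S L I \<phi> (insert x U)"
  let ?U = "U - {x}" and ?V = "insert x U"
  let ?q = "restrict S I ?U ?V \<cdot> ?m" and ?d = "restrict S I ?U U"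
  have V: "is_ctx L ?V" and U': "is_ctx L ?U" using ctx_insert[OF U x] ctx_subset[OF U] by auto
  have UV: "?U \<subseteq> ?V" by auto
  note m' = mono_into_Hom[OF m]
  note r = restrict_in[OF V UV]
  have q: "?q \<in> Hom S (Dom S ?m) (ctx_obj I ?U)" using Cmp_in[OF m' r] .
  have d: "?d \<in> Hom S (ctx_obj I U) (ctx_obj I ?U)" using restrict_in[OF U] by blast
  note im = sub_image_classifies[OF q]
  note pb = sub_pullback_classifies[OF d classifiesD(1)[OF im]]
  have "factors S (?d \<cdot> h) (sub_image S ?q) \<longleftrightarrow> ?Q h" if h: "h \<in> Hom S R (ctx_obj I U)" for R h
  proof -
    have dh: "?d \<cdot> h \<in> Hom S R (ctx_obj I ?U)" using Cmp_in[OF h d] .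
    have R: "Dom S h = R" "Dom S (?d \<cdot> h) = R" using h dh by (auto simp: Hom_iff)
    \<comment> \<open>Maps into the product over \<open>U - {x}\<close> are equal iff their
      coordinates are; this turns the projections of the semantics into equations between
      coordinates.\<close>
    have key: "?q \<cdot> k = (?d \<cdot> h) \<cdot> e \<longleftrightarrow>
       (\<forall>y\<in>?U. ctx_proj I ?V y \<cdot> (?m \<cdot> k) = ctx_proj I U y \<cdot> (h \<cdot> e))"
      if e: "e \<in> Hom S (Dom S e) R" and k: "k \<in> Hom S (Dom S e) (Dom S ?m)" for e k
    proof -
      have mk: "?m \<cdot> k \<in> Hom S (Dom S e) (ctx_obj I ?V)" using Cmp_in[OF k m'] .
      have he: "h \<cdot> e \<in> Hom S (Dom S e) (ctx_obj I U)" using Cmp_in[OF e h] .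
      have 1: "?q \<cdot> k = restrict S I ?U ?V \<cdot> (?m \<cdot> k)" using assoc[OF k m' r] by simp
      have 2: "(?d \<cdot> h) \<cdot> e = ?d \<cdot> (h \<cdot> e)" using assoc[OF e h d] by simp
      have p1: "ctx_proj I ?U y \<cdot> (restrict S I ?U ?V \<cdot> (?m \<cdot> k)) = ctx_proj I ?V y \<cdot> (?m \<cdot> k)"
        and p2: "ctx_proj I ?U y \<cdot> (?d \<cdot> (h \<cdot> e)) = ctx_proj I U y \<cdot> (h \<cdot> e)" if "y \<in> ?U" for y
        using proj_restrict_Cmp[OF V UV mk that] proj_restrict_Cmp[OF U _ he that] by auto
      show ?thesis
      proof
        assume "?q \<cdot> k = (?d \<cdot> h) \<cdot> e"
        then show "\<forall>y\<in>?U. ctx_proj I ?V y \<cdot> (?m \<cdot> k) = ctx_proj I U y \<cdot> (h \<cdot> e)"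
          using 1 2 p1 p2 by metis
      next
        assume *: "\<forall>y\<in>?U. ctx_proj I ?V y \<cdot> (?m \<cdot> k) = ctx_proj I U y \<cdot> (h \<cdot> e)"
        have "restrict S I ?U ?V \<cdot> (?m \<cdot> k) = ?d \<cdot> (h \<cdot> e)"
          by (rule product_eqI[OF ctx_product[OF U'] Cmp_in[OF mk r] Cmp_in[OF he d]])
            (use * p1 p2 in metis)
        then show "?q \<cdot> k = (?d \<cdot> h) \<cdot> e" using 1 2 by simp
      qed
    qed
    show ?thesis (is "?L \<longleftrightarrow> _")
    proof
      assume ?L
      then obtain e k where e: "regular_epi S e" "e \<in> Hom S (Dom S e) R" "k \<in> Hom S (Dom S e) (Dom S ?m)"
        "?q \<cdot> k = (?d \<cdot> h) \<cdot> e"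
        using classifiesD(2)[OF im dh] R by auto
      then have "\<forall>y\<in>?U. ctx_proj I ?V y \<cdot> (?m \<cdot> k) = ctx_proj I U y \<cdot> (h \<cdot> e)"
        using key by blast
      moreover have "?m \<cdot> k \<in> Hom S (Dom S e) (ctx_obj I ?V)" using Cmp_in[OF e(3) m'] .
      moreover from this have "factors S (?m \<cdot> k) ?m" using e(3) by (auto simp: factors_def Hom_iff)
      ultimately show "?Q h" using e(1,2) R by blast
    next
      assume "?Q h"
      then obtain e k where e: "regular_epi S e" "e \<in> Hom S (Dom S e) R"
        "k \<in> Hom S (Dom S e) (ctx_obj I ?V)" "factors S k ?m"
        "\<forall>y\<in>?U. ctx_proj I ?V y \<cdot> k = ctx_proj I U y \<cdot> (h \<cdot> e)" using R by auto
      then obtain l where l: "l \<in> Hom S (Dom S e) (Dom S ?m)" "?m \<cdot> l = k"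
        by (auto simp: factors_def Hom_iff)
      then have "?q \<cdot> l = (?d \<cdot> h) \<cdot> e" using key[OF e(2) l(1)] e(5) by simp
      then show ?L using classifiesD(2)[OF im dh] R e(1,2) l(1) by auto
    qed
  qed
  then show ?thesis
    using pb by (simp add: classifies_def)
qed

lemma sem_mono: "is_ctx L U \<Longrightarrow> \<phi> \<in> fms L U \<Longrightarrow> mono_into S (ctx_obj I U) (sem S L I \<phi> U)"
proof (induction \<phi> arbitrary: U)
  case Top
  have "mono_into S (ctx_obj I U) (Ide S (ctx_obj I U))"
    by (rule mono_intoI[OF Ide_in[OF ctx_obj_in[OF Top(1)]]]) (simp add: Ide_Cmp)
  then show ?case by simp
next
  case (Rel r ts)
  show ?case using classifiesD(1)[OF classifies_sem_Rel[OF Rel]] .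
next
  case (Eq s t)
  show ?case using classifiesD(1)[OF classifies_sem_Eq[OF Eq]] .
next
  case (And \<phi> \<psi>)
  then show ?case
    using classifiesD(1)[OF sub_Inf_classifies[of "{sem S L I \<phi> U, sem S L I \<psi> U}"]] ctx_obj_in
    by (auto simp: fms_simps)
next
  case (Ex x \<phi>)
  then have x: "x \<in> vars L" "\<phi> \<in> fms L (insert x U)" by (auto simp: fms_simps)
  then show ?case
    using classifiesD(1)[OF classifies_sem_Ex[OF Ex(2) x(1)]] Ex.IH[OF ctx_insert[OF Ex(2) x(1)]] by blast
qed

lemma factors_sem_Top:
  assumes "h \<in> Hom S Q (ctx_obj I U)"
  shows "factors S h (sem S L I Top U)"
proof -
  have "Ide S (ctx_obj I U) \<in> Hom S (ctx_obj I U) (ctx_obj I U)"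
    using Ide_in Hom_Obj[OF assms] by blast
  then show ?thesis using assms Ide_Cmp[OF assms] by (auto simp: factors_def Hom_iff)
qed

lemma factors_sem_And:
  assumes "is_ctx L U" "And \<phi> \<psi> \<in> fms L U" "h \<in> Hom S Q (ctx_obj I U)"
  shows "factors S h (sem S L I (And \<phi> \<psi>) U) \<longleftrightarrow>
    factors S h (sem S L I \<phi> U) \<and> factors S h (sem S L I \<psi> U)"
  using classifiesD(2)[OF sub_Inf_classifies[of "{sem S L I \<phi> U, sem S L I \<psi> U}"] assms(3)]
    sem_mono[OF assms(1)] ctx_obj_in[OF assms(1)] assms(2) by (auto simp: fms_simps)

lemma factors_sem_Ex:
  assumes U: "is_ctx L U" and fm: "Ex x \<phi> \<in> fms L U" and h: "h \<in> Hom S Q (ctx_obj I U)"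
  shows "factors S h (sem S L I (Ex x \<phi>) U) \<longleftrightarrow>
    (\<exists>R e k. regular_epi S e \<and> e \<in> Hom S R Q \<and>
       k \<in> Hom S R (ctx_obj I (insert x U)) \<and> factors S k (sem S L I \<phi> (insert x U)) \<and>
       (\<forall>y\<in>U - {x}. ctx_proj I (insert x U) y \<cdot> k = ctx_proj I U y \<cdot> (h \<cdot> e)))"
proof -
  have "x \<in> vars L" "\<phi> \<in> fms L (insert x U)" using fm by (auto simp: fms_simps)
  then have c: "classifies S (ctx_obj I U) (sem S L I (Ex x \<phi>) U)
    (\<lambda>h. \<exists>e k. regular_epi S e \<and> e \<in> Hom S (Dom S e) (Dom S h) \<and>
       k \<in> Hom S (Dom S e) (ctx_obj I (insert x U)) \<and> factors S k (sem S L I \<phi> (insert x U)) \<and>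
       (\<forall>y\<in>U - {x}. ctx_proj I (insert x U) y \<cdot> k = ctx_proj I U y \<cdot> (h \<cdot> e)))"
    using classifies_sem_Ex[OF U] sem_mono ctx_insert[OF U] by blast
  have "Dom S h = Q" using h by (simp add: Hom_iff)
  moreover have "e \<in> Hom S R Q \<Longrightarrow> Dom S e = R" for e R by (simp add: Hom_iff)
  ultimately show ?thesis using classifiesD(2)[OF c h] by metis
qed

text \<open>The Beck--Chevalley condition for projections, in terms of generalized elements.\<close>

lemma factors_sem_cong:
  assumes "is_ctx L U" "is_ctx L V" "\<phi> \<in> fms L U" "\<phi> \<in> fms L V"
    "h \<in> Hom S Q (ctx_obj I U)" "h' \<in> Hom S Q (ctx_obj I V)"
    "\<And>x. x \<in> fv \<phi> \<Longrightarrow> ctx_proj I U x \<cdot> h = ctx_proj I V x \<cdot> h'"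
    "factors S h (sem S L I \<phi> U)"
  shows "factors S h' (sem S L I \<phi> V)"
  using assms
proof (induction \<phi> arbitrary: U V Q h h')
  case Top
  then show ?case using factors_sem_Top by blast
next
  case (Rel r ts)
  note c = classifiesD(2)[OF classifies_sem_Rel[OF Rel(1,3)] Rel(5)]
    classifiesD(2)[OF classifies_sem_Rel[OF Rel(2,4)] Rel(6)]
  have wf: "tm_wf L t \<and> tm_fv t \<subseteq> U \<inter> V" if "t \<in> set ts" for t using that Rel(3,4) by (auto simp: fms_simps)
  have eq: "tm_sem S L I U t \<cdot> h = tm_sem S L I V t \<cdot> h'" if t: "t \<in> set ts" for t
    using tm_sem_cong[OF Rel(1,2,5,6), of t] wf[OF t] Rel(7) t by auto
  have "ar_tuple S I (ctx_obj I U) (rdom L r) (map (tm_sem S L I U) ts) \<cdot> h =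
    ar_tuple S I (ctx_obj I V) (rdom L r) (map (tm_sem S L I V) ts) \<cdot> h'"
    by (rule args_tuple_cong[OF Rel(1,2,5,6) wf _ _ eq]) (use Rel(3) rdom_in in \<open>auto simp: fms_simps\<close>)
  then show ?case using c Rel(8) by simp
next
  case (Eq s t)
  note c = classifiesD(2)[OF classifies_sem_Eq[OF Eq(1,3)] Eq(5)]
    classifiesD(2)[OF classifies_sem_Eq[OF Eq(2,4)] Eq(6)]
  have "tm_sem S L I U s \<cdot> h = tm_sem S L I V s \<cdot> h'" "tm_sem S L I U t \<cdot> h = tm_sem S L I V t \<cdot> h'"
    using tm_sem_cong[OF Eq(1,2,5,6)] Eq(3,4,7) by (auto simp: fms_simps)
  then show ?case using c Eq(8) by simp
next
  case (And \<phi> \<psi>)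
  have ab: "\<phi> \<in> fms L U" "\<psi> \<in> fms L U" "\<phi> \<in> fms L V" "\<psi> \<in> fms L V"
    using And.prems(3,4) by (auto simp: fms_simps)
  have fac: "factors S h (sem S L I \<phi> U)" "factors S h (sem S L I \<psi> U)"
    using And.prems(8) factors_sem_And[OF And.prems(1,3,5)] by auto
  have "factors S h' (sem S L I \<phi> V)"
    by (rule And.IH(1)[OF And.prems(1,2) ab(1,3) And.prems(5,6) _ fac(1)]) (simp add: And.prems(7))
  moreover have "factors S h' (sem S L I \<psi> V)"
    by (rule And.IH(2)[OF And.prems(1,2) ab(2,4) And.prems(5,6) _ fac(2)]) (simp add: And.prems(7))
  ultimately show ?case using factors_sem_And[OF And.prems(2,4,6)] by simp
next
  case (Ex x \<phi>)
  note U = Ex.prems(1) and V = Ex.prems(2) and h = Ex.prems(5) and h' = Ex.prems(6)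
  have x: "x \<in> vars L" "\<phi> \<in> fms L (insert x U)" "\<phi> \<in> fms L (insert x V)"
    using Ex.prems(3,4) by (auto simp: fms_simps)
  note U1 = ctx_insert[OF U x(1)] and V1 = ctx_insert[OF V x(1)]
  obtain R e k where e: "regular_epi S e" "e \<in> Hom S R Q" "k \<in> Hom S R (ctx_obj I (insert x U))"
    "factors S k (sem S L I \<phi> (insert x U))"
    "\<forall>y\<in>U - {x}. ctx_proj I (insert x U) y \<cdot> k = ctx_proj I U y \<cdot> (h \<cdot> e)"
    using Ex.prems(8) factors_sem_Ex[OF U Ex.prems(3) h] by blast
  have h'e: "h' \<cdot> e \<in> Hom S R (ctx_obj I V)" using Cmp_in[OF e(2) h'] .
  \<comment> \<open>The element over \<open>insert x V\<close> takes the witness for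
    \<open>x\<close> from \<open>k\<close> and all other values from \<open>h'\<close>. This also
    supplies the variables of \<open>V\<close> outside \<open>U\<close>, of which \<open>k\<close>
    knows nothing.\<close>
  let ?q = "\<lambda>y. if y = x then ctx_proj I (insert x U) x \<cdot> k else ctx_proj I V y \<cdot> (h' \<cdot> e)"
  have q: "?q y \<in> Hom S R (sort_obj I (vsort L y))" if "y \<in> insert x V" for y
    using that Cmp_in[OF e(3) ctx_proj_in[OF U1]] Cmp_in[OF h'e ctx_proj_in[OF V]] by auto
  have "R \<in> Obj S" using Hom_Obj e(2) by blast
  from product_tuple[OF ctx_product[OF V1] this q]
  obtain k' where k': "k' \<in> Hom S R (ctx_obj I (insert x V))"
    "\<And>y. y \<in> insert x V \<Longrightarrow> ctx_proj I (insert x V) y \<cdot> k' = ?q y" by blast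
  have "factors S k' (sem S L I \<phi> (insert x V))"
  proof (rule Ex.IH[OF U1 V1 x(2,3) e(3) k'(1) _ e(4)])
    fix y assume y: "y \<in> fv \<phi>"
    show "ctx_proj I (insert x U) y \<cdot> k = ctx_proj I (insert x V) y \<cdot> k'"
    proof (cases "y = x")
      case True
      then show ?thesis using k'(2)[of x] by simp
    next
      case False
      then have yUV: "y \<in> U" "y \<in> V" using y x(2,3) by (auto simp: fms_def)
      have "ctx_proj I (insert x U) y \<cdot> k = ctx_proj I U y \<cdot> (h \<cdot> e)" using e(5) yUV False by auto
      also have "\<dots> = ctx_proj I U y \<cdot> h \<cdot> e" using assoc[OF e(2) h ctx_proj_in[OF U yUV(1)]] .
      also have "\<dots> = ctx_proj I V y \<cdot> h' \<cdot> e" using Ex.prems(7)[of y] y False by simp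
      also have "\<dots> = ctx_proj I V y \<cdot> (h' \<cdot> e)" using assoc[OF e(2) h' ctx_proj_in[OF V yUV(2)]] by simp
      also have "\<dots> = ctx_proj I (insert x V) y \<cdot> k'" using k'(2) yUV False by simp
      finally show ?thesis .
    qed
  qed
  moreover have "\<forall>y\<in>V - {x}. ctx_proj I (insert x V) y \<cdot> k' = ctx_proj I V y \<cdot> (h' \<cdot> e)"
    using k'(2) by simp
  ultimately show ?case
    using factors_sem_Ex[OF V Ex.prems(4) h'] e(1,2) k'(1) by blast
qed

end

section \<open>Soundness\<close>

text \<open>The rule \<open>local\<close> yields its conclusion over one face, whereas
  \<open>satisfies\<close> asks for every face in which \<open>\<phi>\<close> is a formula. Closing
  this gap is what soundness needs from the surjectivity of the restrictions of
  \<open>A\<close>.\<close>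

lemma (in interpretation_of) satisfies_from_face:
  assumes K: "simplicial_complex X K" "X \<subseteq> vars L" and A: "no_signalling S I K A"
    and U: "U \<in> K" "\<phi> \<in> fms L U" "sub_le S (A U) (sem S L I \<phi> U)"
  shows "satisfies S L I K A \<phi>"
  unfolding satisfies_def
proof (intro ballI impI)
  fix V assume V: "V \<in> K" "\<phi> \<in> fms L V"
  define W where "W = U \<inter> V"
  have W: "W \<in> K" "W \<subseteq> U" "W \<subseteq> V" "\<phi> \<in> fms L W"
    using K(1) U V by (auto simp: W_def simplicial_complex_def fms_def)
  have ctx: "is_ctx L U" if "U \<in> K" for U
    using that K by (auto simp: simplicial_complex_def is_ctx_def)
  have mono: "mono_into S (ctx_obj I U) (A U)" if "U \<in> K" for U
    using that A by (simp add: no_signalling_def subpresheaf_def)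
  have sub: "\<exists>k. k \<in> Hom S (Dom S (A Z)) (Dom S (A Y)) \<and> A Y \<cdot> k = restrict S I Y Z \<cdot> A Z"
    if "Z \<in> K" "Y \<in> K" "Y \<subseteq> Z" for Y Z
  proof -
    have "factors S (restrict S I Y Z \<cdot> A Z) (A Y)"
      using that A by (simp add: no_signalling_def subpresheaf_def)
    moreover have "restrict S I Y Z \<cdot> A Z \<in> Hom S (Dom S (A Z)) (ctx_obj I Y)"
      using Cmp_in[OF mono_into_Hom[OF mono[OF that(1)]] restrict_in[OF ctx[OF that(1)] that(3)]] .
    ultimately show ?thesis by (auto simp: factors_def Hom_iff)
  qed
  note AU = mono_into_Hom[OF mono[OF U(1)]] and AV = mono_into_Hom[OF mono[OF V(1)]]
    and AW = mono_into_Hom[OF mono[OF W(1)]]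
  define e where "e = sub_restrict S I A W U"
  have "\<exists>!k. k \<in> Hom S (Dom S (A U)) (Dom S (A W)) \<and> A W \<cdot> k = restrict S I W U \<cdot> A U"
    using sub[OF U(1) W(1,2)] mono_cancel[OF mono[OF W(1)]] by metis
  from theI'[OF this] have e: "e \<in> Hom S (Dom S (A U)) (Dom S (A W))" "A W \<cdot> e = restrict S I W U \<cdot> A U"
    unfolding e_def sub_restrict_def by blast+
  have re: "regular_epi S e" using A U W by (simp add: e_def no_signalling_def)
  have "factors S (restrict S I W U \<cdot> A U) (sem S L I \<phi> W)"
    by (rule factors_sem_cong[OF ctx[OF U(1)] ctx[OF W(1)] U(2) W(4) AU
          Cmp_in[OF AU restrict_in[OF ctx[OF U(1)] W(2)]] _ U(3)])
      (use proj_restrict_Cmp[OF ctx[OF U(1)] W(2) AU] W(4) in \<open>auto simp: fms_def\<close>)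
  then have fW: "factors S (A W) (sem S L I \<phi> W)"
    using regular_epi_lift[OF re e(1) sem_mono[OF ctx[OF W(1)] W(4)] AW] e(2) by simp
  obtain k where k: "k \<in> Hom S (Dom S (A V)) (Dom S (A W))" "A W \<cdot> k = restrict S I W V \<cdot> A V"
    using sub[OF V(1) W(1,3)] by blast
  have "factors S (A W \<cdot> k) (sem S L I \<phi> W)"
    using factors_Cmp[OF fW AW mono_into_Hom[OF sem_mono[OF ctx[OF W(1)] W(4)]] k(1)] .
  then have "factors S (restrict S I W V \<cdot> A V) (sem S L I \<phi> W)" using k(2) by simp
  then show "sub_le S (A V) (sem S L I \<phi> V)"
    by (rule factors_sem_cong[OF ctx[OF W(1)] ctx[OF V(1)] W(4) V(2)
          Cmp_in[OF AV restrict_in[OF ctx[OF V(1)] W(3)]] AV, rotated])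
      (use proj_restrict_Cmp[OF ctx[OF V(1)] W(3) AV] W(4) in \<open>auto simp: fms_def\<close>)
qed

lemma inchworm_sound:
  assumes K: "simplicial_complex X K" "X \<subseteq> vars L"
    and S: "regular_category S" and L: "language L" and M: "model S L E I" and A: "no_signalling S I K A"
  shows "inchworm L E K \<Gamma> \<phi> \<Longrightarrow> (\<And>\<psi>. \<psi> \<in> \<Gamma> \<Longrightarrow> satisfies S L I K A \<psi>) \<Longrightarrow> satisfies S L I K A \<phi>"
proof (induction rule: inchworm.induct)
  case (local U \<phi> \<Gamma>)
  interpret regular_category S using S .
  interpret interpretation_of S L I
    using S L M by (simp add: interpretation_of_def interpretation_of_axioms_def model_def)
  obtain \<Delta> where \<Delta>: "finite \<Delta>" "\<Delta> \<subseteq> \<Gamma> \<inter> fms L U"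
    "sub_le S (sub_Inf S (ctx_obj I U) ((\<lambda>\<psi>. sem S L I \<psi> U) ` \<Delta>)) (sem S L I \<phi> U)"
    using M local(3) unfolding model_def by blast
  have U: "is_ctx L U" using local(1) K by (auto simp: simplicial_complex_def is_ctx_def)
  have "mono_into S (ctx_obj I U) (A U)"
    using local(1) A by (simp add: no_signalling_def subpresheaf_def)
  note AU = mono_into_Hom[OF this]
  have "\<And>n. n \<in> (\<lambda>\<psi>. sem S L I \<psi> U) ` \<Delta> \<Longrightarrow> mono_into S (ctx_obj I U) n"
    using sem_mono[OF U] \<Delta>(2) by blast
  then have c: "classifies S (ctx_obj I U) (sub_Inf S (ctx_obj I U) ((\<lambda>\<psi>. sem S L I \<psi> U) ` \<Delta>))
      (\<lambda>h. \<forall>n\<in>(\<lambda>\<psi>. sem S L I \<psi> U) ` \<Delta>. factors S h n)"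
    using sub_Inf_classifies \<Delta>(1) ctx_obj_in[OF U] by blast
  have "\<forall>\<psi>\<in>\<Delta>. factors S (A U) (sem S L I \<psi> U)"
    using local(4) \<Delta>(2) local(1) unfolding satisfies_def by blast
  then have "factors S (A U) (sub_Inf S (ctx_obj I U) ((\<lambda>\<psi>. sem S L I \<psi> U) ` \<Delta>))"
    using classifiesD(2)[OF c AU] by blast
  then have "sub_le S (A U) (sem S L I \<phi> U)"
    using factors_trans[OF _ \<Delta>(3) AU mono_into_Hom[OF classifiesD(1)[OF c]]
        mono_into_Hom[OF sem_mono[OF U local(2)]]] by blast
  then show ?case using satisfies_from_face[OF K A local(1,2)] by blast
next
  case (cut \<Gamma> \<phi> \<Delta> \<psi>)
  then show ?case by blast
qed

section \<open>Set-valued structures\<close>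

record ('a, 's, 'f, 'r) struct =
  carr :: "'s \<Rightarrow> 'a set"
  fint :: "'f \<Rightarrow> 'a list \<Rightarrow> 'a"
  rint :: "'r \<Rightarrow> 'a list set"

fun tval :: "('a, 's, 'f, 'r) struct \<Rightarrow> ('v \<Rightarrow> 'a) \<Rightarrow> ('f, 'v) tm \<Rightarrow> 'a" where
  "tval M a (Var x) = a x"
| "tval M a (Fun f ts) = fint M f (map (tval M a) ts)"

primrec sat :: "('s, 'f, 'r, 'v) signature \<Rightarrow> ('a, 's, 'f, 'r) struct \<Rightarrow>
    ('f, 'r, 'v) fm \<Rightarrow> ('v \<Rightarrow> 'a) \<Rightarrow> bool" where
  "sat L M Top = (\<lambda>a. True)"
| "sat L M (Rel r ts) = (\<lambda>a. map (tval M a) ts \<in> rint M r)"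
| "sat L M (Eq s t) = (\<lambda>a. tval M a s = tval M a t)"
| "sat L M (And \<phi> \<psi>) = (\<lambda>a. sat L M \<phi> a \<and> sat L M \<psi> a)"
| "sat L M (Ex x \<phi>) = (\<lambda>a. \<exists>d\<in>carr M (vsort L x). sat L M \<phi> (a(x := d)))"

definition is_struct :: "('s, 'f, 'r, 'v) signature \<Rightarrow> ('a, 's, 'f, 'r) struct \<Rightarrow> bool" where
  "is_struct L M \<longleftrightarrow> (\<forall>f\<in>funs L. \<forall>ds. list_all2 (\<lambda>d s. d \<in> carr M s) ds (fdom L f) \<longrightarrow>
     fint M f ds \<in> carr M (fcod L f))"

definition assignment :: "('s, 'f, 'r, 'v) signature \<Rightarrow> ('a, 's, 'f, 'r) struct \<Rightarrow> 'v set \<Rightarrow>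
    ('v \<Rightarrow> 'a) \<Rightarrow> bool" where
  "assignment L M U a \<longleftrightarrow> (\<forall>x\<in>U. a x \<in> carr M (vsort L x))"

text \<open>The context enters through \<open>assignment L M U a\<close>: if some sort of
  \<open>U\<close> is empty, entailments in context \<open>U\<close> hold vacuously.\<close>

definition set_model :: "('s, 'f, 'r, 'v) signature \<Rightarrow>
    ('v set \<Rightarrow> ('f, 'r, 'v) fm set \<Rightarrow> ('f, 'r, 'v) fm \<Rightarrow> bool) \<Rightarrow> ('a, 's, 'f, 'r) struct \<Rightarrow> bool" where
  "set_model L E M \<longleftrightarrow> is_struct L M \<and> (\<forall>U \<Gamma> \<phi> a. E U \<Gamma> \<phi> \<longrightarrow> assignment L M U a \<longrightarrow>
     (\<forall>\<psi>\<in>\<Gamma>. sat L M \<psi> a) \<longrightarrow> sat L M \<phi> a)"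

lemma tval_cong: "(\<And>x. x \<in> tm_fv t \<Longrightarrow> a x = b x) \<Longrightarrow> tval M a t = tval M b t"
proof (induction t)
  case (Fun f ts)
  then have "map (tval M a) ts = map (tval M b) ts" by (intro map_cong) auto
  then show ?case by (simp only: tval.simps)
qed simp

lemma sat_cong: "(\<And>x. x \<in> fv \<phi> \<Longrightarrow> a x = b x) \<Longrightarrow> sat L M \<phi> a \<longleftrightarrow> sat L M \<phi> b"
proof (induction \<phi> arbitrary: a b)
  case (Rel r ts)
  then have "map (tval M a) ts = map (tval M b) ts" by (intro map_cong tval_cong) auto
  then show ?case by (simp only: sat.simps)
next
  case (Eq s t)
  have "tval M a s = tval M b s" "tval M a t = tval M b t" using Eq by (auto intro!: tval_cong)
  then show ?case by simp
next
  case (And \<phi> \<psi>)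
  have "sat L M \<phi> a \<longleftrightarrow> sat L M \<phi> b" by (rule And.IH(1)) (simp add: And.prems)
  moreover have "sat L M \<psi> a \<longleftrightarrow> sat L M \<psi> b" by (rule And.IH(2)) (simp add: And.prems)
  ultimately show ?case by simp
next
  case (Ex x \<phi>)
  have "sat L M \<phi> (a(x := d)) \<longleftrightarrow> sat L M \<phi> (b(x := d))" for d
    by (rule Ex.IH) (use Ex.prems in auto)
  then show ?case by simp
qed simp

section \<open>A category of sets with prescribed types of objects and arrows\<close>

text \<open>All sets of elements of \<open>'a\<close>, with objects and arrows named by injections
  into prescribed types. The injection \<open>code\<close> makes \<open>'a\<close> closed under
  finite tuples, so that pullbacks and finite products of subsets of \<open>'a\<close> are again
  subsets of \<open>'a\<close>.\<close>

locale coded_sets =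
  fixes i :: "'a set \<Rightarrow> 'o" and j :: "'a set \<times> 'a set \<times> ('a \<times> 'a) set \<Rightarrow> 'm" and code :: "'a list \<Rightarrow> 'a"
  assumes inj_i: "inj i" and inj_j: "inj j" and inj_code: "inj code"
begin

text \<open>The graph is cut down to \<open>A\<close>, so that functions agreeing on
  \<open>A\<close> give the same arrow; source and target are stored because the graph does not
  determine the target.\<close>

definition arr :: "'a set \<Rightarrow> 'a set \<Rightarrow> ('a \<Rightarrow> 'a) \<Rightarrow> 'm" where
  "arr A B f = j (A, B, {(x, f x) | x. x \<in> A})"

definition app :: "'m \<Rightarrow> 'a \<Rightarrow> 'a" where
  "app m x = (THE y. (x, y) \<in> snd (snd (inv j m)))"

definition src :: "'m \<Rightarrow> 'a set" where
  "src m = fst (inv j m)"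

definition tgt :: "'m \<Rightarrow> 'a set" where
  "tgt m = fst (snd (inv j m))"

definition S :: "('o, 'm) cat" where
  "S = \<lparr>Obj = range i, Arr = {arr A B f | A B f. f ` A \<subseteq> B}, Dom = \<lambda>m. i (src m), Cod = \<lambda>m. i (tgt m),
     Ide = \<lambda>a. arr (inv i a) (inv i a) id, Cmp = \<lambda>g f. arr (src f) (tgt g) (\<lambda>x. app g (app f x))\<rparr>"

abbreviation comp :: "'m \<Rightarrow> 'm \<Rightarrow> 'm"  (infixl \<open>\<odot>\<close> 70) where
  "g \<odot> f \<equiv> g \<cdot>\<^bsub>S\<^esub> f"

lemma i_eq_iff [simp]: "i A = i B \<longleftrightarrow> A = B"
  using inj_i by (simp add: inj_eq)

lemma inv_i [simp]: "inv i (i A) = A"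
  using inj_i by simp

lemma inv_code [simp]: "inv code (code xs) = xs"
  using inj_code by simp

lemma code_eq_iff [simp]: "code xs = code ys \<longleftrightarrow> xs = ys"
  using inj_code by (simp add: inj_eq)

lemma src_arr [simp]: "src (arr A B f) = A" and tgt_arr [simp]: "tgt (arr A B f) = B"
  using inj_j by (simp_all add: src_def tgt_def arr_def)

lemma app_arr [simp]: "x \<in> A \<Longrightarrow> app (arr A B f) x = f x"
  using inj_j by (simp add: app_def arr_def)

lemma arr_cong: "(\<And>x. x \<in> A \<Longrightarrow> f x = g x) \<Longrightarrow> arr A B f = arr A B g"
  unfolding arr_def by (rule arg_cong[of _ _ j]) auto

lemma Obj_S: "a \<in> Obj S \<longleftrightarrow> (\<exists>A. a = i A)"
  by (auto simp: S_def)

lemma i_in_Obj [simp]: "i A \<in> Obj S"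
  by (simp add: S_def)

lemma arr_in: "f ` A \<subseteq> B \<Longrightarrow> arr A B f \<in> Hom S (i A) (i B)"
  by (auto simp: S_def Hom_def)

lemma Hom_S:
  assumes "m \<in> Hom S (i A) (i B)"
  shows "m = arr A B (app m)" "app m ` A \<subseteq> B" "src m = A" "tgt m = B"
proof -
  obtain f where f: "m = arr A B f" "f ` A \<subseteq> B" using assms by (auto simp: Hom_def S_def)
  then show "app m ` A \<subseteq> B" "src m = A" "tgt m = B" by auto
  show "m = arr A B (app m)" unfolding f(1) by (rule arr_cong) simp
qed

lemma app_in: "m \<in> Hom S (i A) (i B) \<Longrightarrow> x \<in> A \<Longrightarrow> app m x \<in> B"
  using Hom_S(2) by blast

lemma HomE:
  assumes "m \<in> Hom S a b"
  obtains A B where "a = i A" "b = i B" "m \<in> Hom S (i A) (i B)"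
  using assms by (auto simp: Hom_def S_def)

lemma arr_ext:
  assumes "m \<in> Hom S (i A) (i B)" "m' \<in> Hom S (i A) (i B)" "\<And>x. x \<in> A \<Longrightarrow> app m x = app m' x"
  shows "m = m'"
  using Hom_S(1)[OF assms(1)] Hom_S(1)[OF assms(2)] arr_cong[of A "app m" "app m'" B] assms(3) by metis

lemma Cmp_S:
  assumes "f \<in> Hom S (i A) (i B)" "g \<in> Hom S (i B) (i C)"
  shows "g \<odot> f = arr A C (\<lambda>x. app g (app f x))"
  using Hom_S(3,4)[OF assms(1)] Hom_S(3,4)[OF assms(2)] by (simp add: S_def)

lemma app_Cmp:
  assumes "f \<in> Hom S (i A) (i B)" "g \<in> Hom S (i B) (i C)" "x \<in> A"
  shows "app (g \<odot> f) x = app g (app f x)"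
  using Cmp_S[OF assms(1,2)] assms(3) by simp

lemma Cmp_in_S:
  assumes "f \<in> Hom S (i A) (i B)" "g \<in> Hom S (i B) (i C)"
  shows "g \<odot> f \<in> Hom S (i A) (i C)"
  unfolding Cmp_S[OF assms] by (rule arr_in) (use assms app_in in blast)

lemma Ide_S: "Ide S (i A) = arr A A id"
  by (simp add: S_def)

lemma Ide_in_S: "Ide S (i A) \<in> Hom S (i A) (i A)"
  unfolding Ide_S by (rule arr_in) simp

lemma app_Ide: "x \<in> A \<Longrightarrow> app (Ide S (i A)) x = x"
  by (simp add: Ide_S)

sublocale category S
proof
  show "Dom S f \<in> Obj S" "Cod S f \<in> Obj S" for f by (simp_all add: S_def)
  show "Ide S a \<in> Hom S a a" if "a \<in> Obj S" for a using that Ide_in_S by (auto simp: Obj_S)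
next
  fix f a b g c assume f: "f \<in> Hom S a b" and g: "g \<in> Hom S b c"
  obtain A B where A: "a = i A" "b = i B" "f \<in> Hom S (i A) (i B)" using HomE[OF f] .
  obtain C where "c = i C" "g \<in> Hom S (i B) (i C)" using HomE[OF g] A(2) by (metis i_eq_iff)
  then show "g \<odot> f \<in> Hom S a c" using Cmp_in_S A by simp
next
  fix f a b assume f: "f \<in> Hom S a b"
  obtain A B where A: "a = i A" "b = i B" "f \<in> Hom S (i A) (i B)" using HomE[OF f] .
  show "f \<odot> Ide S a = f" unfolding A(1)
    by (rule arr_ext[OF Cmp_in_S[OF Ide_in_S A(3)] A(3)]) (simp add: app_Cmp[OF Ide_in_S A(3)] app_Ide)
  show "Ide S b \<odot> f = f" unfolding A(2)
    by (rule arr_ext[OF Cmp_in_S[OF A(3) Ide_in_S] A(3)]) (simp add: app_Cmp[OF A(3) Ide_in_S] app_Ide app_in[OF A(3)])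
next
  fix f a b g c h d assume f: "f \<in> Hom S a b" and g: "g \<in> Hom S b c" and h: "h \<in> Hom S c d"
  obtain A B where A: "a = i A" "b = i B" "f \<in> Hom S (i A) (i B)" using HomE[OF f] .
  obtain C where C: "c = i C" "g \<in> Hom S (i B) (i C)" using HomE[OF g] A(2) by (metis i_eq_iff)
  obtain D where D: "d = i D" "h \<in> Hom S (i C) (i D)" using HomE[OF h] C(1) by (metis i_eq_iff)
  note gf = Cmp_in_S[OF A(3) C(2)] and hg = Cmp_in_S[OF C(2) D(2)]
  show "h \<odot> (g \<odot> f) = h \<odot> g \<odot> f"
    by (rule arr_ext[OF Cmp_in_S[OF gf D(2)] Cmp_in_S[OF A(3) hg]])
      (simp add: app_Cmp[OF gf D(2)] app_Cmp[OF A(3) hg] app_Cmp[OF A(3) C(2)] app_Cmp[OF C(2) D(2)] app_in[OF A(3)])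
qed

section \<open>Points, inclusions and regular epimorphisms of sets\<close>

abbreviation pt :: 'a where
  "pt \<equiv> code []"

text \<open>An element as an arrow from the one-point set. Applied to such arrows, a universal
  property yields its elementwise content for arbitrary limits, not only for the constructed
  ones.\<close>

definition const :: "'a set \<Rightarrow> 'a \<Rightarrow> 'm" where
  "const A x = arr {pt} A (\<lambda>_. x)"

lemma const_in: "x \<in> A \<Longrightarrow> const A x \<in> Hom S (i {pt}) (i A)"
  unfolding const_def by (rule arr_in) simp

lemma app_const: "app (const A x) pt = x"
  by (simp add: const_def)

lemma Cmp_const:
  assumes "m \<in> Hom S (i A) (i B)" "x \<in> A"
  shows "m \<odot> const A x = const B (app m x)"
  by (rule arr_ext[OF Cmp_in_S[OF const_in[OF assms(2)] assms(1)] const_in[OF app_in[OF assms]]])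
    (simp add: app_Cmp[OF const_in[OF assms(2)] assms(1)] app_const)

definition incl :: "'a set \<Rightarrow> 'a set \<Rightarrow> 'm" where
  "incl A B = arr A B id"

lemma incl_in: "A \<subseteq> B \<Longrightarrow> incl A B \<in> Hom S (i A) (i B)"
  unfolding incl_def by (rule arr_in) simp

lemma app_incl: "x \<in> A \<Longrightarrow> app (incl A B) x = x"
  by (simp add: incl_def)

lemma incl_mono:
  assumes "A \<subseteq> B"
  shows "mono_into S (i B) (incl A B)"
proof (rule mono_intoI[OF incl_in[OF assms]])
  fix c u v assume u: "u \<in> Hom S c (i A)" and v: "v \<in> Hom S c (i A)"
    and eq: "incl A B \<odot> u = incl A B \<odot> v"
  obtain C where C: "c = i C" using HomE[OF u] by blast
  note u = u[unfolded C] and v = v[unfolded C]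
  show "u = v"
  proof (rule arr_ext[OF u v])
    fix x assume x: "x \<in> C"
    have "app (incl A B \<odot> u) x = app (incl A B \<odot> v) x" using eq by simp
    then show "app u x = app v x"
      using app_Cmp[OF u incl_in[OF assms] x] app_Cmp[OF v incl_in[OF assms] x]
        app_incl[OF app_in[OF u x]] app_incl[OF app_in[OF v x]] by simp
  qed
qed

lemma factors_incl:
  assumes AB: "A \<subseteq> B" and h: "h \<in> Hom S (i Q) (i B)"
  shows "factors S h (incl A B) \<longleftrightarrow> app h ` Q \<subseteq> A"
proof
  assume "factors S h (incl A B)"
  then obtain k where k: "k \<in> Hom S (i Q) (i A)" "incl A B \<odot> k = h"
    using h incl_in[OF AB] by (auto simp: factors_def Hom_iff)
  have "app h q \<in> A" if "q \<in> Q" for q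
    using app_Cmp[OF k(1) incl_in[OF AB] that] app_in[OF k(1) that] app_incl k(2) by simp
  then show "app h ` Q \<subseteq> A" by blast
next
  assume sub: "app h ` Q \<subseteq> A"
  let ?k = "arr Q A (app h)"
  have k: "?k \<in> Hom S (i Q) (i A)" by (rule arr_in[OF sub])
  have "incl A B \<odot> ?k = h"
    by (rule arr_ext[OF Cmp_in_S[OF k incl_in[OF AB]] h])
      (use app_Cmp[OF k incl_in[OF AB]] app_incl sub in auto)
  then show "factors S h (incl A B)" using k h incl_in[OF AB] by (auto simp: factors_def Hom_iff)
qed

text \<open>A surjection is the coequalizer of any pair that it equalizes and that reaches its whole
  kernel relation. \<open>P\<close> stays arbitrary so that both the constructed pullback and an
  arbitrary kernel pair are covered.\<close>

lemma coequalizer_by_kernel: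
  assumes e: "e \<in> Hom S (i A) (i B)" and surj: "app e ` A = B"
    and p: "p \<in> Hom S (i P) (i A)" and q: "q \<in> Hom S (i P) (i A)" and eq: "e \<odot> p = e \<odot> q"
    and kernel: "\<And>x y. x \<in> A \<Longrightarrow> y \<in> A \<Longrightarrow> app e x = app e y \<Longrightarrow> \<exists>z\<in>P. app p z = x \<and> app q z = y"
  shows "is_coequalizer S p q e"
proof -
  have "\<exists>!h. h \<in> Hom S (i B) (Cod S u) \<and> h \<odot> e = u"
    if u: "u \<in> Arr S" "Dom S u = i A" "u \<odot> p = u \<odot> q" for u
  proof -
    obtain C where C: "Cod S u = i C" using Obj_S Cod_in u(1) by blast
    then have u': "u \<in> Hom S (i A) (i C)" using u by (simp add: Hom_iff)
    have u_eq: "app u x = app u y" if xy: "x \<in> A" "y \<in> A" "app e x = app e y" for x y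
    proof -
      obtain z where z: "z \<in> P" "app p z = x" "app q z = y" using kernel[OF xy] by blast
      then show ?thesis using app_Cmp[OF p u' z(1)] app_Cmp[OF q u' z(1)] u(3) by simp
    qed
    \<comment> \<open>The mediating map applies \<open>u\<close> to some preimage under
      \<open>e\<close>; surjectivity provides one and \<open>u_eq\<close> makes the choice
      harmless.\<close>
    define g where "g b = (SOME a. a \<in> A \<and> app e a = b)" for b
    have g: "g b \<in> A \<and> app e (g b) = b" if "b \<in> B" for b
      unfolding g_def by (rule someI_ex) (use surj that in blast)
    let ?h = "arr B C (\<lambda>b. app u (g b))"
    have h: "?h \<in> Hom S (i B) (i C)" by (rule arr_in) (use g app_in[OF u'] in blast)
    have h1: "?h \<odot> e = u"
    proof (rule arr_ext[OF Cmp_in_S[OF e h] u'])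
      fix x assume x: "x \<in> A"
      have ex: "app e x \<in> B" using app_in[OF e x] .
      have "app u (g (app e x)) = app u x" by (rule u_eq) (use g[OF ex] x in auto)
      then show "app (?h \<odot> e) x = app u x" using app_Cmp[OF e h x] ex by simp
    qed
    have uniq: "h' = ?h" if h': "h' \<in> Hom S (i B) (i C)" "h' \<odot> e = u" for h'
    proof (rule arr_ext[OF h'(1) h])
      fix b assume b: "b \<in> B"
      have "app h' b = app (h' \<odot> e) (g b)" using app_Cmp[OF e h'(1)] g[OF b] by simp
      then show "app h' b = app ?h b" using h'(2) b by simp
    qed
    show ?thesis
      unfolding C
      by (rule ex1I[of _ ?h], (intro conjI ballI h h1; assumption?)[1], elim conjE, rule uniq)
  qed
  then show ?thesis unfolding is_coequalizer_def using e p q eq by (auto simp: Hom_iff)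
qed

lemma pullback_construct:
  assumes f: "f \<in> Hom S (i A) (i C)" and g: "g \<in> Hom S (i B) (i C)"
  defines "P \<equiv> {code [x, y] | x y. x \<in> A \<and> y \<in> B \<and> app f x = app g y}"
  defines "p \<equiv> arr P A (\<lambda>z. inv code z ! 0)" and "q \<equiv> arr P B (\<lambda>z. inv code z ! 1)"
  shows "p \<in> Hom S (i P) (i A)" "q \<in> Hom S (i P) (i B)" "f \<odot> p = g \<odot> q"
    "is_pullback S f g p q"
proof -
  show p: "p \<in> Hom S (i P) (i A)" unfolding p_def by (rule arr_in) (auto simp: P_def)
  show q: "q \<in> Hom S (i P) (i B)" unfolding q_def by (rule arr_in) (auto simp: P_def)
  have pq: "app p z = inv code z ! 0" "app q z = inv code z ! 1" if "z \<in> P" for z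
    using that by (simp_all add: p_def q_def)
  show eq: "f \<odot> p = g \<odot> q"
    by (rule arr_ext[OF Cmp_in_S[OF p f] Cmp_in_S[OF q g]])
      (use app_Cmp[OF p f] app_Cmp[OF q g] pq in \<open>auto simp: P_def\<close>)
  have lift: "\<exists>!h. h \<in> Hom S Q (i P) \<and> p \<odot> h = u \<and> q \<odot> h = v"
    if Q: "Q \<in> Obj S" and u: "u \<in> Hom S Q (i A)" and v: "v \<in> Hom S Q (i B)" and uv: "f \<odot> u = g \<odot> v"
    for Q u v
  proof -
    obtain D where D: "Q = i D" using Q Obj_S by blast
    note u = u[unfolded D] and v = v[unfolded D]
    have fg: "app f (app u x) = app g (app v x)" if "x \<in> D" for x
      using app_Cmp[OF u f that] app_Cmp[OF v g that] uv by simp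
    let ?h = "arr D P (\<lambda>x. code [app u x, app v x])"
    have mem: "code [app u x, app v x] \<in> P" if "x \<in> D" for x
      using fg[OF that] app_in[OF u that] app_in[OF v that] by (auto simp: P_def)
    have h: "?h \<in> Hom S (i D) (i P)" by (rule arr_in) (use mem in blast)
    have h1: "p \<odot> ?h = u"
      by (rule arr_ext[OF Cmp_in_S[OF h p] u]) (simp add: app_Cmp[OF h p] pq mem)
    have h2: "q \<odot> ?h = v"
      by (rule arr_ext[OF Cmp_in_S[OF h q] v]) (simp add: app_Cmp[OF h q] pq mem)
    have uniq: "h' = ?h" if h': "h' \<in> Hom S (i D) (i P)" "p \<odot> h' = u" "q \<odot> h' = v" for h'
    proof (rule arr_ext[OF h'(1) h])
      fix x assume x: "x \<in> D"
      have z: "app h' x \<in> P" using app_in[OF h'(1) x] .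
      then obtain y y' where "app h' x = code [y, y']" by (auto simp: P_def)
      moreover have "inv code (app h' x) ! 0 = app u x" "inv code (app h' x) ! 1 = app v x"
        using app_Cmp[OF h'(1) p x] app_Cmp[OF h'(1) q x] h'(2,3) pq[OF z] by simp_all
      ultimately show "app h' x = app ?h x" using x by simp
    qed
    show ?thesis
      unfolding D
      by (rule ex1I[of _ ?h], (intro conjI ballI h h1 h2; assumption?)[1], elim conjE, rule uniq)
  qed
  have "Dom S f = i A" "Dom S g = i B" "f \<in> Arr S" "g \<in> Arr S" "Cod S f = Cod S g"
    using f g by (auto simp: Hom_iff)
  then show "is_pullback S f g p q"
    unfolding is_pullback_def
    by (simp only: simp_thms) (intro exI[of _ "i P"] conjI p q eq ballI impI lift; assumption)
qed

text \<open>For a regular epimorphism \<open>e\<close>, the corestriction to its range equalizes the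
  same pair and therefore descends along \<open>e\<close> to a map \<open>h\<close> from
  \<open>B\<close> to the range. Since \<open>e\<close> is epic, the inclusion after
  \<open>h\<close> is the identity of \<open>B\<close>, so the range is all of
  \<open>B\<close>.\<close>

lemma regular_epi_iff:
  assumes e: "e \<in> Hom S (i A) (i B)"
  shows "regular_epi S e \<longleftrightarrow> app e ` A = B"
proof
  assume surj: "app e ` A = B"
  let ?P = "{code [x, y] | x y. x \<in> A \<and> y \<in> A \<and> app e x = app e y}"
  let ?p = "arr ?P A (\<lambda>z. inv code z ! 0)" and ?q = "arr ?P A (\<lambda>z. inv code z ! 1)"
  note pb = pullback_construct[OF e e]
  have "is_coequalizer S ?p ?q e"
  proof (rule coequalizer_by_kernel[OF e surj pb(1-3)])
    fix x y assume "x \<in> A" "y \<in> A" "app e x = app e y"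
    then have "code [x, y] \<in> ?P" by blast
    then show "\<exists>z\<in>?P. app ?p z = x \<and> app ?q z = y" by (intro bexI[of _ "code [x, y]"]) simp_all
  qed
  then show "regular_epi S e" by (auto simp: regular_epi_def)
next
  assume "regular_epi S e"
  then obtain f g where co: "is_coequalizer S f g e" by (auto simp: regular_epi_def)
  let ?C = "app e ` A"
  have CB: "?C \<subseteq> B" using app_in[OF e] by blast
  let ?e = "arr A ?C (app e)"
  have e': "?e \<in> Hom S (i A) (i ?C)" by (rule arr_in) simp
  have ie: "incl ?C B \<odot> ?e = e"
    by (rule arr_ext[OF Cmp_in_S[OF e' incl_in[OF CB]] e]) (simp add: app_Cmp[OF e' incl_in[OF CB]] app_incl)
  have "Cod S f = i A" "f \<in> Arr S" "g \<in> Hom S (Dom S f) (i A)" "e \<odot> f = e \<odot> g"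
    using co e by (auto simp: is_coequalizer_def Hom_iff)
  moreover obtain D where "Dom S f = i D" using Obj_S Dom_in calculation(2) by blast
  ultimately have fg: "f \<in> Hom S (i D) (i A)" "g \<in> Hom S (i D) (i A)" "e \<odot> f = e \<odot> g"
    by (auto simp: Hom_iff)
  have "?e \<odot> f = ?e \<odot> g"
  proof (rule arr_ext[OF Cmp_in_S[OF fg(1) e'] Cmp_in_S[OF fg(2) e']])
    fix x assume x: "x \<in> D"
    show "app (?e \<odot> f) x = app (?e \<odot> g) x"
      using app_Cmp[OF fg(1) e' x] app_Cmp[OF fg(2) e' x] app_Cmp[OF fg(1) e x] app_Cmp[OF fg(2) e x]
        fg(3) app_in[OF fg(1) x] app_in[OF fg(2) x] by simp
  qed
  from coequalizer_lift[OF co e e' this] obtain h where h: "h \<in> Hom S (i B) (i ?C)" "h \<odot> e = ?e" by blast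
  have ih: "incl ?C B \<odot> h \<in> Hom S (i B) (i B)" using Cmp_in_S[OF h(1) incl_in[OF CB]] .
  have "(incl ?C B \<odot> h) \<odot> e = Ide S (i B) \<odot> e"
    using assoc[OF e h(1) incl_in[OF CB]] h(2) ie Ide_Cmp[OF e] by simp
  then have eq: "incl ?C B \<odot> h = Ide S (i B)"
    using regular_epi_cancel[OF \<open>regular_epi S e\<close> e ih Ide_in_S] by simp
  have "b \<in> ?C" if b: "b \<in> B" for b
  proof -
    have "app (incl ?C B \<odot> h) b = b" using eq app_Ide[OF b] by simp
    then have "app h b = b" using app_Cmp[OF h(1) incl_in[OF CB] b] app_incl[OF app_in[OF h(1) b]] by simp
    then show ?thesis using app_in[OF h(1) b] by simp
  qed
  then show "app e ` A = B" using CB by blast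
qed

lemma pullback_point:
  assumes pb: "is_pullback S f g p q" and f: "f \<in> Hom S (i A) (i C)" and g: "g \<in> Hom S (i B) (i C)"
    and P: "p \<in> Hom S (i P) (i A)" "q \<in> Hom S (i P) (i B)"
    and xy: "x \<in> A" "y \<in> B" "app f x = app g y"
  shows "\<exists>z\<in>P. app p z = x \<and> app q z = y"
proof -
  have "f \<odot> const A x = g \<odot> const B y"
    using Cmp_const[OF f xy(1)] Cmp_const[OF g xy(2)] xy(3) by simp
  from is_pullbackD(4)[OF pb f g const_in[OF xy(1)] const_in[OF xy(2)] this]
  obtain h where h: "h \<in> Hom S (i {pt}) (i P)" "p \<odot> h = const A x" "q \<odot> h = const B y"
    using P by (auto simp: Hom_iff)
  have "app p (app h pt) = x" "app q (app h pt) = y"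
    using app_Cmp[OF h(1) P(1), of pt] app_Cmp[OF h(1) P(2), of pt] h(2,3) app_const by simp_all
  then show ?thesis using app_in[OF h(1), of pt] by auto
qed

sublocale regular_category S
proof
  have "\<exists>!f. f \<in> Hom S (i A) (i {pt})" for A
  proof
    show f: "arr A {pt} (\<lambda>_. pt) \<in> Hom S (i A) (i {pt})" by (rule arr_in) auto
    show "g = arr A {pt} (\<lambda>_. pt)" if g: "g \<in> Hom S (i A) (i {pt})" for g
      by (rule arr_ext[OF g f]) (use app_in[OF g] in auto)
  qed
  then show "\<exists>t. is_terminal S t" unfolding is_terminal_def using Obj_S by (metis i_in_Obj)
next
  fix f g assume fg: "f \<in> Arr S" "g \<in> Arr S" "Cod S f = Cod S g"
  then obtain A B C where "f \<in> Hom S (i A) (i C)" "g \<in> Hom S (i B) (i C)"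
    using Obj_S Dom_in Cod_in unfolding Hom_iff by metis
  from pullback_construct(4)[OF this] show "\<exists>p q. is_pullback S f g p q" by blast
next
  fix f p q assume pb: "is_pullback S f f p q"
  then have "f \<in> Arr S" by (simp add: is_pullback_def)
  then obtain A B where f: "f \<in> Hom S (i A) (i B)" using Obj_S Dom_in Cod_in unfolding Hom_iff by metis
  note D = is_pullbackD[OF pb f f]
  obtain P where "Dom S p = i P" using D(1) HomE by blast
  note D = D[unfolded this]
  let ?e = "arr A (app f ` A) (app f)"
  have e: "?e \<in> Hom S (i A) (i (app f ` A))" by (rule arr_in) simp
  have "is_coequalizer S p q ?e"
  proof (rule coequalizer_by_kernel[OF e _ D(1,2)])
    show "app ?e ` A = app f ` A" by (simp add: image_def)
    show "?e \<odot> p = ?e \<odot> q"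
    proof (rule arr_ext[OF Cmp_in_S[OF D(1) e] Cmp_in_S[OF D(2) e]])
      fix x assume x: "x \<in> P"
      show "app (?e \<odot> p) x = app (?e \<odot> q) x"
        using app_Cmp[OF D(1) e x] app_Cmp[OF D(2) e x] app_Cmp[OF D(1) f x] app_Cmp[OF D(2) f x]
          D(3) app_in[OF D(1) x] app_in[OF D(2) x] by simp
    qed
    fix x y assume xy: "x \<in> A" "y \<in> A" "app ?e x = app ?e y"
    then show "\<exists>z\<in>P. app p z = x \<and> app q z = y"
      using pullback_point[OF pb f f D(1,2) xy(1,2)] by simp
  qed
  then show "\<exists>e. is_coequalizer S p q e" by blast
next
  fix f e p q assume pb: "is_pullback S f e p q" and re: "regular_epi S e"
  then have "f \<in> Arr S" "e \<in> Arr S" "Cod S f = Cod S e" by (auto simp: is_pullback_def)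
  then obtain A B C where f: "f \<in> Hom S (i A) (i C)" and e: "e \<in> Hom S (i B) (i C)"
    using Obj_S Dom_in Cod_in unfolding Hom_iff by metis
  note D = is_pullbackD[OF pb f e]
  obtain P where "Dom S p = i P" using D(1) HomE by blast
  note D = D[unfolded this]
  have "x \<in> app p ` P" if x: "x \<in> A" for x
  proof -
    obtain y where "y \<in> B" "app f x = app e y"
      using re regular_epi_iff[OF e] app_in[OF f x] by blast
    then show ?thesis using pullback_point[OF pb f e D(1,2) x] by blast
  qed
  then show "regular_epi S p" using regular_epi_iff[OF D(1)] app_in[OF D(1)] by blast
qed

text \<open>Object and projections are packed into one pair \<open>c\<close>, so that a single
  choice in \<open>ctx_prod\<close> and in \<open>ar_prod\<close> fixes both.\<close>

lemma product_exists:
  assumes "finite J"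
  shows "\<exists>c. is_product S J (\<lambda>x. i (D x)) (i (fst c)) (snd c)"
proof -
  \<comment> \<open>An element of the product is coded by its values along \<open>xs\<close>.
    Repetitions in \<open>xs\<close> do no harm, because every coded list has the form
    \<open>map a xs\<close>.\<close>
  obtain xs where xs: "set xs = J" using finite_list[OF assms] by blast
  let ?P = "{code (map a xs) | a. \<forall>x\<in>J. a x \<in> D x}"
  let ?p = "\<lambda>x. arr ?P (D x) (\<lambda>z. the (map_of (zip xs (inv code z)) x))"
  have papp: "app (?p x) (code (map a xs)) = a x" if "\<forall>x\<in>J. a x \<in> D x" "x \<in> J" for a x
  proof -
    have "code (map a xs) \<in> ?P" using that by blast
    then show ?thesis using that xs by (simp add: map_of_zip_map)
  qed
  have p: "?p x \<in> Hom S (i ?P) (i (D x))" if "x \<in> J" for x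
    by (rule arr_in) (use that xs in \<open>auto simp: map_of_zip_map\<close>)
  have "\<exists>!h. h \<in> Hom S Q (i ?P) \<and> (\<forall>x\<in>J. ?p x \<odot> h = q x)"
    if Q: "Q \<in> Obj S" and q: "\<forall>x\<in>J. q x \<in> Hom S Q (i (D x))" for Q q
  proof -
    obtain C where C: "Q = i C" using Q Obj_S by blast
    have q: "q x \<in> Hom S (i C) (i (D x))" if "x \<in> J" for x using q C that by blast
    have mem: "\<forall>x\<in>J. app (q x) c \<in> D x" if "c \<in> C" for c using app_in[OF q that] by blast
    let ?h = "arr C ?P (\<lambda>c. code (map (\<lambda>x. app (q x) c) xs))"
    have h: "?h \<in> Hom S (i C) (i ?P)" by (rule arr_in) (use mem in blast)
    have h1: "?p x \<odot> ?h = q x" if x: "x \<in> J" for x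
    proof (rule arr_ext[OF Cmp_in_S[OF h p[OF x]] q[OF x]])
      fix c assume c: "c \<in> C"
      show "app (?p x \<odot> ?h) c = app (q x) c"
        using app_Cmp[OF h p[OF x] c] papp[OF mem[OF c] x] c by simp
    qed
    have uniq: "h' = ?h" if h': "h' \<in> Hom S (i C) (i ?P)" "\<forall>x\<in>J. ?p x \<odot> h' = q x" for h'
    proof (rule arr_ext[OF h'(1) h])
      fix c assume c: "c \<in> C"
      obtain a where a: "app h' c = code (map a xs)" "\<forall>x\<in>J. a x \<in> D x" using app_in[OF h'(1) c] by blast
      have "a x = app (q x) c" if x: "x \<in> J" for x
        using app_Cmp[OF h'(1) p[OF x] c] papp[OF a(2) x] a(1) h'(2) x by simp
      then have "map a xs = map (\<lambda>x. app (q x) c) xs" using xs by simp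
      then show "app h' c = app ?h c" using a(1) c by simp
    qed
    show ?thesis
      unfolding C
      by (rule ex1I[of _ ?h], (intro conjI ballI h h1; assumption?)[1], elim conjE, rule uniq)
  qed
  then have "is_product S J (\<lambda>x. i (D x)) (i ?P) ?p" unfolding is_product_def using p by simp
  then show ?thesis by (intro exI[of _ "(?P, ?p)"]) simp
qed

lemma product_point:
  assumes P: "is_product S J (\<lambda>x. i (D x)) (i A) p" and a: "\<And>x. x \<in> J \<Longrightarrow> a x \<in> D x"
  shows "\<exists>z\<in>A. \<forall>x\<in>J. app (p x) z = a x"
proof -
  have p: "p x \<in> Hom S (i A) (i (D x))" if "x \<in> J" for x using P that by (simp add: is_product_def)
  obtain h where h: "h \<in> Hom S (i {pt}) (i A)" "\<And>x. x \<in> J \<Longrightarrow> p x \<odot> h = const (D x) (a x)"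
    using product_tuple[OF P i_in_Obj const_in[OF a]] by blast
  have "app (p x) (app h pt) = a x" if "x \<in> J" for x
    using app_Cmp[OF h(1) p[OF that], of pt] h(2)[OF that] app_const by simp
  then show ?thesis using app_in[OF h(1), of pt] by auto
qed

lemma product_point_eqI:
  assumes P: "is_product S J (\<lambda>x. i (D x)) (i A) p" and z: "z \<in> A" "z' \<in> A"
    and eq: "\<And>x. x \<in> J \<Longrightarrow> app (p x) z = app (p x) z'"
  shows "z = z'"
proof -
  have p: "p x \<in> Hom S (i A) (i (D x))" if "x \<in> J" for x using P that by (simp add: is_product_def)
  have "const A z = const A z'"
    by (rule product_eqI[OF P const_in[OF z(1)] const_in[OF z(2)]])
      (simp add: Cmp_const[OF p z(1)] Cmp_const[OF p z(2)] eq)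
  then show ?thesis using app_const by metis
qed

end

section \<open>Set-valued structures as interpretations\<close>

locale struct_interp = coded_sets i j code + language L
  for i :: "'a set \<Rightarrow> 'o" and j :: "'a set \<times> 'a set \<times> ('a \<times> 'a) set \<Rightarrow> 'm" and code :: "'a list \<Rightarrow> 'a"
    and L :: "('s, 'f, 'r, 'v) signature" +
  fixes M :: "('a, 's, 'f, 'r) struct"
  assumes struct: "is_struct L M"
begin

definition ctx_prod :: "'v set \<Rightarrow> 'a set \<times> ('v \<Rightarrow> 'm)" where
  "ctx_prod U = (SOME c. is_product S U (\<lambda>x. i (carr M (vsort L x))) (i (fst c)) (snd c))"

definition ar_prod :: "'s list \<Rightarrow> 'a set \<times> (nat \<Rightarrow> 'm)" where
  "ar_prod ss = (SOME c. is_product S {..<length ss} (\<lambda>k. i (carr M (ss ! k))) (i (fst c)) (snd c))"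

abbreviation pts :: "'v set \<Rightarrow> 'a set" where
  "pts U \<equiv> fst (ctx_prod U)"

abbreviation ar_pts :: "'s list \<Rightarrow> 'a set" where
  "ar_pts ss \<equiv> fst (ar_prod ss)"

definition args :: "'s list \<Rightarrow> 'a \<Rightarrow> 'a list" where
  "args ss z = map (\<lambda>k. app (snd (ar_prod ss) k) z) [0..<length ss]"

definition I :: "('o, 'm, 's, 'f, 'r, 'v) interp" where
  "I = \<lparr>sort_obj = \<lambda>s. i (carr M s),
     ctx_obj = \<lambda>U. i (pts U), ctx_proj = \<lambda>U. snd (ctx_prod U),
     ar_obj = \<lambda>ss. i (ar_pts ss), ar_proj = \<lambda>ss. snd (ar_prod ss),
     fun_arr = \<lambda>f. arr (ar_pts (fdom L f)) (carr M (fcod L f)) (\<lambda>z. fint M f (args (fdom L f) z)),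
     rel_sub = \<lambda>r. incl {z \<in> ar_pts (rdom L r). args (rdom L r) z \<in> rint M r} (ar_pts (rdom L r))\<rparr>"

lemma ctx_prod:
  assumes "is_ctx L U"
  shows "is_product S U (\<lambda>x. i (carr M (vsort L x))) (i (pts U)) (snd (ctx_prod U))"
  unfolding ctx_prod_def by (rule someI_ex, rule product_exists) (use assms in \<open>simp add: is_ctx_def\<close>)

lemma ar_prod: "is_product S {..<length ss} (\<lambda>k. i (carr M (ss ! k))) (i (ar_pts ss)) (snd (ar_prod ss))"
  unfolding ar_prod_def by (rule someI_ex, rule product_exists) simp

lemma args_in_carr: "z \<in> ar_pts ss \<Longrightarrow> list_all2 (\<lambda>d s. d \<in> carr M s) (args ss z) ss"
proof -
  assume z: "z \<in> ar_pts ss"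
  have "snd (ar_prod ss) k \<in> Hom S (i (ar_pts ss)) (i (carr M (ss ! k)))" if "k < length ss" for k
    using ar_prod[of ss] that by (simp add: is_product_def)
  from app_in[OF this z] show ?thesis by (simp add: args_def list_all2_conv_all_nth)
qed

lemma is_interp_I: "is_interp S L I"
  unfolding is_interp_def
proof (intro conjI ballI allI impI)
  fix f assume f: "f \<in> funs L"
  show "fun_arr I f \<in> Hom S (ar_obj I (fdom L f)) (sort_obj I (fcod L f))"
    unfolding I_def interp.simps
    by (rule arr_in) (use struct f args_in_carr in \<open>auto simp: is_struct_def\<close>)
next
  fix r assume "r \<in> rels L"
  show "mono_into S (ar_obj I (rdom L r)) (rel_sub I r)"
    unfolding I_def interp.simps by (rule incl_mono) auto
qed (use ctx_prod ar_prod in \<open>simp_all add: I_def\<close>)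

sublocale interpretation_of S L I
  by unfold_locales (rule is_interp_I)

lemma ctx_obj_I [simp]: "ctx_obj I U = i (pts U)"
  by (simp add: I_def)

text \<open>The points of a chosen product are known only through their projections;
  \<open>env U z\<close> reads the assignment off a point. Its values outside \<open>U\<close> carry
  no meaning, hence the later appeals to \<open>sat_cong\<close>.\<close>

definition env :: "'v set \<Rightarrow> 'a \<Rightarrow> 'v \<Rightarrow> 'a" where
  "env U z = (\<lambda>x. app (ctx_proj I U x) z)"

lemma ctx_proj_Hom: "is_ctx L U \<Longrightarrow> x \<in> U \<Longrightarrow> ctx_proj I U x \<in> Hom S (i (pts U)) (i (carr M (vsort L x)))"
  using ctx_proj_in by (simp add: I_def)

lemma env_in: "is_ctx L U \<Longrightarrow> z \<in> pts U \<Longrightarrow> assignment L M U (env U z)"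
  using app_in[OF ctx_proj_Hom] by (auto simp: assignment_def env_def)

lemma env_exists:
  assumes "is_ctx L U" "assignment L M U a"
  shows "\<exists>z\<in>pts U. \<forall>x\<in>U. env U z x = a x"
  using product_point[OF ctx_prod[OF assms(1)], of a] assms(2)
  by (auto simp: assignment_def env_def I_def)

lemma env_eqI:
  assumes "is_ctx L U" "z \<in> pts U" "z' \<in> pts U" "\<And>x. x \<in> U \<Longrightarrow> env U z x = env U z' x"
  shows "z = z'"
  by (rule product_point_eqI[OF ctx_prod[OF assms(1)] assms(2,3)]) (use assms(4) in \<open>simp add: env_def I_def\<close>)

lemma env_restrict:
  assumes V: "is_ctx L V" "U \<subseteq> V" "z \<in> pts V" "x \<in> U"
  shows "env U (app (restrict S I U V) z) x = env V z x"
proof -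
  have r: "restrict S I U V \<in> Hom S (i (pts V)) (i (pts U))" using restrict_in[OF V(1,2)] by simp
  show ?thesis
    using app_Cmp[OF r ctx_proj_Hom[OF ctx_subset[OF V(1,2)] V(4)] V(3)] proj_restrict[OF V(1,2,4)]
    by (simp add: env_def)
qed

lemma app_proj:
  assumes "is_ctx L U" "h \<in> Hom S (i Q) (i (pts U))" "q \<in> Q" "x \<in> U"
  shows "app (ctx_proj I U x \<odot> h) q = env U (app h q) x"
  using app_Cmp[OF assms(2) ctx_proj_Hom[OF assms(1,4)] assms(3)] by (simp add: env_def)

lemma args_tuple:
  assumes U: "is_ctx L U" and ts: "\<And>t. t \<in> set ts \<Longrightarrow> tm_wf L t \<and> tm_fv t \<subseteq> U"
    and ss: "map (tm_sort L) ts = ss" "set ss \<subseteq> sorts L" and z: "z \<in> pts U"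
    and tv: "\<And>t. t \<in> set ts \<Longrightarrow> app (tm_sem S L I U t) z = tval M (env U z) t"
  shows "args ss (app (ar_tuple S I (ctx_obj I U) ss (map (tm_sem S L I U) ts)) z) = map (tval M (env U z)) ts"
proof (rule nth_equalityI)
  let ?t = "ar_tuple S I (ctx_obj I U) ss (map (tm_sem S L I U) ts)"
  have len: "length ts = length ss" using arg_cong[OF ss(1), of length] by simp
  then show "length (args ss (app ?t z)) = length (map (tval M (env U z)) ts)" by (simp add: args_def)
  have t: "?t \<in> Hom S (i (pts U)) (i (ar_pts ss))"
    using args_tuple_in[OF U ts ss] by (simp add: I_def)
  fix k assume "k < length (args ss (app ?t z))"
  then have k: "k < length ss" by (simp add: args_def)
  have p: "ar_proj I ss k \<in> Hom S (i (ar_pts ss)) (i (carr M (ss ! k)))"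
    using ar_proj_in[OF ss(2) k] by (simp add: I_def)
  have "ar_proj I ss k \<odot> ?t = map (tm_sem S L I U) ts ! k"
    by (rule proj_ar_tuple[OF ss(2) ctx_obj_in[OF U] _ k]) (rule args_in(1)[OF U ts ss(1)])
  then have "app (ar_proj I ss k) (app ?t z) = app (tm_sem S L I U (ts ! k)) z"
    using app_Cmp[OF t p z] k len by simp
  also have "\<dots> = tval M (env U z) (ts ! k)" using tv k len by simp
  finally show "args ss (app ?t z) ! k = map (tval M (env U z)) ts ! k"
    using k len by (simp add: args_def I_def)
qed

lemma app_tm_sem:
  assumes U: "is_ctx L U" and z: "z \<in> pts U"
  shows "tm_wf L t \<Longrightarrow> tm_fv t \<subseteq> U \<Longrightarrow> app (tm_sem S L I U t) z = tval M (env U z) t"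
proof (induction t)
  case (Var x)
  then show ?case by (simp add: env_def)
next
  case (Fun f ts)
  have ts: "tm_wf L t \<and> tm_fv t \<subseteq> U" if "t \<in> set ts" for t using that Fun.prems by auto
  have f: "f \<in> funs L" and ss: "map (tm_sort L) ts = fdom L f" using Fun.prems by auto
  let ?t = "ar_tuple S I (ctx_obj I U) (fdom L f) (map (tm_sem S L I U) ts)"
  have t: "?t \<in> Hom S (i (pts U)) (i (ar_pts (fdom L f)))"
    using args_tuple_in[OF U ts ss fdom_in[OF f]] by (simp add: I_def)
  have fa: "fun_arr I f \<in> Hom S (i (ar_pts (fdom L f))) (i (carr M (fcod L f)))"
    using is_interp_I f unfolding is_interp_def by (simp add: I_def)
  have "args (fdom L f) (app ?t z) = map (tval M (env U z)) ts"
    by (rule args_tuple[OF U ts ss fdom_in[OF f] z]) (use Fun.IH ts in auto)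
  moreover have "app (fun_arr I f) (app ?t z) = fint M f (args (fdom L f) (app ?t z))"
    using app_in[OF t z] by (simp add: I_def)
  ultimately have "app (fun_arr I f) (app ?t z) = tval M (env U z) (Fun f ts)" by simp
  then show ?case using app_Cmp[OF t fa z] by simp
qed

text \<open>Forcing over sets is Tarski truth at each element of \<open>Q\<close>. The existential
  is the case with content: covers are surjections, so each \<open>q\<close> has a preimage at which
  a witness is available.\<close>

lemma factors_sem_iff:
  "is_ctx L U \<Longrightarrow> \<phi> \<in> fms L U \<Longrightarrow> h \<in> Hom S (i Q) (i (pts U)) \<Longrightarrow>
    factors S h (sem S L I \<phi> U) \<longleftrightarrow> (\<forall>q\<in>Q. sat L M \<phi> (env U (app h q)))"
proof (induction \<phi> arbitrary: U h Q)
  case Top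
  then show ?case using factors_sem_Top[of h "i Q" U] by simp
next
  case (Rel r ts)
  note U = Rel(1) and h = Rel(3)
  let ?T = "ar_tuple S I (ctx_obj I U) (rdom L r) (map (tm_sem S L I U) ts)"
  have r: "r \<in> rels L" and ss: "map (tm_sort L) ts = rdom L r"
    and ts: "\<And>t. t \<in> set ts \<Longrightarrow> tm_wf L t \<and> tm_fv t \<subseteq> U" using Rel(2) by (auto simp: fms_simps)
  have T: "?T \<in> Hom S (i (pts U)) (i (ar_pts (rdom L r)))"
    using args_tuple_in[OF U ts ss rdom_in[OF r]] by (simp add: I_def)
  have rel: "rel_sub I r = incl {z \<in> ar_pts (rdom L r). args (rdom L r) z \<in> rint M r} (ar_pts (rdom L r))"
    by (simp add: I_def)
  have args: "args (rdom L r) (app (?T \<odot> h) q) = map (tval M (env U (app h q))) ts" if q: "q \<in> Q" for q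
    using args_tuple[OF U ts ss rdom_in[OF r] app_in[OF h q]] app_tm_sem[OF U app_in[OF h q]] ts
      app_Cmp[OF h T q] by simp
  have "factors S h (sem S L I (Rel r ts) U) \<longleftrightarrow> factors S (?T \<odot> h) (rel_sub I r)"
    using classifiesD(2)[OF classifies_sem_Rel[OF U Rel(2)]] h by simp
  also have "\<dots> \<longleftrightarrow> app (?T \<odot> h) ` Q \<subseteq> {z \<in> ar_pts (rdom L r). args (rdom L r) z \<in> rint M r}"
    unfolding rel by (rule factors_incl[OF _ Cmp_in_S[OF h T]]) auto
  also have "\<dots> \<longleftrightarrow> (\<forall>q\<in>Q. args (rdom L r) (app (?T \<odot> h) q) \<in> rint M r)"
    using app_in[OF Cmp_in_S[OF h T]] by auto
  also have "\<dots> \<longleftrightarrow> (\<forall>q\<in>Q. sat L M (Rel r ts) (env U (app h q)))" using args by simp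
  finally show ?case .
next
  case (Eq s t)
  note U = Eq(1) and h = Eq(3)
  have st: "tm_wf L s" "tm_fv s \<subseteq> U" "tm_wf L t" "tm_fv t \<subseteq> U" "tm_sort L s = tm_sort L t"
    using Eq(2) by (auto simp: fms_simps)
  have s: "tm_sem S L I U s \<in> Hom S (i (pts U)) (i (carr M (tm_sort L s)))"
    and t: "tm_sem S L I U t \<in> Hom S (i (pts U)) (i (carr M (tm_sort L s)))"
    using tm_sem_in[OF U st(1,2)] tm_sem_in[OF U st(3,4)] st(5) by (simp_all add: I_def)
  have tv: "app (tm_sem S L I U s \<odot> h) q = tval M (env U (app h q)) s"
    "app (tm_sem S L I U t \<odot> h) q = tval M (env U (app h q)) t" if q: "q \<in> Q" for q
    using app_Cmp[OF h s q] app_Cmp[OF h t q] app_tm_sem[OF U app_in[OF h q]] st by simp_all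
  have "factors S h (sem S L I (Eq s t) U) \<longleftrightarrow> tm_sem S L I U s \<odot> h = tm_sem S L I U t \<odot> h"
    using classifiesD(2)[OF classifies_sem_Eq[OF U Eq(2)]] h by simp
  also have "\<dots> \<longleftrightarrow> (\<forall>q\<in>Q. sat L M (Eq s t) (env U (app h q)))"
    using arr_ext[OF Cmp_in_S[OF h s] Cmp_in_S[OF h t]] tv by fastforce
  finally show ?case .
next
  case (And \<phi> \<psi>)
  then show ?case
    using factors_sem_And[OF And.prems(1,2), of h "i Q"] by (auto simp: fms_simps)
next
  case (Ex x \<phi>)
  note U = Ex.prems(1) and h = Ex.prems(3)
  let ?V = "insert x U"
  have x: "x \<in> vars L" "\<phi> \<in> fms L ?V" using Ex.prems(2) by (auto simp: fms_simps)
  note V = ctx_insert[OF U x(1)]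
  have fvs: "y \<in> ?V" if "y \<in> fv \<phi>" for y using x(2) that by (auto simp: fms_def)
  have iff: "factors S h (sem S L I (Ex x \<phi>) U) \<longleftrightarrow>
    (\<exists>R e k. regular_epi S e \<and> e \<in> Hom S R (i Q) \<and>
       k \<in> Hom S R (i (pts ?V)) \<and> factors S k (sem S L I \<phi> ?V) \<and>
       (\<forall>y\<in>U - {x}. ctx_proj I ?V y \<odot> k = ctx_proj I U y \<odot> (h \<odot> e)))"
    using factors_sem_Ex[OF U Ex.prems(2)] h by simp
  show ?case
  proof
    assume "factors S h (sem S L I (Ex x \<phi>) U)"
    then obtain R0 e k where e0: "regular_epi S e" "e \<in> Hom S R0 (i Q)"
      "k \<in> Hom S R0 (i (pts ?V))" "factors S k (sem S L I \<phi> ?V)"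
      and eq: "\<forall>y\<in>U - {x}. ctx_proj I ?V y \<odot> k = ctx_proj I U y \<odot> (h \<odot> e)"
      using iff by blast
    obtain R where R: "R0 = i R" using HomE[OF e0(2)] by blast
    note e = e0(2)[unfolded R] and k = e0(3)[unfolded R]
    show "\<forall>q\<in>Q. sat L M (Ex x \<phi>) (env U (app h q))"
    proof
      fix q assume "q \<in> Q"
      then obtain p where p: "p \<in> R" "app e p = q" using e0(1) regular_epi_iff[OF e] by blast
      have "sat L M \<phi> (env ?V (app k p))" using Ex.IH[OF V x(2) k] e0(4) p(1) by blast
      moreover have "env ?V (app k p) y = env U (app h q) y" if y: "y \<in> U" "y \<noteq> x" for y
      proof -
        have "ctx_proj I ?V y \<odot> k = ctx_proj I U y \<odot> (h \<odot> e)" using eq y by blast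
        then show ?thesis
          using app_proj[OF V k p(1), of y] app_proj[OF U Cmp_in_S[OF e h] p(1) y(1)] app_Cmp[OF e h p(1)] p(2) y
          by simp
      qed
      then have "sat L M \<phi> (env ?V (app k p)) \<longleftrightarrow> sat L M \<phi> ((env U (app h q))(x := env ?V (app k p) x))"
        by (intro sat_cong) (use fvs in auto)
      ultimately have "sat L M \<phi> ((env U (app h q))(x := env ?V (app k p) x))" by simp
      moreover have "env ?V (app k p) x \<in> carr M (vsort L x)"
        using env_in[OF V app_in[OF k p(1)]] by (simp add: assignment_def)
      ultimately show "sat L M (Ex x \<phi>) (env U (app h q))" by auto
    qed
  next
    assume "\<forall>q\<in>Q. sat L M (Ex x \<phi>) (env U (app h q))"
    then have "\<forall>q\<in>Q. \<exists>d. d \<in> carr M (vsort L x) \<and> sat L M \<phi> ((env U (app h q))(x := d))" by auto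
    \<comment> \<open>Collecting the witnesses into one function \<open>d\<close> by choice makes
      the identity of \<open>Q\<close> a sufficient cover.\<close>
    then obtain d where d: "\<And>q. q \<in> Q \<Longrightarrow> d q \<in> carr M (vsort L x)"
      "\<And>q. q \<in> Q \<Longrightarrow> sat L M \<phi> ((env U (app h q))(x := d q))" by metis
    let ?q = "\<lambda>y. if y = x then arr Q (carr M (vsort L x)) d else ctx_proj I U y \<odot> h"
    have "?q y \<in> Hom S (i Q) (sort_obj I (vsort L y))" if "y \<in> ?V" for y
      using that arr_in[of d Q "carr M (vsort L x)"] d(1) Cmp_in_S[OF h ctx_proj_Hom[OF U]] by (auto simp: I_def)
    from product_tuple[OF ctx_product[OF V] i_in_Obj this]
    obtain k where k: "k \<in> Hom S (i Q) (i (pts ?V))" "\<And>y. y \<in> ?V \<Longrightarrow> ctx_proj I ?V y \<odot> k = ?q y"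
      unfolding ctx_obj_I by blast
    have "sat L M \<phi> (env ?V (app k q))" if q: "q \<in> Q" for q
    proof -
      have "env ?V (app k q) y = ((env U (app h q))(x := d q)) y" if y: "y \<in> fv \<phi>" for y
      proof -
        have eq: "env ?V (app k q) y = app (?q y) q"
          unfolding app_proj[OF V k(1) q fvs[OF y], symmetric] k(2)[OF fvs[OF y]] ..
        show ?thesis
        proof (cases "y = x")
          case True
          then show ?thesis unfolding eq using q by simp
        next
          case False
          then have "y \<in> U" using fvs[OF y] by simp
          then show ?thesis unfolding eq using app_proj[OF U h q] False by simp
        qed
      qed
      then have "sat L M \<phi> (env ?V (app k q)) \<longleftrightarrow> sat L M \<phi> ((env U (app h q))(x := d q))"
        by (rule sat_cong)
      then show ?thesis using d(2)[OF q] by blast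
    qed
    then have "factors S k (sem S L I \<phi> ?V)" using Ex.IH[OF V x(2) k(1)] by blast
    moreover have "regular_epi S (Ide S (i Q))"
      using regular_epi_iff[OF Ide_in_S] app_Ide by force
    moreover have "\<forall>y\<in>U - {x}. ctx_proj I ?V y \<odot> k = ctx_proj I U y \<odot> (h \<odot> Ide S (i Q))"
      using k(2) Cmp_Ide[OF h] by simp
    ultimately show "factors S h (sem S L I (Ex x \<phi>) U)" using iff Ide_in_S k(1) by blast
  qed
qed

lemma model_I:
  assumes E: "regular_theory L E" and M: "set_model L E M"
  shows "model S L E I"
  unfolding model_def
proof (intro conjI allI impI is_interp_I)
  fix U \<Gamma> \<phi> assume e: "E U \<Gamma> \<phi>"
  interpret E: regular_theory L E by (rule E)
  obtain \<Delta> where \<Delta>: "finite \<Delta>" "\<Delta> \<subseteq> \<Gamma>" "E U \<Delta> \<phi>" using E.finitary[OF e] by blast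
  have U: "is_ctx L U" "\<Delta> \<subseteq> fms L U" "\<phi> \<in> fms L U" using E.in_context[OF \<Delta>(3)] by auto
  let ?N = "(\<lambda>\<psi>. sem S L I \<psi> U) ` \<Delta>"
  let ?m = "sub_Inf S (ctx_obj I U) ?N"
  have c: "classifies S (ctx_obj I U) ?m (\<lambda>h. \<forall>n\<in>?N. factors S h n)"
    by (rule sub_Inf_classifies) (use \<Delta>(1) sem_mono[OF U(1)] U(2) in auto)
  have m: "?m \<in> Hom S (Dom S ?m) (i (pts U))" using mono_into_Hom[OF classifiesD(1)[OF c]] by simp
  obtain Q where Q: "Dom S ?m = i Q" using HomE[OF m] by blast
  note m' = m[unfolded Q]
  \<comment> \<open>The meet is tested on its own inclusion, regarded as a generalized
    element.\<close>
  have "\<forall>n\<in>?N. factors S ?m n"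
    using classifiesD(2)[OF c] m factors_refl[OF m] by simp
  then have "\<forall>\<psi>\<in>\<Delta>. \<forall>q\<in>Q. sat L M \<psi> (env U (app ?m q))"
    using factors_sem_iff[OF U(1) _ m'] U(2) by blast
  then have "\<forall>q\<in>Q. sat L M \<phi> (env U (app ?m q))"
    using M \<Delta>(3) env_in[OF U(1) app_in[OF m']] unfolding set_model_def by blast
  then have "sub_le S ?m (sem S L I \<phi> U)" using factors_sem_iff[OF U(1,3) m'] by blast
  then show "\<exists>\<Delta>. finite \<Delta> \<and> \<Delta> \<subseteq> \<Gamma> \<and>
      sub_le S (sub_Inf S (ctx_obj I U) ((\<lambda>\<psi>. sem S L I \<psi> U) ` \<Delta>)) (sem S L I \<phi> U)"
    using \<Delta> by blast
qed

section \<open>The subpresheaf of solutions of a set of formulas\<close>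

definition solutions :: "('f, 'r, 'v) fm set \<Rightarrow> 'v set \<Rightarrow> 'a set" where
  "solutions \<Theta> U = {z \<in> pts U. \<forall>\<psi>\<in>\<Theta> \<inter> fms L U. sat L M \<psi> (env U z)}"

definition solution_sub :: "('f, 'r, 'v) fm set \<Rightarrow> 'v set \<Rightarrow> 'm" where
  "solution_sub \<Theta> U = incl (solutions \<Theta> U) (pts U)"

lemma solution_sub_in: "solution_sub \<Theta> U \<in> Hom S (i (solutions \<Theta> U)) (i (pts U))"
  unfolding solution_sub_def by (rule incl_in) (auto simp: solutions_def)

lemma app_solution_sub: "z \<in> solutions \<Theta> U \<Longrightarrow> app (solution_sub \<Theta> U) z = z"
  by (simp add: solution_sub_def app_incl)

lemma solution_sub_mono: "mono_into S (ctx_obj I U) (solution_sub \<Theta> U)"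
  unfolding solution_sub_def ctx_obj_I by (rule incl_mono) (auto simp: solutions_def)

lemma factors_solution_sub:
  assumes "is_ctx L U" "\<phi> \<in> fms L U"
  shows "factors S (solution_sub \<Theta> U) (sem S L I \<phi> U) \<longleftrightarrow> (\<forall>z\<in>solutions \<Theta> U. sat L M \<phi> (env U z))"
  using factors_sem_iff[OF assms solution_sub_in] app_solution_sub by simp

lemma restrict_solution:
  assumes V: "is_ctx L V" "U \<subseteq> V" and z: "z \<in> solutions \<Theta> V"
  shows "app (restrict S I U V) z \<in> solutions \<Theta> U"
proof -
  have zV: "z \<in> pts V" using z by (simp add: solutions_def)
  have r: "restrict S I U V \<in> Hom S (i (pts V)) (i (pts U))" using restrict_in[OF V] by simp
  have "sat L M \<psi> (env U (app (restrict S I U V) z))" if \<psi>: "\<psi> \<in> \<Theta> \<inter> fms L U" for \<psi>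
  proof -
    have "\<psi> \<in> \<Theta> \<inter> fms L V" using \<psi> V(2) by (auto simp: fms_def)
    then have "sat L M \<psi> (env V z)" using z by (simp add: solutions_def)
    moreover have "sat L M \<psi> (env U (app (restrict S I U V) z)) \<longleftrightarrow> sat L M \<psi> (env V z)"
      by (rule sat_cong, rule env_restrict[OF V zV]) (use \<psi> in \<open>auto simp: fms_def\<close>)
    ultimately show ?thesis by simp
  qed
  then show ?thesis using app_in[OF r zV] by (simp add: solutions_def)
qed

text \<open>The hypothesis \<open>ext\<close> is the surjectivity of restriction between solution
  sets, phrased with assignments; by \<open>regular_epi_iff\<close> surjections are the regular
  epimorphisms.\<close>

lemma no_signalling_solutions:
  assumes K: "\<And>U. U \<in> K \<Longrightarrow> is_ctx L U"
    and ext: "\<And>U V a. V \<in> K \<Longrightarrow> U \<in> K \<Longrightarrow> U \<subseteq> V \<Longrightarrow> assignment L M U a \<Longrightarrow>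
      \<forall>\<psi>\<in>\<Theta> \<inter> fms L U. sat L M \<psi> a \<Longrightarrow>
      \<exists>b. assignment L M V b \<and> (\<forall>x\<in>U. b x = a x) \<and> (\<forall>\<psi>\<in>\<Theta> \<inter> fms L V. sat L M \<psi> b)"
  shows "no_signalling S I K (solution_sub \<Theta>)"
proof -
  have fact: "factors S (restrict S I U V \<odot> solution_sub \<Theta> V) (solution_sub \<Theta> U)"
    and epi: "regular_epi S (sub_restrict S I (solution_sub \<Theta>) U V)"
    if UV: "V \<in> K" "U \<in> K" "U \<subseteq> V" for U V
  proof -
    note V = K[OF UV(1)] and U = K[OF UV(2)]
    have r: "restrict S I U V \<in> Hom S (i (pts V)) (i (pts U))" using restrict_in[OF V UV(3)] by simp
    note sV = solution_sub_in[of \<Theta> V] and sU = solution_sub_in[of \<Theta> U]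
    let ?k = "arr (solutions \<Theta> V) (solutions \<Theta> U) (app (restrict S I U V))"
    have k: "?k \<in> Hom S (i (solutions \<Theta> V)) (i (solutions \<Theta> U))"
      by (rule arr_in) (use restrict_solution[OF V UV(3)] in blast)
    have eq: "solution_sub \<Theta> U \<odot> ?k = restrict S I U V \<odot> solution_sub \<Theta> V"
      by (rule arr_ext[OF Cmp_in_S[OF k sU] Cmp_in_S[OF sV r]])
        (simp add: app_Cmp[OF k sU] app_Cmp[OF sV r] app_solution_sub restrict_solution[OF V UV(3)])
    have D: "Dom S (solution_sub \<Theta> W) = i (solutions \<Theta> W)" for W
      using solution_sub_in[of \<Theta> W] by (simp add: Hom_iff)
    show "factors S (restrict S I U V \<odot> solution_sub \<Theta> V) (solution_sub \<Theta> U)"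
      using k eq Cmp_in_S[OF sV r] D by (auto simp: factors_def Hom_iff)
    have "sub_restrict S I (solution_sub \<Theta>) U V = ?k"
      unfolding sub_restrict_def D
      by (rule the_equality) (use k eq mono_cancel[OF solution_sub_mono] D in \<open>metis+\<close>)
    moreover have "z \<in> app ?k ` solutions \<Theta> V" if z: "z \<in> solutions \<Theta> U" for z
    proof -
      have zU: "z \<in> pts U" using z by (simp add: solutions_def)
      obtain b where b: "assignment L M V b" "\<forall>x\<in>U. b x = env U z x" "\<forall>\<psi>\<in>\<Theta> \<inter> fms L V. sat L M \<psi> b"
        using ext[OF UV env_in[OF U zU]] z by (auto simp: solutions_def)
      obtain z' where z': "z' \<in> pts V" "\<forall>x\<in>V. env V z' x = b x" using env_exists[OF V b(1)] by blast
      have "sat L M \<psi> (env V z')" if \<psi>: "\<psi> \<in> \<Theta> \<inter> fms L V" for \<psi>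
      proof -
        have "sat L M \<psi> (env V z') \<longleftrightarrow> sat L M \<psi> b"
          by (rule sat_cong) (use \<psi> z'(2) in \<open>auto simp: fms_def\<close>)
        then show ?thesis using b(3) \<psi> by blast
      qed
      then have sol: "z' \<in> solutions \<Theta> V" using z'(1) by (simp add: solutions_def)
      have "app (restrict S I U V) z' = z"
      proof (rule env_eqI[OF U app_in[OF r z'(1)] zU])
        fix x assume x: "x \<in> U"
        then show "env U (app (restrict S I U V) z') x = env U z x"
          using env_restrict[OF V UV(3) z'(1) x] z'(2) b(2) UV(3) by auto
      qed
      then have "app ?k z' = z" using sol by simp
      then show ?thesis using sol by blast
    qed
    ultimately show "regular_epi S (sub_restrict S I (solution_sub \<Theta>) U V)"
      using regular_epi_iff[OF k] app_in[OF k] by auto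
  qed
  show ?thesis
    unfolding no_signalling_def subpresheaf_def using solution_sub_mono fact epi by blast
qed

lemma solutions_satisfy:
  assumes K: "\<And>U. U \<in> K \<Longrightarrow> is_ctx L U" and "\<psi> \<in> \<Theta>"
  shows "satisfies S L I K (solution_sub \<Theta>) \<psi>"
  unfolding satisfies_def using factors_solution_sub[OF K] assms(2) by (auto simp: solutions_def)

lemma solutions_refute:
  assumes K: "\<And>U. U \<in> K \<Longrightarrow> is_ctx L U" and U: "U \<in> K" "\<phi> \<in> fms L U"
    and a: "assignment L M U a" "\<forall>\<psi>\<in>\<Theta> \<inter> fms L U. sat L M \<psi> a" "\<not> sat L M \<phi> a"
  shows "\<not> satisfies S L I K (solution_sub \<Theta>) \<phi>"
proof
  assume s: "satisfies S L I K (solution_sub \<Theta>) \<phi>"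
  obtain z where z: "z \<in> pts U" "\<forall>x\<in>U. env U z x = a x" using env_exists[OF K[OF U(1)] a(1)] by blast
  have eq: "sat L M \<psi> (env U z) \<longleftrightarrow> sat L M \<psi> a" if "\<psi> \<in> fms L U" for \<psi>
    by (rule sat_cong) (use that z(2) in \<open>auto simp: fms_def\<close>)
  then have "z \<in> solutions \<Theta> U" using z(1) a(2) by (auto simp: solutions_def)
  moreover have "factors S (solution_sub \<Theta> U) (sem S L I \<phi> U)" using s U unfolding satisfies_def by blast
  ultimately have "sat L M \<phi> (env U z)" using factors_solution_sub[OF K[OF U(1)] U(2)] by blast
  then show False using eq[OF U(2)] a(3) by blast
qed

end

section \<open>Substitution\<close>

text \<open>Unlike \<open>tm_subst\<close>, this may change the type of variables, as is needed to
  pass between variables and names.\<close>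

fun tm_bind :: "('v \<Rightarrow> ('f, 'w) tm) \<Rightarrow> ('f, 'v) tm \<Rightarrow> ('f, 'w) tm" where
  "tm_bind \<sigma> (Var x) = \<sigma> x"
| "tm_bind \<sigma> (Fun f ts) = Fun f (map (tm_bind \<sigma>) ts)"

lemma tm_subst_eq_bind: "tm_subst \<sigma> t = tm_bind \<sigma> t"
  by (induction t) auto

lemma tm_bind_cong: "(\<And>x. x \<in> tm_fv t \<Longrightarrow> \<sigma> x = \<tau> x) \<Longrightarrow> tm_bind \<sigma> t = tm_bind \<tau> t"
  by (induction t) auto

lemma tm_bind_bind: "tm_bind \<tau> (tm_bind \<sigma> t) = tm_bind (\<lambda>x. tm_bind \<tau> (\<sigma> x)) t"
  by (induction t) auto

lemma tm_bind_Var: "tm_bind Var t = t"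
  by (induction t) (auto intro: map_idI)

lemma tm_fv_bind: "tm_fv (tm_bind \<sigma> t) = (\<Union>x\<in>tm_fv t. tm_fv (\<sigma> x))"
  by (induction t) auto

lemma finite_tm_fv: "finite (tm_fv t)"
  by (induction t) auto

lemma finite_fv: "finite (fv \<phi>)"
  by (induction \<phi>) (auto simp: finite_tm_fv)

lemma subst_cong: "(\<And>x. x \<in> fv \<phi> \<Longrightarrow> \<sigma> x = \<tau> x) \<Longrightarrow> subst \<sigma> \<phi> = subst \<tau> \<phi>"
proof (induction \<phi> arbitrary: \<sigma> \<tau>)
  case (Ex y \<phi>)
  then have "subst (\<sigma>(y := Var y)) \<phi> = subst (\<tau>(y := Var y)) \<phi>" by (intro Ex.IH) auto
  then show ?case by simp
next
  case (And \<phi> \<psi>)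
  have "subst \<sigma> \<phi> = subst \<tau> \<phi>" by (rule And.IH(1)) (simp add: And.prems)
  moreover have "subst \<sigma> \<psi> = subst \<tau> \<psi>" by (rule And.IH(2)) (simp add: And.prems)
  ultimately show ?case by simp
next
  case (Eq s t)
  have "tm_bind \<sigma> s = tm_bind \<tau> s" "tm_bind \<sigma> t = tm_bind \<tau> t" using Eq by (auto intro!: tm_bind_cong)
  then show ?case by (simp add: tm_subst_eq_bind)
next
  case (Rel r ts)
  have "tm_subst \<sigma> t = tm_subst \<tau> t" if "t \<in> set ts" for t
    unfolding tm_subst_eq_bind using Rel that by (intro tm_bind_cong) auto
  then show ?case by simp
qed simp

lemma free_for_cong: "(\<And>x. x \<in> fv \<phi> \<Longrightarrow> \<sigma> x = \<tau> x) \<Longrightarrow> free_for \<sigma> \<phi> \<longleftrightarrow> free_for \<tau> \<phi>"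
proof (induction \<phi> arbitrary: \<sigma> \<tau>)
  case (Ex y \<phi>)
  then have "free_for (\<sigma>(y := Var y)) \<phi> \<longleftrightarrow> free_for (\<tau>(y := Var y)) \<phi>" by (intro Ex.IH) auto
  then show ?case using Ex.prems by simp
next
  case (And \<phi> \<psi>)
  have "free_for \<sigma> \<phi> \<longleftrightarrow> free_for \<tau> \<phi>" by (rule And.IH(1)) (simp add: And.prems)
  moreover have "free_for \<sigma> \<psi> \<longleftrightarrow> free_for \<tau> \<psi>" by (rule And.IH(2)) (simp add: And.prems)
  ultimately show ?case by simp
qed simp_all

lemma subst_Var: "subst Var \<phi> = \<phi>"
proof (induction \<phi>)
  case (Rel r ts)
  then show ?case by (auto simp: tm_subst_eq_bind tm_bind_Var intro: map_idI)
next
  case (Ex y \<phi>)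
  have "Var(y := Var y) = Var" by auto
  with Ex show ?case by simp
qed (auto simp: tm_subst_eq_bind tm_bind_Var)

lemma free_for_Var: "free_for Var \<phi>"
proof (induction \<phi>)
  case (Ex y \<phi>)
  have "Var(y := Var y) = Var" by auto
  with Ex show ?case by auto
qed auto

lemma subst_subst:
  "free_for \<sigma> \<phi> \<Longrightarrow> subst \<tau> (subst \<sigma> \<phi>) = subst (\<lambda>x. tm_bind \<tau> (\<sigma> x)) \<phi>"
proof (induction \<phi> arbitrary: \<sigma> \<tau>)
  case (Ex y \<phi>)
  have "subst (\<tau>(y := Var y)) (subst (\<sigma>(y := Var y)) \<phi>) =
      subst (\<lambda>x. tm_bind (\<tau>(y := Var y)) ((\<sigma>(y := Var y)) x)) \<phi>"
    by (rule Ex.IH) (use Ex.prems in \<open>simp del: fun_upd_apply\<close>)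
  \<comment> \<open>Binding by \<open>\<tau>\<close> commutes with resetting \<open>y\<close>,
    because \<open>free_for\<close> keeps \<open>y\<close> out of \<open>\<sigma> x\<close> for
    every other free variable \<open>x\<close>.\<close>
  also have "\<dots> = subst ((\<lambda>x. tm_bind \<tau> (\<sigma> x))(y := Var y)) \<phi>"
    by (rule subst_cong) (use Ex.prems in \<open>auto intro!: tm_bind_cong\<close>)
  finally show ?case by simp
qed (auto simp: tm_subst_eq_bind tm_bind_bind)

text \<open>A composite without capture has a second stage without capture. The description of free
  variables is proved jointly: the existential case uses it to trace a free variable of the
  substituted formula back to some \<open>\<sigma> x\<close>.\<close>

lemma free_for_subst:
  "free_for \<sigma> \<phi> \<Longrightarrow> free_for (\<lambda>x. tm_bind \<tau> (\<sigma> x)) \<phi> \<Longrightarrow> free_for \<tau> (subst \<sigma> \<phi>)"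
    and fv_subst: "free_for \<sigma> \<phi> \<Longrightarrow> fv (subst \<sigma> \<phi>) = (\<Union>x\<in>fv \<phi>. tm_fv (\<sigma> x))"
proof (induction \<phi> arbitrary: \<sigma> \<tau>)
  case (Ex y \<phi>)
  {
    case 2
    then have "fv (subst (\<sigma>(y := Var y)) \<phi>) = (\<Union>x\<in>fv \<phi>. tm_fv ((\<sigma>(y := Var y)) x))"
      by (intro Ex.IH(2)) (simp del: fun_upd_apply)
    moreover have "y \<notin> tm_fv (\<sigma> x)" if "x \<in> fv \<phi>" "x \<noteq> y" for x using 2 that by simp
    ultimately show ?case by (auto split: if_splits)
  }
  note fv = this
  {
    case 1
    have "y \<notin> tm_fv (\<tau> z)" if z: "z \<in> fv (subst \<sigma> (Ex y \<phi>))" for z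
    proof -
      from z obtain x where "x \<in> fv (Ex y \<phi>)" "z \<in> tm_fv (\<sigma> x)" using fv[OF 1(1)] by blast
      then show ?thesis using 1(2) by (auto simp: tm_fv_bind)
    qed
    moreover have "free_for (\<tau>(y := Var y)) (subst (\<sigma>(y := Var y)) \<phi>)"
    proof (rule Ex.IH(1))
      show "free_for (\<sigma>(y := Var y)) \<phi>" using 1 by simp
      have "free_for ((\<lambda>x. tm_bind \<tau> (\<sigma> x))(y := Var y)) \<phi>" using 1 by simp
      moreover have "((\<lambda>x. tm_bind \<tau> (\<sigma> x))(y := Var y)) x =
        tm_bind (\<tau>(y := Var y)) ((\<sigma>(y := Var y)) x)" if "x \<in> fv \<phi>" for x
        using that 1(1) by (auto intro!: tm_bind_cong)
      ultimately show "free_for (\<lambda>x. tm_bind (\<tau>(y := Var y)) ((\<sigma>(y := Var y)) x)) \<phi>"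
        by (subst free_for_cong[symmetric]) assumption+
    qed
    ultimately show ?case by simp
  }
qed (auto simp: tm_subst_eq_bind tm_fv_bind)

section \<open>Bound variables, capture and typing of substitutions\<close>

primrec bv :: "('f, 'r, 'v) fm \<Rightarrow> 'v set" where
  "bv Top = {}"
| "bv (Rel r ts) = {}"
| "bv (Eq s t) = {}"
| "bv (And \<phi> \<psi>) = bv \<phi> \<union> bv \<psi>"
| "bv (Ex x \<phi>) = insert x (bv \<phi>)"

lemma finite_bv: "finite (bv \<phi>)"
  by (induction \<phi>) auto

text \<open>The alternative \<open>\<sigma> x = Var x\<close> keeps the hypothesis inductive: under
  a quantifier the bound variable is mapped to itself, and it may be bound again further
  inside.\<close>

lemma free_for_bv:
  "(\<And>x. x \<in> fv \<phi> \<Longrightarrow> \<sigma> x = Var x \<or> tm_fv (\<sigma> x) \<inter> bv \<phi> = {}) \<Longrightarrow> free_for \<sigma> \<phi>"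
proof (induction \<phi> arbitrary: \<sigma>)
  case (Ex y \<phi>)
  have "y \<notin> tm_fv (\<sigma> x)" if "x \<in> fv (Ex y \<phi>)" for x
    using Ex.prems[OF that] that by auto
  moreover have "free_for (\<sigma>(y := Var y)) \<phi>"
  proof (rule Ex.IH)
    fix x assume "x \<in> fv \<phi>"
    then show "(\<sigma>(y := Var y)) x = Var x \<or> tm_fv ((\<sigma>(y := Var y)) x) \<inter> bv \<phi> = {}"
      using Ex.prems[of x] by (cases "x = y") auto
  qed
  ultimately show ?case by simp
next
  case (And \<phi> \<psi>)
  have "free_for \<sigma> \<phi>" "free_for \<sigma> \<psi>"
    using And.prems by (intro And.IH; fastforce)+
  then show ?case by simp
qed simp_all

text \<open>Two signatures occur because binding may replace variables by terms over names, or names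
  by variables; only the function symbols with their sorts have to agree.\<close>

lemma tm_bind_typed:
  assumes "funs L' = funs L" "fdom L' = fdom L" "fcod L' = fcod L"
  shows "tm_wf L t \<Longrightarrow> (\<And>x. x \<in> tm_fv t \<Longrightarrow> tm_wf L' (\<sigma> x) \<and> tm_sort L' (\<sigma> x) = vsort L x) \<Longrightarrow>
    tm_wf L' (tm_bind \<sigma> t) \<and> tm_sort L' (tm_bind \<sigma> t) = tm_sort L t"
proof (induction t)
  case (Fun f ts)
  have "tm_wf L' (tm_bind \<sigma> t) \<and> tm_sort L' (tm_bind \<sigma> t) = tm_sort L t" if "t \<in> set ts" for t
    using Fun.IH[OF that] Fun.prems that by auto
  then show ?case using Fun.prems(1) assms by (auto simp: comp_def cong: map_cong)
qed simp

lemma fm_wf_subst: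
  "fm_wf L \<phi> \<Longrightarrow> (\<And>x. x \<in> fv \<phi> \<Longrightarrow> tm_wf L (\<sigma> x) \<and> tm_sort L (\<sigma> x) = vsort L x) \<Longrightarrow> fm_wf L (subst \<sigma> \<phi>)"
proof (induction \<phi> arbitrary: \<sigma>)
  case (Rel r ts)
  have "tm_wf L (tm_bind \<sigma> t) \<and> tm_sort L (tm_bind \<sigma> t) = tm_sort L t" if "t \<in> set ts" for t
    using tm_bind_typed[of L L t \<sigma>] Rel that by auto
  then show ?case using Rel.prems(1) by (auto simp: tm_subst_eq_bind comp_def cong: map_cong)
next
  case (Eq s t)
  then show ?case using tm_bind_typed[of L L s \<sigma>] tm_bind_typed[of L L t \<sigma>] by (auto simp: tm_subst_eq_bind)
next
  case (Ex y \<phi>)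
  have "fm_wf L (subst (\<sigma>(y := Var y)) \<phi>)" by (rule Ex.IH) (use Ex.prems in auto)
  then show ?case using Ex.prems by simp
qed auto

lemma tm_wf_vars: "tm_wf L t \<Longrightarrow> tm_fv t \<subseteq> vars L"
  by (induction t) auto

lemma fm_wf_vars: "fm_wf L \<phi> \<Longrightarrow> fv \<phi> \<subseteq> vars L"
  using tm_wf_vars by (induction \<phi>) fastforce+

lemma ctx_fv: "fm_wf L \<phi> \<Longrightarrow> is_ctx L (fv \<phi>)"
  using fm_wf_vars finite_fv by (auto simp: is_ctx_def)

section \<open>Sequents over names\<close>

text \<open>
  The elements of a Henkin model are terms over a type of names, which may have to be larger
  than the set of variables. A fact \<open>(\<psi>, b)\<close> stands for the formula \<open>\<psi>\<close> with its free variables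
  replaced by such terms. Finitely many facts mention finitely many names, so they become
  formulas of the language by an injective renaming of these names into the variables.
\<close>

type_synonym ('f, 'r, 'v, 'w) fact = "('f, 'r, 'v) fm \<times> ('v \<Rightarrow> ('f, 'w) tm)"

text \<open>Names act as the variables of an auxiliary signature, so that \<open>tm_wf\<close> and
  \<open>tm_sort\<close> apply to terms over names.\<close>

definition name_sig :: "('s, 'f, 'r, 'v) signature \<Rightarrow> ('w \<Rightarrow> 's) \<Rightarrow> 'w set \<Rightarrow> ('s, 'f, 'r, 'w) signature" where
  "name_sig L ns W = \<lparr>sorts = sorts L, vars = W, vsort = ns, funs = funs L, fdom = fdom L,
     fcod = fcod L, rels = rels L, rdom = rdom L, has_eq = has_eq L\<rparr>"

definition inst_env :: "('w \<Rightarrow> 'v) \<Rightarrow> ('v \<Rightarrow> ('f, 'w) tm) \<Rightarrow> 'v \<Rightarrow> ('f, 'v) tm" where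
  "inst_env \<rho> b = (\<lambda>y. tm_bind (\<lambda>w. Var (\<rho> w)) (b y))"

definition inst :: "('w \<Rightarrow> 'v) \<Rightarrow> ('f, 'r, 'v, 'w) fact \<Rightarrow> ('f, 'r, 'v) fm" where
  "inst \<rho> F = subst (inst_env \<rho> (snd F)) (fst F)"

locale named_theory = regular_theory L E
  for L :: "('s, 'f, 'r, 'v) signature" and E +
  fixes nsort :: "'w \<Rightarrow> 's"
begin

definition typed :: "'w set \<Rightarrow> ('f, 'w) tm \<Rightarrow> 's \<Rightarrow> bool" where
  "typed W t s \<longleftrightarrow> tm_wf (name_sig L nsort W) t \<and> tm_sort (name_sig L nsort W) t = s"

lemma typed_Var: "typed W (Var w) s \<longleftrightarrow> w \<in> W \<and> nsort w = s"
  by (simp add: typed_def name_sig_def)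

lemma typed_Fun: "typed W (Fun f us) s \<longleftrightarrow> f \<in> funs L \<and> fcod L f = s \<and> list_all2 (typed W) us (fdom L f)"
proof -
  have "(\<forall>u\<in>set us. P u) \<and> map g us = ss \<longleftrightarrow> list_all2 (\<lambda>u s. P u \<and> g u = s) us ss"
    for P and g :: "('f, 'w) tm \<Rightarrow> 's" and ss
    by (induction us arbitrary: ss) (auto simp: list_all2_Cons1)
  from this[symmetric, of "tm_wf (name_sig L nsort W)" "tm_sort (name_sig L nsort W)" "fdom L f"]
  show ?thesis unfolding typed_def by (auto simp: name_sig_def)
qed

lemma typed_fv: "typed W t s \<Longrightarrow> tm_fv t \<subseteq> W"
  unfolding typed_def
proof (induction t arbitrary: s)
  case (Fun f ts)
  then have "\<And>t. t \<in> set ts \<Longrightarrow> tm_fv t \<subseteq> W" by (auto simp: name_sig_def)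
  then show ?case by auto
qed (simp add: name_sig_def)

lemma typed_support: "typed W t s \<Longrightarrow> tm_fv t \<subseteq> V \<Longrightarrow> typed V t s"
  unfolding typed_def
proof (induction t arbitrary: s)
  case (Fun f ts)
  then have "\<And>t. t \<in> set ts \<Longrightarrow> tm_wf (name_sig L nsort V) t \<and>
    tm_sort (name_sig L nsort V) t = tm_sort (name_sig L nsort W) t" by (auto simp: name_sig_def)
  then show ?case using Fun.prems by (auto simp: name_sig_def cong: map_cong)
qed (auto simp: name_sig_def)

lemma typed_mono: "typed W t s \<Longrightarrow> W \<subseteq> W' \<Longrightarrow> typed W' t s"
  using typed_support typed_fv by blast

lemma typed_bind:
  assumes "tm_wf L t" "\<And>x. x \<in> tm_fv t \<Longrightarrow> typed W (b x) (vsort L x)"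
  shows "typed W (tm_bind b t) (tm_sort L t)"
  using tm_bind_typed[of "name_sig L nsort W" L t b] assms by (simp add: typed_def name_sig_def)

definition fact_ok :: "'w set \<Rightarrow> ('f, 'r, 'v, 'w) fact \<Rightarrow> bool" where
  "fact_ok W F \<longleftrightarrow> fm_wf L (fst F) \<and> (\<forall>x\<in>fv (fst F). typed W (snd F x) (vsort L x))"

definition name_ctx :: "'w set \<Rightarrow> bool" where
  "name_ctx W \<longleftrightarrow> finite W \<and> nsort ` W \<subseteq> sorts L"

definition renaming :: "('w \<Rightarrow> 'v) \<Rightarrow> 'w set \<Rightarrow> bool" where
  "renaming \<rho> W \<longleftrightarrow> inj_on \<rho> W \<and> (\<forall>w\<in>W. \<rho> w \<in> vars L \<and> vsort L (\<rho> w) = nsort w)"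

text \<open>Freeness has to be demanded because \<open>inst\<close> renames no bound variables: a
  renaming that sends a name to a bound variable of a fact could distort the fact.\<close>

definition admissible :: "('w \<Rightarrow> 'v) \<Rightarrow> 'w set \<Rightarrow> ('f, 'r, 'v, 'w) fact set \<Rightarrow> bool" where
  "admissible \<rho> W H \<longleftrightarrow> renaming \<rho> W \<and>
     (\<forall>F\<in>H. fact_ok W F \<and> free_for (inst_env \<rho> (snd F)) (fst F))"

text \<open>Only one admissible renaming is asked for; by \<open>seq_rename\<close> every other one
  then works as well. \<open>W\<close> plays the context and may contain names that occur in no
  fact, since contexts matter when sorts are empty.\<close>

definition seq :: "'w set \<Rightarrow> ('f, 'r, 'v, 'w) fact set \<Rightarrow> ('f, 'r, 'v, 'w) fact \<Rightarrow> bool" where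
  "seq W G F \<longleftrightarrow> name_ctx W \<and> finite G \<and>
     (\<exists>\<rho>. admissible \<rho> W (insert F G) \<and> E (\<rho> ` W) (inst \<rho> ` G) (inst \<rho> F))"

lemma fact_ok_mono: "fact_ok W F \<Longrightarrow> W \<subseteq> W' \<Longrightarrow> fact_ok W' F"
  using typed_mono by (auto simp: fact_ok_def)

lemma admissible_mono: "admissible \<rho> W H \<Longrightarrow> H' \<subseteq> H \<Longrightarrow> admissible \<rho> W H'"
  by (auto simp: admissible_def)

lemma rename_ctx: "name_ctx W \<Longrightarrow> renaming \<rho> W \<Longrightarrow> is_ctx L (\<rho> ` W)"
  by (auto simp: name_ctx_def renaming_def is_ctx_def)

lemma inst_env_typed:
  assumes "renaming \<rho> W" "typed W (b x) s"
  shows "tm_wf L (inst_env \<rho> b x) \<and> tm_sort L (inst_env \<rho> b x) = s \<and> tm_fv (inst_env \<rho> b x) \<subseteq> \<rho> ` W"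
proof -
  have "tm_wf L (tm_bind (\<lambda>w. Var (\<rho> w)) (b x)) \<and>
    tm_sort L (tm_bind (\<lambda>w. Var (\<rho> w)) (b x)) = tm_sort (name_sig L nsort W) (b x)"
    by (rule tm_bind_typed)
      (use assms typed_fv in \<open>auto simp: typed_def name_sig_def renaming_def subset_iff\<close>)
  then show ?thesis
    using assms(2) typed_fv[OF assms(2)] by (auto simp: inst_env_def typed_def tm_fv_bind)
qed

lemma inst_in_fms:
  assumes "admissible \<rho> W H" "F \<in> H"
  shows "inst \<rho> F \<in> fms L (\<rho> ` W)"
proof -
  have ok: "renaming \<rho> W" "fm_wf L (fst F)" "\<And>x. x \<in> fv (fst F) \<Longrightarrow> typed W (snd F x) (vsort L x)"
    "free_for (inst_env \<rho> (snd F)) (fst F)"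
    using assms by (auto simp: admissible_def fact_ok_def)
  show ?thesis
    using fm_wf_subst[OF ok(2), of "inst_env \<rho> (snd F)"] fv_subst[OF ok(4)] inst_env_typed[OF ok(1,3)]
    by (fastforce simp: fms_def inst_def)
qed

lemma inst_subset: "admissible \<rho> W H \<Longrightarrow> inst \<rho> ` H \<subseteq> fms L (\<rho> ` W)"
  using inst_in_fms by blast

lemma fresh_var:
  assumes "s \<in> sorts L" "finite B"
  obtains x where "x \<in> vars L" "vsort L x = s" "x \<notin> B"
proof -
  have "infinite ({x \<in> vars L. vsort L x = s} - B)" using infinite_vars assms by simp
  then have "{x \<in> vars L. vsort L x = s} - B \<noteq> {}" by (metis finite.emptyI)
  then show ?thesis using that by blast
qed

lemma renaming_exists:
  assumes "finite W" "nsort ` W \<subseteq> sorts L" "finite B"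
  shows "\<exists>\<rho>. renaming \<rho> W \<and> \<rho> ` W \<inter> B = {}"
  using assms(1,2)
proof (induction W)
  case empty
  then show ?case by (simp add: renaming_def)
next
  case (insert w W)
  then obtain \<rho> where \<rho>: "renaming \<rho> W" "\<rho> ` W \<inter> B = {}" by auto
  obtain x where x: "x \<in> vars L" "vsort L x = nsort w" "x \<notin> B \<union> \<rho> ` W"
    using fresh_var[of "nsort w" "B \<union> \<rho> ` W"] insert assms(3) by auto
  have "(\<rho>(w := x)) ` W = \<rho> ` W" using insert(2) by (auto simp: image_def)
  then have "renaming (\<rho>(w := x)) (insert w W) \<and> (\<rho>(w := x)) ` insert w W \<inter> B = {}"
    using \<rho> x insert(2) by (auto simp: renaming_def inj_on_def)
  then show ?case by blast
qed

text \<open>Each sort has infinitely many variables, so finitely many names can be sent away from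
  all bound variables of \<open>H\<close> and from the reserved set \<open>B\<close>.\<close>

lemma admissible_exists:
  assumes "name_ctx W" "finite H" "\<And>F. F \<in> H \<Longrightarrow> fact_ok W F" "finite B"
  obtains \<rho> where "admissible \<rho> W H" "\<rho> ` W \<inter> B = {}"
proof -
  have "finite (B \<union> (\<Union>F\<in>H. bv (fst F)))" using assms finite_bv by auto
  then obtain \<rho> where \<rho>: "renaming \<rho> W" "\<rho> ` W \<inter> (B \<union> (\<Union>F\<in>H. bv (fst F))) = {}"
    using renaming_exists assms(1) unfolding name_ctx_def by metis
  have "free_for (inst_env \<rho> (snd F)) (fst F)" if F: "F \<in> H" for F
  proof (rule free_for_bv)
    fix x assume "x \<in> fv (fst F)"
    then have "tm_fv (inst_env \<rho> (snd F) x) \<subseteq> \<rho> ` W"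
      using inst_env_typed[OF \<rho>(1), of "snd F" x] assms(3)[OF F] by (auto simp: fact_ok_def)
    then show "inst_env \<rho> (snd F) x = Var x \<or> tm_fv (inst_env \<rho> (snd F) x) \<inter> bv (fst F) = {}"
      using \<rho>(2) F by blast
  qed
  then show ?thesis using that[of \<rho>] \<rho> assms(3) by (auto simp: admissible_def)
qed

lemma inst_rename:
  assumes \<rho>: "admissible \<rho> W H" and \<rho>': "admissible \<rho>' W' H" and F: "F \<in> H"
    and \<sigma>: "\<And>w. w \<in> W \<Longrightarrow> \<sigma> (\<rho> w) = Var (\<rho>' w)"
  shows "subst \<sigma> (inst \<rho> F) = inst \<rho>' F" and "free_for \<sigma> (inst \<rho> F)"
proof -
  have ff: "free_for (inst_env \<rho> (snd F)) (fst F)" "free_for (inst_env \<rho>' (snd F)) (fst F)"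
    and ty: "\<And>x. x \<in> fv (fst F) \<Longrightarrow> typed W (snd F x) (vsort L x)"
    using \<rho> \<rho>' F by (auto simp: admissible_def fact_ok_def)
  have eq: "tm_bind \<sigma> (inst_env \<rho> (snd F) x) = inst_env \<rho>' (snd F) x" if "x \<in> fv (fst F)" for x
    unfolding inst_env_def tm_bind_bind
    by (rule tm_bind_cong) (use typed_fv[OF ty[OF that]] \<sigma> in auto)
  show "subst \<sigma> (inst \<rho> F) = inst \<rho>' F"
    unfolding inst_def subst_subst[OF ff(1)] using eq by (rule subst_cong)
  have "free_for (\<lambda>x. tm_bind \<sigma> (inst_env \<rho> (snd F) x)) (fst F)"
    using ff(2) free_for_cong[OF eq, of "fst F"] by simp
  then show "free_for \<sigma> (inst \<rho> F)"
    unfolding inst_def by (rule free_for_subst[OF ff(1)])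
qed

lemma seq_rename:
  assumes seq: "seq W G F" and W: "W \<subseteq> W'" "name_ctx W'" and \<rho>: "admissible \<rho> W' (insert F G)"
  shows "E (\<rho> ` W') (inst \<rho> ` G) (inst \<rho> F)"
proof -
  obtain \<rho>0 where \<rho>0: "admissible \<rho>0 W (insert F G)" and E0: "E (\<rho>0 ` W) (inst \<rho>0 ` G) (inst \<rho>0 F)"
    using seq by (auto simp: seq_def)
  \<comment> \<open>\<open>\<sigma>\<close> undoes \<open>\<rho>0\<close> and applies
    \<open>\<rho>\<close>; the rule \<open>substitution\<close> enlarges the context to that of
    \<open>W'\<close> at the same time.\<close>
  define \<sigma> :: "'v \<Rightarrow> ('f, 'v) tm" where "\<sigma> = (\<lambda>x. Var (\<rho> (inv_into W \<rho>0 x)))"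
  have r: "renaming \<rho>0 W" "renaming \<rho> W'" using \<rho>0 \<rho> by (auto simp: admissible_def)
  have \<sigma>: "\<sigma> (\<rho>0 w) = Var (\<rho> w)" if "w \<in> W" for w
    using r(1) that by (simp add: \<sigma>_def renaming_def inv_into_f_f)
  note ir = inst_rename[OF \<rho>0 \<rho> _ \<sigma>]
  have "E (\<rho> ` W') (subst \<sigma> ` inst \<rho>0 ` G) (subst \<sigma> (inst \<rho>0 F))"
  proof (rule substitution[OF E0 rename_ctx[OF W(2) r(2)]])
    fix x assume "x \<in> \<rho>0 ` W"
    then show "tm_wf L (\<sigma> x) \<and> tm_sort L (\<sigma> x) = vsort L x \<and> tm_fv (\<sigma> x) \<subseteq> \<rho> ` W'"
      using \<sigma> r W(1) by (auto simp: renaming_def subset_iff)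
  next
    fix \<psi> assume "\<psi> \<in> insert (inst \<rho>0 F) (inst \<rho>0 ` G)"
    then show "free_for \<sigma> \<psi>" using ir(2) by blast
  qed
  moreover have "subst \<sigma> ` inst \<rho>0 ` G = inst \<rho> ` G"
    unfolding image_image using ir(1) by (intro image_cong) auto
  ultimately show ?thesis using ir(1)[of F] by simp
qed

section \<open>Rules for sequents over names\<close>

lemma seq_ok: "seq W G F \<Longrightarrow> H \<in> insert F G \<Longrightarrow> fact_ok W H"
  by (auto simp: seq_def admissible_def)

lemma seqI:
  assumes W: "name_ctx W" and G: "finite G" and ok: "\<And>H. H \<in> insert F G \<Longrightarrow> fact_ok W H" and B: "finite B"
    and E: "\<And>\<rho>. admissible \<rho> W (insert F G) \<Longrightarrow> \<rho> ` W \<inter> B = {} \<Longrightarrow> E (\<rho> ` W) (inst \<rho> ` G) (inst \<rho> F)"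
  shows "seq W G F"
proof -
  obtain \<rho> where "admissible \<rho> W (insert F G)" "\<rho> ` W \<inter> B = {}"
    using admissible_exists[of W "insert F G" B] W G ok B by auto
  then show ?thesis using E W G unfolding seq_def by blast
qed

lemma seq_weaken:
  assumes seq: "seq W G F" and W: "W \<subseteq> W'" "name_ctx W'" and G: "G \<subseteq> G'" "finite G'"
    and ok: "\<And>H. H \<in> G' \<Longrightarrow> fact_ok W' H"
  shows "seq W' G' F"
proof (rule seqI[where B = "{}"])
  fix \<rho> assume \<rho>: "admissible \<rho> W' (insert F G')"
  have "E (\<rho> ` W') (inst \<rho> ` G) (inst \<rho> F)"
    by (rule seq_rename[OF seq W]) (rule admissible_mono[OF \<rho>], use G in auto)
  then show "E (\<rho> ` W') (inst \<rho> ` G') (inst \<rho> F)"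
    by (rule weakening) (use G inst_subset[OF \<rho>] in auto)
qed (use W G ok fact_ok_mono[OF seq_ok[OF seq]] in auto)

text \<open>Both derivations are moved to one renaming, chosen to be admissible for the cut fact as
  well.\<close>

lemma seq_cut:
  assumes F: "seq W G F" and F': "seq W' (insert F G') F'"
  shows "seq (W \<union> W') (G \<union> G') F'"
proof -
  have fin: "finite G" "finite G'" and W: "name_ctx (W \<union> W')"
    using F F' by (auto simp: seq_def name_ctx_def)
  have ok: "fact_ok (W \<union> W') H" if "H \<in> insert F' (insert F (G \<union> G'))" for H
    using that fact_ok_mono[OF seq_ok[OF F], of H "W \<union> W'"] fact_ok_mono[OF seq_ok[OF F'], of H "W \<union> W'"] by auto
  obtain \<rho> where \<rho>: "admissible \<rho> (W \<union> W') (insert F' (insert F (G \<union> G')))"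
    using admissible_exists[OF W _ ok, of "insert F' (insert F (G \<union> G'))" "{}"] fin by auto
  have "E (\<rho> ` (W \<union> W')) (inst \<rho> ` G) (inst \<rho> F)"
    by (rule seq_rename[OF F _ W]) (blast, rule admissible_mono[OF \<rho>], blast)
  moreover have "E (\<rho> ` (W \<union> W')) (inst \<rho> ` insert F G') (inst \<rho> F')"
    by (rule seq_rename[OF F' _ W]) (blast, rule admissible_mono[OF \<rho>], blast)
  ultimately have "E (\<rho> ` (W \<union> W')) (inst \<rho> ` (G \<union> G')) (inst \<rho> F')"
    unfolding image_insert image_Un by (rule cut)
  moreover have "admissible \<rho> (W \<union> W') (insert F' (G \<union> G'))"
    by (rule admissible_mono[OF \<rho>]) blast
  ultimately show ?thesis using W fin by (auto simp: seq_def)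
qed

lemma seq_entailment:
  assumes E: "E U \<Gamma> \<psi>" and fin: "finite \<Gamma>" and W: "name_ctx W"
    and b: "\<And>x. x \<in> U \<Longrightarrow> typed W (b x) (vsort L x)"
  shows "seq W ((\<lambda>\<chi>. (\<chi>, b)) ` \<Gamma>) (\<psi>, b)"
proof (rule seqI[OF W, where B = "{}"])
  have U: "is_ctx L U" "\<Gamma> \<subseteq> fms L U" "\<psi> \<in> fms L U" using in_context[OF E] by auto
  show "fact_ok W H" if "H \<in> insert (\<psi>, b) ((\<lambda>\<chi>. (\<chi>, b)) ` \<Gamma>)" for H
    using that U b by (fastforce simp: fact_ok_def fms_def)
  fix \<rho> assume \<rho>: "admissible \<rho> W (insert (\<psi>, b) ((\<lambda>\<chi>. (\<chi>, b)) ` \<Gamma>))"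
  then have r: "renaming \<rho> W" and ff: "\<And>\<chi>. \<chi> \<in> insert \<psi> \<Gamma> \<Longrightarrow> free_for (inst_env \<rho> b) \<chi>"
    by (auto simp: admissible_def)
  have "E (\<rho> ` W) (subst (inst_env \<rho> b) ` \<Gamma>) (subst (inst_env \<rho> b) \<psi>)"
    by (rule substitution[OF E rename_ctx[OF W r] inst_env_typed[OF r b] ff])
  then show "E (\<rho> ` W) (inst \<rho> ` (\<lambda>\<chi>. (\<chi>, b)) ` \<Gamma>) (inst \<rho> (\<psi>, b))"
    by (simp add: inst_def image_image)
qed (use fin in auto)

text \<open>An instance does not determine how it splits into a formula and an environment. This
  rule moves between splittings, for example from a term to a variable that has this term as its
  value.\<close>

lemma seq_same_inst:
  assumes "\<And>\<rho>. inst \<rho> F = inst \<rho> F'" "fact_ok W F" "fact_ok W F'" "name_ctx W"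
  shows "seq W {F} F'"
proof (rule seqI[OF assms(4), where B = "{}"])
  fix \<rho> assume \<rho>: "admissible \<rho> W (insert F' {F})"
  show "E (\<rho> ` W) (inst \<rho> ` {F}) (inst \<rho> F')"
    by (rule identity) (use \<rho> assms rename_ctx inst_subset[OF \<rho>] in \<open>auto simp: admissible_def\<close>)
qed (use assms in auto)

text \<open>
  A new name \<open>w\<close> may be replaced by the bound variable \<open>x\<close> itself, because the other names are
  renamed away from \<open>x\<close>. Thus no renaming of bound variables is needed.
\<close>

lemma seq_exists:
  assumes seq: "seq (insert w W) (insert (\<phi>, b(x := Var w)) G) F"
    and w: "w \<notin> W" "nsort w = vsort L x" and x: "x \<in> vars L"
    and ok: "\<And>H. H \<in> insert F (insert (Ex x \<phi>, b) G) \<Longrightarrow> fact_ok W H"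
  shows "seq W (insert (Ex x \<phi>, b) G) F"
proof -
  let ?N = "(\<phi>, b(x := Var w))"
  have W': "name_ctx (insert w W)" and G: "finite G" using seq by (auto simp: seq_def)
  then have W: "name_ctx W" by (auto simp: name_ctx_def)
  have ok': "fact_ok (insert w W) H" if "H \<in> insert ?N (insert F (insert (Ex x \<phi>, b) G))" for H
    using that fact_ok_mono[OF ok, of H "insert w W"] seq_ok[OF seq, of ?N] by auto
  obtain \<rho> where \<rho>: "admissible \<rho> (insert w W) (insert ?N (insert F (insert (Ex x \<phi>, b) G)))"
    and \<rho>x: "\<rho> ` insert w W \<inter> {x} = {}"
    using admissible_exists[OF W' _ ok', of "insert ?N (insert F (insert (Ex x \<phi>, b) G))" "{x}"] G by auto
  have r: "renaming \<rho> (insert w W)" using \<rho> by (simp add: admissible_def)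
  then have \<rho>W: "admissible \<rho> W (insert F (insert (Ex x \<phi>, b) G))"
    using \<rho> ok by (auto simp: admissible_def renaming_def)
  let ?V = "\<rho> ` W" and ?z = "\<rho> w"
  have V: "is_ctx L ?V" using rename_ctx[OF W] \<rho>W by (simp add: admissible_def)
  have z: "?z \<notin> ?V" "?z \<noteq> x" "x \<notin> ?V" using r w(1) \<rho>x by (auto simp: renaming_def inj_on_def)
  have E1: "E (insert ?z ?V) (insert (inst \<rho> ?N) (inst \<rho> ` G)) (inst \<rho> F)"
    using seq_rename[OF seq subset_refl W'] admissible_mono[OF \<rho>, of "insert F (insert ?N G)"] by auto
  \<comment> \<open>\<open>?\<sigma>\<close> sends the variable of the new name to \<open>x\<close>.
    The side facts and the conclusion do not mention \<open>?z\<close> and stay fixed, while the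
    witness fact becomes literally the body \<open>\<phi>'\<close> of the instance of
    \<open>Ex x \<phi>\<close>, so that the rule \<open>ex\<close> applies.\<close>
  let ?\<sigma> = "Var(?z := Var x)"
  define \<phi>' where "\<phi>' = subst ((inst_env \<rho> b)(x := Var x)) \<phi>"
  have fmV: "\<And>H. H \<in> insert F (insert (Ex x \<phi>, b) G) \<Longrightarrow> inst \<rho> H \<in> fms L ?V"
    using inst_in_fms[OF \<rho>W] by blast
  have id: "subst ?\<sigma> (inst \<rho> H) = inst \<rho> H" "free_for ?\<sigma> (inst \<rho> H)" if "H \<in> insert F G" for H
  proof -
    have "?\<sigma> y = Var y" if "y \<in> fv (inst \<rho> H)" for y
      using fmV[of H] that \<open>H \<in> insert F G\<close> z by (auto simp: fms_def)
    then show "subst ?\<sigma> (inst \<rho> H) = inst \<rho> H" "free_for ?\<sigma> (inst \<rho> H)"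
      using subst_cong[of _ ?\<sigma> Var] subst_Var free_for_cong[of _ ?\<sigma> Var] free_for_Var by metis+
  qed
  have ffN: "free_for (inst_env \<rho> (b(x := Var w))) \<phi>" and ffE: "free_for ((inst_env \<rho> b)(x := Var x)) \<phi>"
    using \<rho> by (auto simp: admissible_def)
  have eq: "tm_bind ?\<sigma> (inst_env \<rho> (b(x := Var w)) y) = ((inst_env \<rho> b)(x := Var x)) y" if y: "y \<in> fv \<phi>" for y
  proof (cases "y = x")
    case True
    then show ?thesis by (simp add: inst_env_def)
  next
    case False
    then have "typed W (b y) (vsort L y)" using y ok[of "(Ex x \<phi>, b)"] by (auto simp: fact_ok_def)
    then have "tm_fv (inst_env \<rho> b y) \<subseteq> ?V" using inst_env_typed \<rho>W by (auto simp: admissible_def)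
    then have "tm_bind ?\<sigma> (inst_env \<rho> b y) = tm_bind Var (inst_env \<rho> b y)"
      using z by (intro tm_bind_cong) auto
    then show ?thesis using False by (simp add: inst_env_def tm_bind_Var)
  qed
  have sN: "subst ?\<sigma> (inst \<rho> ?N) = \<phi>'"
    unfolding inst_def \<phi>'_def fst_conv snd_conv subst_subst[OF ffN] by (rule subst_cong[OF eq])
  have fN: "free_for ?\<sigma> (inst \<rho> ?N)"
    unfolding inst_def fst_conv snd_conv
    by (rule free_for_subst[OF ffN], subst free_for_cong[OF eq]) (assumption, rule ffE)
  have xV: "is_ctx L (insert x ?V)" using V x by (auto simp: is_ctx_def)
  have "E (insert x ?V) (subst ?\<sigma> ` insert (inst \<rho> ?N) (inst \<rho> ` G)) (subst ?\<sigma> (inst \<rho> F))"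
  proof (rule substitution[OF E1 xV])
    fix y assume y: "y \<in> insert ?z ?V"
    have "vsort L ?z = vsort L x" using r w(2) by (auto simp: renaming_def)
    then show "tm_wf L (?\<sigma> y) \<and> tm_sort L (?\<sigma> y) = vsort L y \<and> tm_fv (?\<sigma> y) \<subseteq> insert x ?V"
      using y x V by (auto simp: is_ctx_def)
  next
    fix \<psi> assume "\<psi> \<in> insert (inst \<rho> F) (insert (inst \<rho> ?N) (inst \<rho> ` G))"
    then show "free_for ?\<sigma> \<psi>" using id(2) fN by blast
  qed
  moreover have "subst ?\<sigma> ` inst \<rho> ` G = inst \<rho> ` G"
    using id(1) by (simp add: image_image)
  ultimately have E2: "E (insert x ?V) (insert \<phi>' (inst \<rho> ` G)) (inst \<rho> F)"
    using sN id(1)[of F] by simp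
  have iE: "inst \<rho> (Ex x \<phi>, b) = Ex x \<phi>'" by (simp add: inst_def \<phi>'_def)
  have "\<phi>' \<in> fms L (insert x ?V)" using fmV[of "(Ex x \<phi>, b)"] iE by (auto simp: fms_def)
  then have "E ?V (insert (Ex x \<phi>') (inst \<rho> ` G)) (inst \<rho> F)"
    using ex[OF V x z(3), of \<phi>' "inst \<rho> ` G" "inst \<rho> F"] E2 fmV by blast
  then show ?thesis using \<rho>W W G iE by (auto simp: seq_def)
qed

lemma finite_support:
  assumes "finite H" "\<forall>F\<in>H. fact_ok W F"
  shows "\<exists>V\<subseteq>W. finite V \<and> (\<forall>F\<in>H. fact_ok V F)"
proof -
  let ?V = "\<Union>F\<in>H. \<Union>x\<in>fv (fst F). tm_fv (snd F x)"
  have "finite ?V" using assms(1) finite_fv finite_tm_fv by auto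
  moreover have "?V \<subseteq> W" using assms(2) typed_fv by (fastforce simp: fact_ok_def)
  moreover have "fact_ok ?V F" if F: "F \<in> H" for F
  proof -
    have "typed ?V (snd F x) (vsort L x)" if "x \<in> fv (fst F)" for x
      by (rule typed_support[of W]) (use assms(2) F that in \<open>auto simp: fact_ok_def\<close>)
    then show ?thesis using assms(2) F by (simp add: fact_ok_def)
  qed
  ultimately show ?thesis by blast
qed

end

section \<open>Henkin models\<close>

text \<open>\<open>gen\<close> provides generic names for variables, \<open>wit\<close> a witness
  for an existential fact. \<open>wit_inject\<close> compares environments on free variables only,
  because the names used later are formulas, which can record just finitely many terms.\<close>

locale henkin = named_theory L E nsort
  for L :: "('s, 'f, 'r, 'v) signature" and E and nsort :: "'w \<Rightarrow> 's" +
  fixes gen :: "'v \<Rightarrow> 'w"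
    and wit :: "'v \<Rightarrow> ('f, 'r, 'v) fm \<Rightarrow> ('v \<Rightarrow> ('f, 'w) tm) \<Rightarrow> 'w"
    and U0 :: "'v set" and \<Delta>0 :: "('f, 'r, 'v) fm set" and \<phi>0 :: "('f, 'r, 'v) fm"
  assumes inj_gen: "inj gen"
    and nsort_gen: "nsort (gen x) = vsort L x"
    and nsort_wit: "nsort (wit x \<phi> b) = vsort L x"
    and gen_neq_wit: "gen y \<noteq> wit x \<phi> b"
    and wit_inject: "wit x \<phi> b = wit x' \<phi>' b' \<Longrightarrow> x = x' \<and> \<phi> = \<phi>' \<and> (\<forall>y\<in>fv (Ex x \<phi>). b y = b' y)"
    and U0: "is_ctx L U0" and \<Delta>0: "\<Delta>0 \<subseteq> fms L U0" and \<phi>0: "\<phi>0 \<in> fms L U0"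
    and underivable: "\<not> E U0 \<Delta>0 \<phi>0"
begin

definition gen_env :: "'v \<Rightarrow> ('f, 'w) tm" where
  "gen_env x = Var (gen x)"

text \<open>A witness name enters only together with the fact that it witnesses. Thus no sort gets
  inhabited without reason, and a witness name found in \<open>W\<close> is already backed by a fact
  in \<open>G\<close>. Underivability ranges over subsets because \<open>seq\<close> takes finite
  sets.\<close>

definition state :: "'w set \<Rightarrow> ('f, 'r, 'v, 'w) fact set \<Rightarrow> bool" where
  "state W G \<longleftrightarrow> gen ` U0 \<subseteq> W \<and> (\<lambda>\<psi>. (\<psi>, gen_env)) ` \<Delta>0 \<subseteq> G \<and> nsort ` W \<subseteq> sorts L \<and>
     (\<forall>F\<in>G. fact_ok W F) \<and>
     (\<forall>w\<in>W. w \<in> gen ` U0 \<or> (\<exists>x \<phi> b. w = wit x \<phi> b \<and> (\<phi>, b(x := Var w)) \<in> G)) \<and>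
     (\<forall>W1\<subseteq>W. \<forall>G1\<subseteq>G. \<not> seq W1 G1 (\<phi>0, gen_env))"

lemma gen_ok:
  assumes "\<psi> \<in> fms L U0" "gen ` U0 \<subseteq> W"
  shows "fact_ok W (\<psi>, gen_env)"
  using assms by (auto simp: fact_ok_def fms_def gen_env_def typed_Var nsort_gen)

lemma initial_state: "state (gen ` U0) ((\<lambda>\<psi>. (\<psi>, gen_env)) ` \<Delta>0)"
proof -
  have W: "name_ctx (gen ` U0)"
    using U0 vsort_in by (auto simp: name_ctx_def is_ctx_def nsort_gen)
  have "\<not> seq W1 G1 (\<phi>0, gen_env)" if sub: "W1 \<subseteq> gen ` U0" "G1 \<subseteq> (\<lambda>\<psi>. (\<psi>, gen_env)) ` \<Delta>0" for W1 G1
  proof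
    assume seq: "seq W1 G1 (\<phi>0, gen_env)"
    \<comment> \<open>Sending the generic names back to their variables turns a fact over
      \<open>gen_env\<close> into the formula itself, so the sequent would contradict
      \<open>underivable\<close>.\<close>
    define \<rho> where "\<rho> = inv gen"
    have \<rho>: "\<rho> (gen x) = x" for x using inj_gen by (simp add: \<rho>_def)
    have env: "inst_env \<rho> gen_env = Var" by (simp add: inst_env_def gen_env_def \<rho> fun_eq_iff)
    have im: "\<rho> ` gen ` U0 = U0" by (simp add: image_image \<rho>)
    have ins: "inst \<rho> (\<psi>, gen_env) = \<psi>" for \<psi> by (simp add: inst_def env subst_Var)
    have "renaming \<rho> (gen ` U0)" using U0 \<rho> by (auto simp: renaming_def inj_on_def is_ctx_def nsort_gen)
    moreover have "fact_ok (gen ` U0) F \<and> free_for (inst_env \<rho> (snd F)) (fst F)"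
      if "F \<in> insert (\<phi>0, gen_env) G1" for F
    proof -
      from that sub(2) obtain \<psi> where \<psi>: "F = (\<psi>, gen_env)" "\<psi> \<in> insert \<phi>0 \<Delta>0" by blast
      then have "\<psi> \<in> fms L U0" using \<phi>0 \<Delta>0 by blast
      then show ?thesis using gen_ok[OF _ subset_refl] \<psi>(1) by (simp add: env free_for_Var)
    qed
    ultimately have "admissible \<rho> (gen ` U0) (insert (\<phi>0, gen_env) G1)"
      by (simp add: admissible_def)
    from seq_rename[OF seq sub(1) W this] have "E U0 (inst \<rho> ` G1) \<phi>0" by (simp only: im ins)
    moreover have "inst \<rho> ` G1 \<subseteq> \<Delta>0" using image_mono[OF sub(2), of "inst \<rho>"] by (simp add: image_image ins)
    ultimately show False using weakening \<Delta>0 underivable by blast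
  qed
  then show ?thesis
    using W \<Delta>0 gen_ok by (auto simp: state_def name_ctx_def)
qed

text \<open>Names and facts are packed into one subset of a sum type, so that Zorn's lemma for
  inclusion applies to the pair. A sequent involves finitely many names and facts, hence lives in
  one member of the chain.\<close>

lemma state_Union:
  assumes C: "C \<noteq> {}" "subset.chain {Z. state (Inl -` Z) (Inr -` Z)} C"
  shows "state (Inl -` \<Union>C) (Inr -` \<Union>C)"
proof -
  have st: "state (Inl -` Z) (Inr -` Z)" if "Z \<in> C" for Z
    using C(2) that by (auto simp: subset.chain_def)
  obtain Z0 where Z0: "Z0 \<in> C" using C(1) by blast
  have "fact_ok (Inl -` \<Union>C) F" if "F \<in> Inr -` \<Union>C" for F
  proof -
    from that obtain Z where Z: "Z \<in> C" "F \<in> Inr -` Z" by auto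
    then have "fact_ok (Inl -` Z) F" using st[OF Z(1)] by (simp add: state_def)
    then show ?thesis by (rule fact_ok_mono) (use Z(1) in auto)
  qed
  moreover have "\<not> seq W1 G1 (\<phi>0, gen_env)" if sub: "W1 \<subseteq> Inl -` \<Union>C" "G1 \<subseteq> Inr -` \<Union>C" for W1 G1
  proof
    assume seq: "seq W1 G1 (\<phi>0, gen_env)"
    then have "finite (Inl ` W1 \<union> Inr ` G1)" by (auto simp: seq_def name_ctx_def)
    moreover have "Inl ` W1 \<union> Inr ` G1 \<subseteq> \<Union>C" using sub by auto
    ultimately obtain Z where Z: "Z \<in> C" "Inl ` W1 \<union> Inr ` G1 \<subseteq> Z"
      by (rule finite_subset_Union_chain[OF _ _ C])
    then have "W1 \<subseteq> Inl -` Z" "G1 \<subseteq> Inr -` Z" by auto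
    then show False using st[OF Z(1)] seq by (simp add: state_def)
  qed
  moreover have "w \<in> gen ` U0 \<or> (\<exists>x \<phi> b. w = wit x \<phi> b \<and> (\<phi>, b(x := Var w)) \<in> Inr -` \<Union>C)"
    if "w \<in> Inl -` \<Union>C" for w
  proof -
    from that obtain Z where Z: "Z \<in> C" "w \<in> Inl -` Z" by auto
    then have "w \<in> gen ` U0 \<or> (\<exists>x \<phi> b. w = wit x \<phi> b \<and> (\<phi>, b(x := Var w)) \<in> Inr -` Z)"
      using st[OF Z(1)] unfolding state_def by blast
    then show ?thesis using Z(1) by blast
  qed
  moreover have "gen ` U0 \<subseteq> Inl -` Z0" "(\<lambda>\<psi>. (\<psi>, gen_env)) ` \<Delta>0 \<subseteq> Inr -` Z0"
    using st[OF Z0] unfolding state_def by simp_all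
  then have "gen ` U0 \<subseteq> Inl -` \<Union>C" "(\<lambda>\<psi>. (\<psi>, gen_env)) ` \<Delta>0 \<subseteq> Inr -` \<Union>C"
    using Z0 by (meson Union_upper order_trans vimage_mono)+
  moreover have "nsort ` (Inl -` \<Union>C) \<subseteq> sorts L"
    using st by (fastforce simp: state_def)
  ultimately show ?thesis by (simp add: state_def)
qed

lemma maximal_state:
  "\<exists>W G. state W G \<and>
    (\<forall>W' G'. state W' G' \<longrightarrow> W \<subseteq> W' \<longrightarrow> G \<subseteq> G' \<longrightarrow> W' = W \<and> G' = G)"
proof -
  let ?A = "{Z. state (Inl -` Z) (Inr -` Z)}"
  have pair: "Inl -` (Inl ` W \<union> Inr ` G) = W" "Inr -` (Inl ` W \<union> Inr ` G) = G" for W :: "'w set" and G :: "('f, 'r, 'v, 'w) fact set"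
    by auto
  have "Inl ` gen ` U0 \<union> Inr ` (\<lambda>\<psi>. (\<psi>, gen_env)) ` \<Delta>0 \<in> ?A"
    using initial_state by (simp only: pair mem_Collect_eq)
  then have "?A \<noteq> {}" by blast
  moreover have "\<Union>C \<in> ?A" if "C \<noteq> {}" "subset.chain ?A C" for C
    using state_Union[OF that] by simp
  ultimately obtain M where M: "M \<in> ?A" "\<forall>Z\<in>?A. M \<subseteq> Z \<longrightarrow> Z = M"
    using subset_Zorn_nonempty[of ?A] by blast
  have "W' = Inl -` M \<and> G' = Inr -` M"
    if st: "state W' G'" and sub: "Inl -` M \<subseteq> W'" "Inr -` M \<subseteq> G'" for W' G'
  proof -
    have "M \<subseteq> Inl ` W' \<union> Inr ` G'"
    proof
      fix z assume "z \<in> M" then show "z \<in> Inl ` W' \<union> Inr ` G'" using sub by (cases z) auto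
    qed
    moreover have "Inl ` W' \<union> Inr ` G' \<in> ?A" using st by (simp only: pair mem_Collect_eq)
    ultimately have "Inl ` W' \<union> Inr ` G' = M" using M(2) by blast
    then show ?thesis using pair by metis
  qed
  then show ?thesis using M(1) by blast
qed

end

locale henkin_complete = henkin L E nsort gen wit U0 \<Delta>0 \<phi>0
  for L :: "('s, 'f, 'r, 'v) signature" and E and nsort :: "'w \<Rightarrow> 's" and gen and wit
    and U0 \<Delta>0 \<phi>0 +
  fixes W :: "'w set" and G :: "('f, 'r, 'v, 'w) fact set"
  assumes state: "state W G"
    and maximal: "\<And>W' G'. state W' G' \<Longrightarrow> W \<subseteq> W' \<Longrightarrow> G \<subseteq> G' \<Longrightarrow> W' = W \<and> G' = G"
begin

lemma fact_ok_mem: "F \<in> G \<Longrightarrow> fact_ok W F"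
  using state by (simp add: state_def)

lemma consistent: "W1 \<subseteq> W \<Longrightarrow> G1 \<subseteq> G \<Longrightarrow> \<not> seq W1 G1 (\<phi>0, gen_env)"
  using state by (simp add: state_def)

lemma sub_name_ctx: "finite V \<Longrightarrow> V \<subseteq> W \<Longrightarrow> name_ctx V"
  using state image_mono[of V W nsort] unfolding state_def name_ctx_def by (meson order_trans)

text \<open>By cut, a derivation of \<open>\<phi>0\<close> that uses \<open>F\<close> would give one
  from \<open>G\<close> alone. So \<open>F\<close> can be added, and by maximality it is already
  there.\<close>

lemma seq_closed:
  assumes sub: "W1 \<subseteq> W" "G1 \<subseteq> G" and seq: "seq W1 G1 F"
  shows "F \<in> G"
proof -
  have okF: "fact_ok W F" using fact_ok_mono[OF seq_ok[OF seq] sub(1)] by simp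
  have "\<not> seq W2 G2 (\<phi>0, gen_env)" if sub2: "W2 \<subseteq> W" "G2 \<subseteq> insert F G" for W2 G2
  proof
    assume seq2: "seq W2 G2 (\<phi>0, gen_env)"
    show False
    proof (cases "F \<in> G2")
      case False
      then show ?thesis using consistent seq2 sub2 by blast
    next
      case True
      then have "seq W2 (insert F (G2 - {F})) (\<phi>0, gen_env)" using seq2 by (simp add: insert_absorb)
      from seq_cut[OF seq this] show False using consistent[of "W1 \<union> W2" "G1 \<union> (G2 - {F})"] sub sub2 by blast
    qed
  qed
  moreover have "\<forall>w\<in>W. w \<in> gen ` U0 \<or> (\<exists>x \<phi> b. w = wit x \<phi> b \<and> (\<phi>, b(x := Var w)) \<in> insert F G)"
    using state unfolding state_def by (meson insertI2)
  ultimately have "state W (insert F G)"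
    using state okF by (simp add: state_def subset_insertI2)
  then show ?thesis using maximal[of W "insert F G"] by blast
qed

lemma entailment_closed:
  assumes E: "E U \<Gamma> \<psi>" and b: "\<And>x. x \<in> U \<Longrightarrow> typed W (b x) (vsort L x)"
    and \<Gamma>: "\<And>\<chi>. \<chi> \<in> \<Gamma> \<Longrightarrow> (\<chi>, b) \<in> G"
  shows "(\<psi>, b) \<in> G"
proof -
  obtain \<Delta> where \<Delta>: "finite \<Delta>" "\<Delta> \<subseteq> \<Gamma>" "E U \<Delta> \<psi>" using finitary[OF E] by blast
  let ?V = "\<Union>x\<in>U. tm_fv (b x)"
  have "finite U" using in_context[OF E] by (simp add: is_ctx_def)
  then have V: "finite ?V" "?V \<subseteq> W" using finite_tm_fv typed_fv[OF b] by auto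
  have "typed ?V (b x) (vsort L x)" if "x \<in> U" for x
    by (rule typed_support[OF b[OF that]]) (use that in auto)
  then have "seq ?V ((\<lambda>\<chi>. (\<chi>, b)) ` \<Delta>) (\<psi>, b)"
    by (rule seq_entailment[OF \<Delta>(3,1) sub_name_ctx[OF V]])
  moreover have "(\<lambda>\<chi>. (\<chi>, b)) ` \<Delta> \<subseteq> G" using \<Gamma> \<Delta>(2) by auto
  ultimately show ?thesis using seq_closed[OF V(2)] by simp
qed

lemma same_inst:
  assumes "F \<in> G" "fact_ok W F'" "\<And>\<rho>. inst \<rho> F = inst \<rho> F'"
  shows "F' \<in> G"
proof -
  obtain V where V: "finite V" "V \<subseteq> W" "fact_ok V F" "fact_ok V F'"
    using finite_support[of "{F, F'}" W] fact_ok_mem[OF assms(1)] assms(2) by auto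
  have "seq V {F} F'"
    using seq_same_inst[OF assms(3) V(3,4) sub_name_ctx[OF V(1,2)]] .
  then show ?thesis using seq_closed[OF V(2)] assms(1) by blast
qed

lemma fact_cong:
  assumes "(\<psi>, b) \<in> G" "\<And>x. x \<in> fv \<psi> \<Longrightarrow> b x = c x"
  shows "(\<psi>, c) \<in> G"
proof (rule same_inst[OF assms(1)])
  show "fact_ok W (\<psi>, c)" using fact_ok_mem[OF assms(1)] assms(2) by (simp add: fact_ok_def)
  show "inst \<rho> (\<psi>, b) = inst \<rho> (\<psi>, c)" for \<rho>
    unfolding inst_def by (simp, rule subst_cong) (simp add: inst_env_def assms(2))
qed

text \<open>If the name \<open>wit x \<phi> b\<close> is new, \<open>seq_exists\<close> allows
  adding it with its fact, against maximality. If it is present, the invariant of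
  \<open>state\<close> supplies a fact for it, and injectivity of \<open>wit\<close> identifies this
  fact up to irrelevant values of the environment.\<close>

lemma witness:
  assumes "(Ex x \<phi>, b) \<in> G"
  shows "\<exists>t. typed W t (vsort L x) \<and> (\<phi>, b(x := t)) \<in> G"
proof -
  define w where "w = wit x \<phi> b"
  let ?N = "(\<phi>, b(x := Var w))"
  have okE: "fact_ok W (Ex x \<phi>, b)" using fact_ok_mem[OF assms] .
  then have x: "x \<in> vars L" by (simp add: fact_ok_def)
  have ws: "nsort w = vsort L x" by (simp add: w_def nsort_wit)
  have "w \<in> W"
  proof (rule ccontr)
    assume w: "w \<notin> W"
    have okN: "fact_ok V' ?N" if "fact_ok V (Ex x \<phi>, b)" "insert w V \<subseteq> V'" for V V'
      using that typed_mono[of V _ _ V'] ws by (auto simp: fact_ok_def typed_Var)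
    have "\<not> seq W2 G2 (\<phi>0, gen_env)" if sub2: "W2 \<subseteq> insert w W" "G2 \<subseteq> insert ?N G" for W2 G2
    proof
      assume seq: "seq W2 G2 (\<phi>0, gen_env)"
      then have fin: "finite W2" "finite G2" by (auto simp: seq_def name_ctx_def)
      \<comment> \<open>\<open>seq_exists\<close> needs a context without \<open>w\<close> in which
        the existential fact and all remaining facts are typed. \<open>W2\<close> need not contain
        the names of the existential fact, so a finite support of \<open>H\<close> is added to
        it.\<close>
      define H where "H = insert (\<phi>0, gen_env) (insert (Ex x \<phi>, b) (G2 - {?N}))"
      have "\<forall>F\<in>H. fact_ok W F"
        using sub2 fact_ok_mem okE gen_ok[OF \<phi>0] state by (auto simp: H_def state_def)
      moreover have "finite H" using fin by (simp add: H_def)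
      ultimately obtain V where V: "finite V" "V \<subseteq> W" "\<forall>F\<in>H. fact_ok V F"
        using finite_support by metis
      define V1 where "V1 = V \<union> (W2 - {w})"
      have V1: "finite V1" "V1 \<subseteq> W" using V fin sub2 by (auto simp: V1_def)
      have okV1: "fact_ok V1 F" if "F \<in> H" for F
        using fact_ok_mono[OF V(3)[rule_format, OF that]] by (simp add: V1_def)
      have nc: "name_ctx (insert w V1)"
        using sub_name_ctx[OF V1] ws vsort_in[OF x] by (simp add: name_ctx_def)
      have "fact_ok (insert w V1) F" if "F \<in> insert ?N (G2 - {?N})" for F
      proof (cases "F = ?N")
        case True
        then show ?thesis using okN[OF okV1 subset_refl] by (simp add: H_def)
      next
        case False
        then have "F \<in> H" using that by (simp add: H_def)
        then show ?thesis using fact_ok_mono[OF okV1] by blast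
      qed
      then have "seq (insert w V1) (insert ?N (G2 - {?N})) (\<phi>0, gen_env)"
        using seq_weaken[OF seq _ nc, of "insert ?N (G2 - {?N})"] fin by (auto simp: V1_def)
      then have "seq V1 (insert (Ex x \<phi>, b) (G2 - {?N})) (\<phi>0, gen_env)"
        by (rule seq_exists) (use w V1 ws x okV1 in \<open>auto simp: H_def\<close>)
      moreover have "insert (Ex x \<phi>, b) (G2 - {?N}) \<subseteq> G" using sub2(2) assms by auto
      ultimately show False using consistent[OF V1(2)] by simp
    qed
    moreover have "fact_ok (insert w W) F" if "F \<in> insert ?N G" for F
    proof (cases "F = ?N")
      case True
      then show ?thesis using okN[OF okE] by blast
    next
      case False
      then show ?thesis using that fact_ok_mono[OF fact_ok_mem] by blast
    qed
    moreover have "v \<in> gen ` U0 \<or> (\<exists>y \<psi> c. v = wit y \<psi> c \<and> (\<psi>, c(y := Var v)) \<in> insert ?N G)"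
      if v: "v \<in> insert w W" for v
    proof (cases "v = w")
      case True
      then show ?thesis using w_def by blast
    next
      case False
      then show ?thesis using v state unfolding state_def by blast
    qed
    moreover have "gen ` U0 \<subseteq> insert w W" "(\<lambda>\<psi>. (\<psi>, gen_env)) ` \<Delta>0 \<subseteq> insert ?N G"
      "nsort ` insert w W \<subseteq> sorts L"
      using state ws vsort_in[OF x] by (auto simp: state_def)
    ultimately have "state (insert w W) (insert ?N G)" by (simp add: state_def)
    then show False using maximal[of "insert w W" "insert ?N G"] w by blast
  qed
  moreover have "w \<notin> gen ` U0" using gen_neq_wit[THEN not_sym] by (auto simp: w_def)
  ultimately obtain x' \<phi>' b' where w': "w = wit x' \<phi>' b'" "(\<phi>', b'(x' := Var w)) \<in> G"
    using state unfolding state_def by blast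
  then have eq: "x' = x" "\<phi>' = \<phi>" "\<forall>y\<in>fv (Ex x \<phi>). b y = b' y"
    using wit_inject[of x \<phi> b x' \<phi>' b'] by (auto simp: w_def)
  have "(\<phi>, b(x := Var w)) \<in> G"
    by (rule fact_cong[of _ "b'(x := Var w)"]) (use w' eq in auto)
  then show ?thesis using \<open>w \<in> W\<close> ws typed_Var by blast
qed

text \<open>Provable equality of terms; without equality in the language, this is identity.\<close>

definition eqv :: "('f, 'w) tm \<Rightarrow> ('f, 'w) tm \<Rightarrow> bool" where
  "eqv t u \<longleftrightarrow> t = u \<or> (\<exists>x y b. (Eq (Var x) (Var y), b) \<in> G \<and> b x = t \<and> b y = u)"

section \<open>Provable equality is a congruence\<close>

lemma eq_fact_ok:
  assumes "(Eq (Var x) (Var y), b) \<in> G"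
  shows "has_eq L" "x \<in> vars L" "y \<in> vars L" "vsort L x = vsort L y"
    "typed W (b x) (vsort L y)" "typed W (b y) (vsort L y)"
  using fact_ok_mem[OF assms] by (auto simp: fact_ok_def)

lemma typed_unique: "typed V t s \<Longrightarrow> typed V t s' \<Longrightarrow> s = s'"
  by (simp add: typed_def)

lemma eqv_typed: "eqv t u \<Longrightarrow> typed W t s \<Longrightarrow> typed W u s"
  unfolding eqv_def using eq_fact_ok typed_unique by metis

lemma eq_reindex:
  assumes "(Eq s t, b) \<in> G" "fact_ok W (Eq s' t', c)"
    and "tm_bind b s = tm_bind c s'" "tm_bind b t = tm_bind c t'"
  shows "(Eq s' t', c) \<in> G"
proof (rule same_inst[OF assms(1,2)])
  show "inst \<rho> (Eq s t, b) = inst \<rho> (Eq s' t', c)" for \<rho>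
    using arg_cong[OF assms(3), of "tm_bind (\<lambda>w. Var (\<rho> w))"] arg_cong[OF assms(4), of "tm_bind (\<lambda>w. Var (\<rho> w))"]
    by (simp add: inst_def inst_env_def tm_subst_eq_bind tm_bind_bind)
qed

text \<open>Leibniz's law for facts. The rule \<open>eq_subst\<close> exchanges variables, so the
  new value \<open>u\<close> is first given to a fresh variable \<open>z\<close>; then
  \<open>y\<close> is replaced by \<open>z\<close> in \<open>\<psi>\<close>, and the result is
  re-read as \<open>\<psi>\<close> with value \<open>u\<close> at \<open>y\<close>. The assumption
  \<open>atomic\<close> excludes capture.\<close>

lemma replace_one:
  assumes fact: "(\<psi>, b) \<in> G" and atomic: "\<And>\<sigma>. free_for \<sigma> \<psi>" and y: "y \<in> fv \<psi>" and eqv: "eqv (b y) u"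
  shows "(\<psi>, b(y := u)) \<in> G"
proof (cases "b y = u")
  case True
  then have "b(y := u) = b" by auto
  then show ?thesis using fact by simp
next
  case False
  then obtain p q c where c: "(Eq (Var p) (Var q), c) \<in> G" "c p = b y" "c q = u"
    using eqv by (auto simp: eqv_def)
  have ty: "typed W (b x) (vsort L x)" if "x \<in> fv \<psi>" for x
    using fact_ok_mem[OF fact] that by (simp add: fact_ok_def)
  have wf: "fm_wf L \<psi>" using fact_ok_mem[OF fact] by (simp add: fact_ok_def)
  have yv: "y \<in> vars L" using fm_wf_vars[OF wf] y by blast
  obtain z where z: "z \<in> vars L" "vsort L z = vsort L y" "z \<notin> insert y (fv \<psi>)"
    using fresh_var[OF vsort_in[OF yv], of "insert y (fv \<psi>)"] finite_fv by auto
  have tyu: "typed W u (vsort L y)" using eqv_typed[OF eqv ty[OF y]] .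
  have "fact_ok W (Eq (Var y) (Var z), b(z := u))"
    unfolding fact_ok_def fst_conv snd_conv
  proof (intro HOL.conjI ballI)
    show "fm_wf L (Eq (Var y) (Var z))" using z yv eq_fact_ok(1)[OF c(1)] by simp
    fix x assume "x \<in> fv (Eq (Var y) (Var z) :: ('f, 'r, 'v) fm)"
    then consider "x = z" | "x = y" "x \<noteq> z" by auto
    then show "typed W ((b(z := u)) x) (vsort L x)"
    proof cases
      case 1
      then show ?thesis using tyu z(2) by simp
    next
      case 2
      then show ?thesis using ty[OF y] by simp
    qed
  qed
  from eq_reindex[OF c(1) this] have eq: "(Eq (Var y) (Var z), b(z := u)) \<in> G"
    using c(2,3) z(3) by (cases "y = z") simp_all
  have \<psi>: "(\<psi>, b(z := u)) \<in> G" by (rule fact_cong[OF fact]) (use z in auto)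
  let ?U = "insert z (fv \<psi>)" and ?\<sigma> = "Var(y := Var z)"
  have U: "is_ctx L ?U" using ctx_fv[OF wf] z(1) by (simp add: is_ctx_def)
  have "E ?U {Eq (Var y) (Var z), \<psi>} (subst ?\<sigma> \<psi>)"
    by (rule eq_subst) (use eq_fact_ok(1)[OF c(1)] U y z wf atomic in \<open>auto simp: fms_def\<close>)
  then have s: "(subst ?\<sigma> \<psi>, b(z := u)) \<in> G"
    by (rule entailment_closed) (use ty tyu z eq \<psi> in auto)
  show ?thesis
  proof (rule same_inst[OF s])
    have ty': "typed W ((b(y := u)) x) (vsort L x)" if "x \<in> fv \<psi>" for x
      using ty that tyu by simp
    then show "fact_ok W (\<psi>, b(y := u))" using wf by (simp add: fact_ok_def)
    fix \<rho>
    have "tm_bind (inst_env \<rho> (b(z := u))) (?\<sigma> x) = inst_env \<rho> (b(y := u)) x" if "x \<in> fv \<psi>" for x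
      using that z by (auto simp: inst_env_def)
    then show "inst \<rho> (subst ?\<sigma> \<psi>, b(z := u)) = inst \<rho> (\<psi>, b(y := u))"
      unfolding inst_def fst_conv snd_conv subst_subst[OF atomic] by (rule subst_cong)
  qed
qed

lemma replace_all:
  assumes fact: "(\<psi>, b) \<in> G" and atomic: "\<And>\<sigma>. free_for \<sigma> \<psi>"
    and eqv: "\<And>y. y \<in> fv \<psi> \<Longrightarrow> eqv (b y) (c y)"
  shows "(\<psi>, c) \<in> G"
proof -
  have "(\<psi>, \<lambda>y. if y \<in> Y then c y else b y) \<in> G" if "finite Y" "Y \<subseteq> fv \<psi>" for Y
    using that
  proof (induction Y)
    case empty
    then show ?case using fact by simp
  next
    case (insert y Y)
    then have "(\<psi>, (\<lambda>y. if y \<in> Y then c y else b y)(y := c y)) \<in> G"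
      using eqv by (intro replace_one atomic) auto
    moreover have "(\<lambda>y. if y \<in> Y then c y else b y)(y := c y) = (\<lambda>z. if z \<in> insert y Y then c z else b z)"
      by auto
    ultimately show ?case by simp
  qed
  from this[OF finite_fv subset_refl] show ?thesis by (rule fact_cong) simp
qed

lemma eq_refl_fact:
  assumes "has_eq L" "fact_ok W (Eq s t, b)" "tm_bind b s = tm_bind b t"
  shows "(Eq s t, b) \<in> G"
proof -
  have st: "tm_wf L s" "\<And>x. x \<in> tm_fv s \<Longrightarrow> typed W (b x) (vsort L x)"
    using assms(2) by (auto simp: fact_ok_def)
  note ty = typed_bind[of s W b, OF st]
  have "tm_sort L s \<in> sorts L"
    using st(1) vsort_in fcod_in by (cases s) auto
  then obtain x where x: "x \<in> vars L" "vsort L x = tm_sort L s"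
    using fresh_var[of _ "{}"] by blast
  \<comment> \<open>The rule \<open>eq_refl\<close> speaks of a variable. Here this variable has the
    whole term as its value, and \<open>eq_reindex\<close> recovers the equation between
    terms.\<close>
  let ?c = "\<lambda>_. tm_bind b s"
  have "E {x} {} (Eq (Var x) (Var x))"
    using eq_refl assms(1) x(1) by (simp add: is_ctx_def)
  then have "(Eq (Var x) (Var x), ?c) \<in> G"
    by (rule entailment_closed) (use ty x in auto)
  then show ?thesis by (rule eq_reindex) (use assms in auto)
qed

lemma eqv_sym: "eqv t u \<Longrightarrow> eqv u t"
proof -
  assume eqv: "eqv t u"
  show ?thesis
  proof (cases "t = u")
    case True
    then show ?thesis using eqv by simp
  next
    case False
    then obtain p q c where c: "(Eq (Var p) (Var q), c) \<in> G" "c p = t" "c q = u"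
      using eqv by (auto simp: eqv_def)
    have pq: "p \<noteq> q" using c False by auto
    \<comment> \<open>Reflexivity gives \<open>t = t\<close>; replacing its left side by
      \<open>u\<close> gives \<open>u = t\<close>.\<close>
    have "(Eq (Var p) (Var q), c(q := t)) \<in> G"
      by (rule eq_refl_fact) (use eq_fact_ok[OF c(1)] c pq in \<open>auto simp: fact_ok_def\<close>)
    then have "(Eq (Var p) (Var q), c(q := t, p := u)) \<in> G"
      by (rule replace_one) (use eqv c pq in auto)
    then show ?thesis using pq unfolding eqv_def by (metis fun_upd_apply)
  qed
qed

lemma eqv_trans: "eqv t u \<Longrightarrow> eqv u v \<Longrightarrow> eqv t v"
proof -
  assume eqv: "eqv t u" "eqv u v"
  show ?thesis
  proof (cases "t = u")
    case True
    then show ?thesis using eqv by simp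
  next
    case False
    then obtain p q c where c: "(Eq (Var p) (Var q), c) \<in> G" "c p = t" "c q = u"
      using eqv by (auto simp: eqv_def)
    have pq: "p \<noteq> q" using c False by auto
    \<comment> \<open>The right side of \<open>t = u\<close> is replaced by
      \<open>v\<close>.\<close>
    have "(Eq (Var p) (Var q), c(q := v)) \<in> G"
      by (rule replace_one[OF c(1)]) (use eqv c in auto)
    then show ?thesis using pq c unfolding eqv_def by (metis fun_upd_apply)
  qed
qed

text \<open>\<open>eqv\<close> mentions only equations between variables. Giving the two terms as
  values to distinct variables of their common sort extends it to equations between arbitrary
  terms.\<close>

lemma eq_fact_iff:
  assumes fact: "fact_ok W (Eq s t, b)"
  shows "(Eq s t, b) \<in> G \<longleftrightarrow> eqv (tm_bind b s) (tm_bind b t)"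
proof
  have wf: "has_eq L" "tm_wf L s" "tm_wf L t" "tm_sort L s = tm_sort L t"
    and tys: "\<And>x. x \<in> tm_fv s \<Longrightarrow> typed W (b x) (vsort L x)" "\<And>x. x \<in> tm_fv t \<Longrightarrow> typed W (b x) (vsort L x)"
    using fact by (auto simp: fact_ok_def)
  note ty = typed_bind[of s W b, OF wf(2) tys(1)] typed_bind[of t W b, OF wf(3) tys(2)]
  {
    assume G: "(Eq s t, b) \<in> G"
    have sort: "tm_sort L s \<in> sorts L"
      using wf(2) vsort_in fcod_in by (cases s) auto
    obtain p where p: "p \<in> vars L" "vsort L p = tm_sort L s" using fresh_var[OF sort, of "{}"] by auto
    obtain q where q: "q \<in> vars L" "vsort L q = tm_sort L s" "q \<noteq> p" using fresh_var[OF sort, of "{p}"] by auto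
    have "(Eq (Var p) (Var q), (\<lambda>_. tm_bind b s)(q := tm_bind b t)) \<in> G"
      by (rule eq_reindex[OF G]) (use p q wf ty in \<open>auto simp: fact_ok_def\<close>)
    then show "eqv (tm_bind b s) (tm_bind b t)" unfolding eqv_def using q(3) by fastforce
  next
    assume eqv: "eqv (tm_bind b s) (tm_bind b t)"
    show "(Eq s t, b) \<in> G"
    proof (cases "tm_bind b s = tm_bind b t")
      case True
      then show ?thesis using eq_refl_fact wf(1) fact by blast
    next
      case False
      then obtain p q c where "(Eq (Var p) (Var q), c) \<in> G" "c p = tm_bind b s" "c q = tm_bind b t"
        using eqv by (auto simp: eqv_def)
      then show ?thesis using eq_reindex[OF _ fact] by simp
    qed
  }
qed

lemma fresh_vars:
  assumes "set ss \<subseteq> sorts L" "finite B"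
  shows "\<exists>xs. distinct xs \<and> set xs \<subseteq> vars L \<and> set xs \<inter> B = {} \<and> map (vsort L) xs = ss"
  using assms(1)
proof (induction ss)
  case (Cons s ss)
  then obtain xs where xs: "distinct xs" "set xs \<subseteq> vars L" "set xs \<inter> B = {}" "map (vsort L) xs = ss" by auto
  obtain x where "x \<in> vars L" "vsort L x = s" "x \<notin> B \<union> set xs"
    using fresh_var[of s "B \<union> set xs"] Cons assms(2) by auto
  with xs show ?case by (intro exI[of _ "x # xs"]) auto
qed simp

lemma env_exists:
  assumes "distinct xs" "length xs = length us"
  shows "\<exists>c. map c xs = us"
proof
  show "map (\<lambda>x. the (map_of (zip xs us) x)) xs = us"
    using assms by (auto intro!: nth_equalityI simp: map_of_zip_nth)
qed

text \<open>The equation between \<open>f\<close> applied to \<open>ys\<close> and \<open>f\<close>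
  applied to \<open>zs\<close> holds by reflexivity when both lists have the values
  \<open>us\<close>; then the values of \<open>zs\<close> are replaced by \<open>vs\<close>.
  Distinct variables allow changing one side alone.\<close>

lemma eqv_Fun:
  assumes us: "typed W (Fun f us) s" and eqv: "list_all2 eqv us vs"
  shows "eqv (Fun f us) (Fun f vs)"
proof (cases "us = vs")
  case True
  then show ?thesis by (simp add: eqv_def)
next
  case False
  note len = list_all2_lengthD[OF eqv]
  have f: "f \<in> funs L" "list_all2 (typed W) us (fdom L f)" using us by (auto simp: typed_Fun)
  have fv: "list_all2 (typed W) vs (fdom L f)"
    using f(2) eqv eqv_typed by (auto simp: list_all2_conv_all_nth)
  \<comment> \<open>Different but equivalent lists contain a proper equation, and this shows that
    the language has equality; reflexivity can then be invoked.\<close>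
  have "\<exists>t u. eqv t u \<and> t \<noteq> u"
    using False eqv unfolding list_all2_conv_all_nth list_eq_iff_nth_eq by blast
  then have he: "has_eq L" using eq_fact_ok(1) unfolding eqv_def by blast
  obtain xs where xs: "distinct xs" "set xs \<subseteq> vars L" "map (vsort L) xs = fdom L f @ fdom L f"
    using fresh_vars[of "fdom L f @ fdom L f" "{}"] fdom_in[OF f(1)] by auto
  define ys zs where "ys = take (length (fdom L f)) xs" and "zs = drop (length (fdom L f)) xs"
  have xyz: "xs = ys @ zs" by (simp add: ys_def zs_def)
  have lenx: "length xs = 2 * length (fdom L f)" using arg_cong[OF xs(3), of length] by simp
  have ys: "map (vsort L) ys = fdom L f" "map (vsort L) zs = fdom L f"
    using xs(3) unfolding ys_def zs_def take_map[symmetric] drop_map[symmetric] by simp_all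
  have lenus: "length us = length (fdom L f)" using list_all2_lengthD[OF f(2)] .
  obtain b where b: "map b xs = us @ us" using env_exists[OF xs(1), of "us @ us"] lenx lenus by auto
  obtain c where c: "map c xs = us @ vs" using env_exists[OF xs(1), of "us @ vs"] lenx lenus len by auto
  have lenyz: "length ys = length us" "length zs = length us" using lenx lenus by (auto simp: ys_def zs_def)
  have bc: "map b ys = us" "map b zs = us" "map c ys = us" "map c zs = vs"
    using b c lenyz by (auto simp: xyz)
  define \<psi> :: "('f, 'r, 'v) fm" where "\<psi> = Eq (Fun f (map Var ys)) (Fun f (map Var zs))"
  have ty: "typed W (d x) (vsort L x)" if "map d xs = ws" "list_all2 (typed W) ws (fdom L f @ fdom L f)" "x \<in> set xs" for d ws x
    using that(2,3) unfolding that(1)[symmetric] xs(3)[symmetric]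
    by (auto simp: list_all2_conv_all_nth in_set_conv_nth)
  have okd: "fact_ok W (\<psi>, d)" if "map d xs = ws" "list_all2 (typed W) ws (fdom L f @ fdom L f)" for d ws
    using ty[OF that] f(1) he xs(2) ys by (auto simp: \<psi>_def fact_ok_def xyz comp_def)
  have okb: "fact_ok W (\<psi>, b)" by (rule okd[OF b]) (simp add: f(2) list_all2_appendI)
  have okc: "fact_ok W (\<psi>, c)" by (rule okd[OF c]) (simp add: f(2) fv list_all2_appendI)
  have "(\<psi>, b) \<in> G"
    unfolding \<psi>_def by (rule eq_refl_fact[OF he okb[unfolded \<psi>_def]]) (simp add: comp_def bc)
  then have "(\<psi>, c) \<in> G"
  proof (rule replace_all)
    fix x assume "x \<in> fv \<psi>"
    then have "x \<in> set xs" by (auto simp: \<psi>_def xyz)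
    moreover have "list_all2 eqv (us @ us) (us @ vs)"
      using eqv by (intro list_all2_appendI) (simp_all add: eqv_def list.rel_refl)
    ultimately show "eqv (b x) (c x)"
      unfolding b[symmetric] c[symmetric] by (auto simp: list_all2_conv_all_nth in_set_conv_nth)
  qed (simp add: \<psi>_def)
  then have "eqv (tm_bind c (Fun f (map Var ys))) (tm_bind c (Fun f (map Var zs)))"
    using eq_fact_iff okc by (simp add: \<psi>_def)
  then show ?thesis by (simp add: comp_def bc)
qed

text \<open>The elements of the model are representatives rather than classes, so that they remain
  terms, the type whose subsets and functions can be coded.\<close>

definition rep :: "('f, 'w) tm \<Rightarrow> ('f, 'w) tm" where
  "rep t = (SOME u. eqv t u)"

lemma eqv_rep: "eqv t (rep t)"
  unfolding rep_def by (rule someI[of _ t]) (simp add: eqv_def)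

lemma rep_eq_iff: "rep t = rep u \<longleftrightarrow> eqv t u"
proof
  assume "rep t = rep u"
  then show "eqv t u" using eqv_rep eqv_sym eqv_trans by metis
next
  assume "eqv t u"
  then have "eqv t = eqv u" using eqv_sym eqv_trans by blast
  then show "rep t = rep u" by (simp add: rep_def)
qed

text \<open>\<open>fint\<close> picks some terms represented by its arguments, which
  \<open>eqv_Fun\<close> makes harmless. \<open>rint\<close> collects the arguments of all facts
  about \<open>r\<close>; by \<open>rel_fact_iff\<close> the truth of a fact depends only on the
  represented arguments.\<close>

definition M :: "(('f, 'w) tm, 's, 'f, 'r) struct" where
  "M = \<lparr>carr = \<lambda>s. rep ` {t. typed W t s},
     fint = \<lambda>f ds. rep (Fun f (SOME us. map rep us = ds)),
     rint = \<lambda>r. {map rep (map (tm_bind b) ts) | ts b. (Rel r ts, b) \<in> G}\<rparr>"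

lemma map_rep_eq_iff: "map rep us = map rep vs \<longleftrightarrow> list_all2 eqv us vs"
  by (simp add: list_eq_iff_nth_eq list_all2_conv_all_nth rep_eq_iff) (metis nth_map rep_eq_iff)

lemma fint_rep:
  assumes "typed W (Fun f us) s"
  shows "fint M f (map rep us) = rep (Fun f us)"
proof -
  let ?vs = "SOME vs. map rep vs = map rep us"
  have "map rep ?vs = map rep us" by (rule someI[of _ us]) simp
  then have "list_all2 eqv us ?vs" using map_rep_eq_iff by metis
  then have "eqv (Fun f us) (Fun f ?vs)" by (rule eqv_Fun[OF assms])
  then show ?thesis by (simp add: M_def rep_eq_iff eqv_sym)
qed

lemma tval_rep:
  "tm_wf L t \<Longrightarrow> (\<And>x. x \<in> tm_fv t \<Longrightarrow> typed W (b x) (vsort L x)) \<Longrightarrow>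
    tval M (\<lambda>x. rep (b x)) t = rep (tm_bind b t)"
proof (induction t)
  case (Fun f ts)
  have "map (tval M (\<lambda>x. rep (b x))) ts = map rep (map (tm_bind b) ts)"
    using Fun by auto
  then have "tval M (\<lambda>x. rep (b x)) (Fun f ts) = fint M f (map rep (map (tm_bind b) ts))"
    by (simp only: tval.simps)
  then show ?case
    using fint_rep[of f "map (tm_bind b) ts"] typed_bind[OF Fun.prems] by simp
qed simp

lemma rel_fact_iff:
  assumes fact: "fact_ok W (Rel r ts, b)"
  shows "(Rel r ts, b) \<in> G \<longleftrightarrow> map rep (map (tm_bind b) ts) \<in> rint M r"
proof
  assume "(Rel r ts, b) \<in> G"
  then show "map rep (map (tm_bind b) ts) \<in> rint M r" by (auto simp: M_def)
next
  assume "map rep (map (tm_bind b) ts) \<in> rint M r"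
  then obtain ts' b' where G: "(Rel r ts', b') \<in> G"
    and eq: "map rep (map (tm_bind b) ts) = map rep (map (tm_bind b') ts')" by (auto simp: M_def)
  have wf: "r \<in> rels L" "map (tm_sort L) ts = rdom L r" "map (tm_sort L) ts' = rdom L r"
    and wft: "\<And>t. t \<in> set ts \<Longrightarrow> typed W (tm_bind b t) (tm_sort L t)"
    and wft': "\<And>t. t \<in> set ts' \<Longrightarrow> typed W (tm_bind b' t) (tm_sort L t)"
    using fact fact_ok_mem[OF G] by (auto simp: fact_ok_def intro!: typed_bind)
  have len: "length ts = length (rdom L r)" "length ts' = length (rdom L r)"
    using arg_cong[OF wf(2), of length] arg_cong[OF wf(3), of length] by simp_all
  obtain xs where xs: "distinct xs" "set xs \<subseteq> vars L" "map (vsort L) xs = rdom L r"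
    using fresh_vars[of "rdom L r" "{}"] rdom_in[OF wf(1)] by auto
  have lenx: "length xs = length (rdom L r)" using arg_cong[OF xs(3), of length] by simp
  obtain c where c: "map c xs = map (tm_bind b) ts"
    using env_exists[OF xs(1), of "map (tm_bind b) ts"] lenx len by auto
  obtain c' where c': "map c' xs = map (tm_bind b') ts'"
    using env_exists[OF xs(1), of "map (tm_bind b') ts'"] lenx len by auto
  have nth: "c (xs ! i) = tm_bind b (ts ! i)" "c' (xs ! i) = tm_bind b' (ts' ! i)" "vsort L (xs ! i) = rdom L r ! i"
    "tm_sort L (ts ! i) = rdom L r ! i" "tm_sort L (ts' ! i) = rdom L r ! i" "ts ! i \<in> set ts" "ts' ! i \<in> set ts'"
    if "i < length (rdom L r)" for i
    using that len lenx arg_cong[OF c, of "\<lambda>l. l ! i"] arg_cong[OF c', of "\<lambda>l. l ! i"]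
      arg_cong[OF xs(3), of "\<lambda>l. l ! i"] arg_cong[OF wf(2), of "\<lambda>l. l ! i"] arg_cong[OF wf(3), of "\<lambda>l. l ! i"] by auto
  have ix: "\<exists>i<length (rdom L r). x = xs ! i" if "x \<in> set xs" for x
    using that lenx by (auto simp: in_set_conv_nth)
  have ty: "typed W (c x) (vsort L x)" "typed W (c' x) (vsort L x)" if "x \<in> set xs" for x
    using ix[OF that] nth wft wft' by force+
  \<comment> \<open>Both facts are re-read as \<open>r\<close> applied to distinct variables, where
    equivalent values can be exchanged by \<open>replace_all\<close>.\<close>
  let ?\<psi> = "Rel r (map Var xs) :: ('f, 'r, 'v) fm"
  have okx: "fact_ok W (?\<psi>, c)" "fact_ok W (?\<psi>, c')"
    using ty wf(1) xs by (auto simp: fact_ok_def comp_def)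
  have inst: "inst \<rho> (Rel r us, d) = inst \<rho> (?\<psi>, d')" if "map d' xs = map (tm_bind d) us" for \<rho> us d d'
  proof -
    have "map (tm_bind (\<lambda>w. Var (\<rho> w))) (map d' xs) = map (tm_bind (\<lambda>w. Var (\<rho> w))) (map (tm_bind d) us)"
      using that by simp
    then show ?thesis by (simp add: inst_def inst_env_def tm_subst_eq_bind tm_bind_bind comp_def)
  qed
  have "(?\<psi>, c') \<in> G" using same_inst[OF G okx(2) inst[OF c']] .
  then have "(?\<psi>, c) \<in> G"
  proof (rule replace_all)
    fix x assume "x \<in> fv ?\<psi>"
    then have x: "x \<in> set xs" by auto
    have "list_all2 eqv (map c' xs) (map c xs)"
      unfolding c c' map_rep_eq_iff[symmetric] using eq by simp
    then show "eqv (c' x) (c x)" using x by (auto simp: list_all2_conv_all_nth in_set_conv_nth)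
  qed simp
  then show "(Rel r ts, b) \<in> G" using same_inst[OF _ fact] inst[OF c] by metis
qed

text \<open>The truth lemma of the Henkin construction. Environments run over terms, while truth is
  evaluated at their representatives; \<open>witness\<close> settles the elimination half of the
  existential.\<close>

lemma sat_iff_fact:
  "fact_ok W (\<psi>, b) \<Longrightarrow> sat L M \<psi> (\<lambda>x. rep (b x)) \<longleftrightarrow> (\<psi>, b) \<in> G"
proof (induction \<psi> arbitrary: b)
  case Top
  have "is_ctx L {}" by (simp add: is_ctx_def)
  from entailment_closed[OF top[OF this], of b] show ?case by simp
next
  case (Rel r ts)
  have "tval M (\<lambda>x. rep (b x)) t = rep (tm_bind b t)" if "t \<in> set ts" for t
    by (rule tval_rep) (use Rel that in \<open>auto simp: fact_ok_def\<close>)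
  then have "map (tval M (\<lambda>x. rep (b x))) ts = map rep (map (tm_bind b) ts)" by auto
  then show ?case using rel_fact_iff[OF Rel] by (simp only: sat.simps)
next
  case (Eq s t)
  have "tval M (\<lambda>x. rep (b x)) s = rep (tm_bind b s)" "tval M (\<lambda>x. rep (b x)) t = rep (tm_bind b t)"
    using Eq by (auto intro!: tval_rep simp: fact_ok_def)
  then show ?case using eq_fact_iff[OF Eq] rep_eq_iff by simp
next
  case (And \<phi> \<psi>)
  let ?U = "fv (And \<phi> \<psi>)"
  have ok: "fact_ok W (\<phi>, b)" "fact_ok W (\<psi>, b)" using And.prems by (auto simp: fact_ok_def)
  have U: "is_ctx L ?U" "\<phi> \<in> fms L ?U" "\<psi> \<in> fms L ?U"
    using ctx_fv[of L "And \<phi> \<psi>"] And.prems by (auto simp: fact_ok_def fms_def)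
  have ty: "\<And>x. x \<in> ?U \<Longrightarrow> typed W (b x) (vsort L x)" using And.prems by (auto simp: fact_ok_def)
  have "(And \<phi> \<psi>, b) \<in> G \<longleftrightarrow> (\<phi>, b) \<in> G \<and> (\<psi>, b) \<in> G"
    using entailment_closed[OF conjI[OF U] ty] entailment_closed[OF conjD1[OF U] ty]
      entailment_closed[OF conjD2[OF U] ty] by blast
  then show ?case using And.IH ok by simp
next
  case (Ex x \<phi>)
  have x: "x \<in> vars L" using Ex.prems by (simp add: fact_ok_def)
  have okt: "fact_ok W (\<phi>, b(x := t))" if "typed W t (vsort L x)" for t
    using Ex.prems that by (auto simp: fact_ok_def)
  have upd: "(\<lambda>y. rep ((b(x := t)) y)) = (\<lambda>y. rep (b y))(x := rep t)" for t by auto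
  have "sat L M (Ex x \<phi>) (\<lambda>y. rep (b y)) \<longleftrightarrow> (\<exists>t. typed W t (vsort L x) \<and> sat L M \<phi> ((\<lambda>y. rep (b y))(x := rep t)))"
    by (auto simp: M_def)
  also have "\<dots> \<longleftrightarrow> (\<exists>t. typed W t (vsort L x) \<and> (\<phi>, b(x := t)) \<in> G)"
    using Ex.IH[OF okt] unfolding upd by blast
  also have "\<dots> \<longleftrightarrow> (Ex x \<phi>, b) \<in> G"
  proof
    assume "\<exists>t. typed W t (vsort L x) \<and> (\<phi>, b(x := t)) \<in> G"
    then obtain t where t: "typed W t (vsort L x)" "(\<phi>, b(x := t)) \<in> G" by blast
    let ?U = "fv (Ex x \<phi>)"
    have U: "is_ctx L ?U" "\<phi> \<in> fms L (insert x ?U)" "Ex x \<phi> \<in> fms L ?U"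
      using ctx_fv[of L "Ex x \<phi>"] Ex.prems by (auto simp: fact_ok_def fms_def)
    \<comment> \<open>Applied to the identity on \<open>Ex x \<phi>\<close>, the adjunction
      \<open>ex\<close> yields the introduction of the quantifier.\<close>
    have "E ?U (insert (Ex x \<phi>) {}) (Ex x \<phi>)" using identity[OF U(1)] U(3) by blast
    then have "E (insert x ?U) (insert \<phi> {}) (Ex x \<phi>)" using ex[OF U(1) x _ U(2) _ U(3), of "{}"] by simp
    then have "(Ex x \<phi>, b(x := t)) \<in> G"
      by (rule entailment_closed) (use t Ex.prems in \<open>auto simp: fact_ok_def\<close>)
    then show "(Ex x \<phi>, b) \<in> G" by (rule fact_cong) auto
  qed (rule witness)
  finally show ?case .
qed

lemma assignment_rep:
  assumes "assignment L M U a"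
  shows "\<exists>b. \<forall>x\<in>U. typed W (b x) (vsort L x) \<and> a x = rep (b x)"
proof -
  have "\<forall>x\<in>U. \<exists>t. typed W t (vsort L x) \<and> a x = rep t"
    using assms by (auto simp: assignment_def M_def)
  then show ?thesis by metis
qed

lemma set_model_M: "set_model L E M"
  unfolding set_model_def is_struct_def
proof (safe)
  fix f ds assume f: "f \<in> funs L" and ds: "list_all2 (\<lambda>d s. d \<in> carr M s) ds (fdom L f)"
  have "\<exists>us. list_all2 (typed W) us ss \<and> es = map rep us" if "list_all2 (\<lambda>d s. d \<in> carr M s) es ss" for es ss
    using that
  proof induction
    case (Cons d ds s ss)
    then obtain us t where "list_all2 (typed W) us ss" "ds = map rep us" "typed W t s" "d = rep t"
      by (auto simp: M_def)
    then show ?case by (intro exI[of _ "t # us"]) simp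
  qed simp
  then obtain us where us: "list_all2 (typed W) us (fdom L f)" "ds = map rep us" using ds by blast
  then have "typed W (Fun f us) (fcod L f)" using f by (simp add: typed_Fun)
  from fint_rep[OF this] this show "fint M f ds \<in> carr M (fcod L f)" using us(2) by (auto simp: M_def)
next
  fix U \<Gamma> \<psi> a assume E: "E U \<Gamma> \<psi>" and a: "assignment L M U a" and \<Gamma>: "\<forall>\<chi>\<in>\<Gamma>. sat L M \<chi> a"
  obtain b where b: "\<And>x. x \<in> U \<Longrightarrow> typed W (b x) (vsort L x)" "\<And>x. x \<in> U \<Longrightarrow> a x = rep (b x)"
    using assignment_rep[OF a] by blast
  have U: "\<Gamma> \<subseteq> fms L U" "\<psi> \<in> fms L U" using in_context[OF E] by auto
  have sat: "sat L M \<chi> a \<longleftrightarrow> (\<chi>, b) \<in> G" if \<chi>: "\<chi> \<in> fms L U" for \<chi>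
  proof -
    have "sat L M \<chi> a \<longleftrightarrow> sat L M \<chi> (\<lambda>x. rep (b x))"
      by (rule sat_cong) (use \<chi> b(2) in \<open>auto simp: fms_def\<close>)
    also have "\<dots> \<longleftrightarrow> (\<chi>, b) \<in> G"
      by (rule sat_iff_fact) (use \<chi> b(1) in \<open>auto simp: fms_def fact_ok_def\<close>)
    finally show ?thesis .
  qed
  have "(\<psi>, b) \<in> G" by (rule entailment_closed[OF E b(1)]) (use sat U(1) \<Gamma> in auto)
  then show "sat L M \<psi> a" using sat U(2) by blast
qed

lemma countermodel:
  "\<exists>a. assignment L M U0 a \<and> (\<forall>\<psi>\<in>\<Delta>0. sat L M \<psi> a) \<and> \<not> sat L M \<phi>0 a"
proof (intro exI[of _ "\<lambda>x. rep (gen_env x)"] HOL.conjI ballI)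
  have W: "gen ` U0 \<subseteq> W" using state by (simp add: state_def)
  then show "assignment L M U0 (\<lambda>x. rep (gen_env x))"
    by (auto simp: assignment_def M_def gen_env_def typed_Var nsort_gen)
  show "sat L M \<psi> (\<lambda>x. rep (gen_env x))" if "\<psi> \<in> \<Delta>0" for \<psi>
  proof -
    have "(\<psi>, gen_env) \<in> G" "\<psi> \<in> fms L U0" using that \<Delta>0 state by (auto simp: state_def)
    then show ?thesis using sat_iff_fact[OF gen_ok[OF _ W]] by blast
  qed
  have "(\<phi>0, gen_env) \<notin> G"
  proof
    assume G: "(\<phi>0, gen_env) \<in> G"
    have V: "finite (gen ` U0)" using U0 by (simp add: is_ctx_def)
    note gok = gen_ok[OF \<phi>0 subset_refl]
    have "seq (gen ` U0) {(\<phi>0, gen_env)} (\<phi>0, gen_env)"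
      by (rule seq_same_inst[OF _ gok gok sub_name_ctx[OF V W]]) simp
    then show False using consistent[OF W] G by blast
  qed
  then show "\<not> sat L M \<phi>0 (\<lambda>x. rep (gen_env x))" using sat_iff_fact[OF gen_ok[OF \<phi>0 W]] by simp
qed

end

section \<open>Codings\<close>

primrec fm_list :: "('f, 'r, 'v) fm list \<Rightarrow> ('f, 'r, 'v) fm" where
  "fm_list [] = Top"
| "fm_list (\<phi> # \<phi>s) = And \<phi> (fm_list \<phi>s)"

lemma fm_list_inject [simp]: "fm_list \<phi>s = fm_list \<psi>s \<longleftrightarrow> \<phi>s = \<psi>s"
proof (induction \<phi>s arbitrary: \<psi>s)
  case Nil
  then show ?case by (cases \<psi>s) auto
next
  case (Cons \<phi> \<phi>s)
  then show ?case by (cases \<psi>s) auto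
qed

text \<open>The first conjunct tells names from applications and records the function symbol. Codes
  are bare datatype elements and need not be well-formed, so \<open>Eq\<close> is available even if
  \<open>has_eq\<close> fails.\<close>

fun fm_of_tm :: "('f, ('f, 'r, 'v) fm) tm \<Rightarrow> ('f, 'r, 'v) fm" where
  "fm_of_tm (Var w) = And Top w"
| "fm_of_tm (Fun f ts) = And (Eq (Fun f []) (Fun f [])) (fm_list (map fm_of_tm ts))"

lemma fm_of_tm_inject [simp]: "fm_of_tm t = fm_of_tm u \<longleftrightarrow> t = u"
proof
  show "fm_of_tm t = fm_of_tm u \<Longrightarrow> t = u"
  proof (induction t arbitrary: u)
    case (Var w)
    then show ?case by (cases u) auto
  next
    case (Fun f ts)
    then obtain us where us: "u = Fun f us" "map fm_of_tm ts = map fm_of_tm us" by (cases u) auto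
    have "ts = us" by (rule list.inj_map_strong[OF _ us(2)]) (use Fun.IH in blast)
    then show ?case using us(1) by simp
  qed
qed simp

text \<open>Reads the sort off the variable \<open>x\<close> that both \<open>generic_name x\<close>
  and \<open>witness_name x \<phi> b\<close> contain.\<close>

definition fm_sort :: "('s, 'f, 'r, 'v) signature \<Rightarrow> ('f, 'r, 'v) fm \<Rightarrow> 's" where
  "fm_sort L \<chi> = (case \<chi> of Eq s t \<Rightarrow> tm_sort L s
     | And \<alpha> \<beta> \<Rightarrow> (case \<alpha> of Ex x \<phi> \<Rightarrow> vsort L x | _ \<Rightarrow> undefined) | _ \<Rightarrow> undefined)"

definition generic_name :: "'v \<Rightarrow> ('f, 'r, 'v) fm" where
  "generic_name x = Eq (Var x) (Var x)"

text \<open>A fixed enumeration for each formula, so that equal witness names list the values of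
  their environments at the same variables.\<close>

definition fv_list :: "('f, 'r, 'v) fm \<Rightarrow> 'v list" where
  "fv_list \<phi> = (SOME xs. set xs = fv \<phi>)"

text \<open>A whole environment may be too large to be recorded in a formula; its values on the
  finitely many free variables are what the fact depends on.\<close>

definition witness_name :: "'v \<Rightarrow> ('f, 'r, 'v) fm \<Rightarrow> ('v \<Rightarrow> ('f, ('f, 'r, 'v) fm) tm) \<Rightarrow> ('f, 'r, 'v) fm" where
  "witness_name x \<phi> b = And (Ex x \<phi>) (fm_list (map (\<lambda>y. fm_of_tm (b y)) (fv_list (Ex x \<phi>))))"

lemma set_fv_list: "set (fv_list \<phi>) = fv \<phi>"
  unfolding fv_list_def by (rule someI_ex) (rule finite_list[OF finite_fv])

text \<open>The elements of the model have a type built from the language alone, so the model lives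
  in the category over any types that can code sets of formulas.\<close>

lemma (in regular_theory) set_completeness:
  fixes U0 \<Delta>0 \<phi>0
  assumes "is_ctx L U0" "\<Delta>0 \<subseteq> fms L U0" "\<phi>0 \<in> fms L U0" "\<not> E U0 \<Delta>0 \<phi>0"
  obtains M :: "(('f, ('f, 'r, 'v) fm) tm, 's, 'f, 'r) struct" and a
  where "set_model L E M" "assignment L M U0 a" "\<forall>\<psi>\<in>\<Delta>0. sat L M \<psi> a" "\<not> sat L M \<phi>0 a"
proof -
  interpret henkin L E "fm_sort L" generic_name witness_name U0 \<Delta>0 \<phi>0
  proof unfold_locales
    show "inj (generic_name :: 'v \<Rightarrow> ('f, 'r, 'v) fm)" by (auto simp: inj_def generic_name_def)
    show "x = x' \<and> \<phi> = \<phi>' \<and> (\<forall>y\<in>fv (Ex x \<phi>). b y = b' y)"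
      if "witness_name x \<phi> b = witness_name x' \<phi>' b'" for x x' \<phi> \<phi>' and b b' :: "'v \<Rightarrow> ('f, ('f, 'r, 'v) fm) tm"
    proof -
      have "x = x'" "\<phi> = \<phi>'" "\<forall>y\<in>set (fv_list (Ex x \<phi>)). b y = b' y"
        using that by (auto simp: witness_name_def)
      then show ?thesis unfolding set_fv_list by blast
    qed
  qed (use assms in \<open>auto simp: fm_sort_def generic_name_def witness_name_def\<close>)
  obtain W G where WG: "state W G"
    "\<forall>W' G'. state W' G' \<longrightarrow> W \<subseteq> W' \<longrightarrow> G \<subseteq> G' \<longrightarrow> W' = W \<and> G' = G"
    using maximal_state by blast
  interpret henkin_complete L E "fm_sort L" generic_name witness_name U0 \<Delta>0 \<phi>0 W G
    by unfold_locales (use WG in auto)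
  show ?thesis using that set_model_M countermodel by blast
qed

text \<open>A set of terms becomes a set of formulas by \<open>fm_of_tm\<close>. An arrow becomes
  the union of copies of its source, target and graph, tagged by the first conjuncts
  \<open>Top\<close>, \<open>And Top Top\<close> and \<open>And Top (And Top Top)\<close>. A list of
  terms becomes a single name, hence a term.\<close>

lemma coded_sets_exists:
  assumes "inj (ci :: ('f, 'r, 'v) fm set \<Rightarrow> 'o)" "inj (cj :: ('f, 'r, 'v) fm set \<Rightarrow> 'm)"
  shows "\<exists>i j code. coded_sets (i :: ('f, ('f, 'r, 'v) fm) tm set \<Rightarrow> 'o)
    (j :: ('f, ('f, 'r, 'v) fm) tm set \<times> ('f, ('f, 'r, 'v) fm) tm set \<times>
      (('f, ('f, 'r, 'v) fm) tm \<times> ('f, ('f, 'r, 'v) fm) tm) set \<Rightarrow> 'm) code"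
proof -
  let ?e = "fm_of_tm :: ('f, ('f, 'r, 'v) fm) tm \<Rightarrow> ('f, 'r, 'v) fm"
  define e3 where "e3 = (\<lambda>(A, B, R). (\<lambda>x. And Top (?e x)) ` A \<union> (\<lambda>x. And (And Top Top) (?e x)) ` B \<union>
    (\<lambda>(x, y). And (And Top (And Top Top)) (And (?e x) (?e y))) ` R)"
  have "A = {x. And Top (?e x) \<in> e3 (A, B, R)}" "B = {x. And (And Top Top) (?e x) \<in> e3 (A, B, R)}"
    "R = {(x, y). And (And Top (And Top Top)) (And (?e x) (?e y)) \<in> e3 (A, B, R)}" for A B R
    by (auto simp: e3_def image_iff Bex_def)
  then have "inj e3" by (intro injI) (metis prod_cases3)
  moreover have "inj ((`) ?e)" by (rule injI) (simp add: inj_image_eq_iff inj_def)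
  moreover have "inj (\<lambda>ts. Var (fm_list (map ?e ts)) :: ('f, ('f, 'r, 'v) fm) tm)"
    by (rule injI) (simp add: inj_map_eq_map inj_def)
  ultimately have "coded_sets (ci \<circ> (`) ?e) (cj \<circ> e3) (\<lambda>ts. Var (fm_list (map ?e ts)))"
    using assms by (simp add: coded_sets_def inj_compose)
  then show ?thesis by blast
qed

section \<open>The inchworm closure\<close>

context regular_theory
begin

definition inchworm_closure :: "'v set set \<Rightarrow> ('f, 'r, 'v) fm set \<Rightarrow> ('f, 'r, 'v) fm set" where
  "inchworm_closure K \<Gamma> = {\<psi> \<in> fms_over L K. inchworm L E K \<Gamma> \<psi>}"

lemma inchworm_cut_finite:
  "finite D \<Longrightarrow> \<forall>\<chi>\<in>D. inchworm L E K \<Gamma> \<chi> \<Longrightarrow> inchworm L E K (\<Gamma> \<union> D) \<psi> \<Longrightarrow> inchworm L E K \<Gamma> \<psi>"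
proof (induction D rule: finite_induct)
  case (insert \<chi> D)
  have "inchworm L E K ((\<Gamma> \<union> D) \<union> {\<chi>}) \<psi>" using insert.prems(2) by (simp add: Un_insert_right)
  then have "inchworm L E K (\<Gamma> \<union> (\<Gamma> \<union> D)) \<psi>"
    using inchworm.cut insert.prems(1) by blast
  moreover have "\<Gamma> \<union> (\<Gamma> \<union> D) = \<Gamma> \<union> D" by blast
  ultimately show ?case using insert.IH insert.prems(1) by simp
qed simp

text \<open>The rule \<open>local\<close> applies once the formulas of the closure that are used
  have been adjoined to \<open>\<Gamma>\<close>. There are finitely many of them by
  \<open>finitary\<close>, so repeated cuts remove them again.\<close>

lemma closure_closed:
  assumes U: "U \<in> K" and E: "E U \<Delta> \<psi>" and \<Delta>: "\<Delta> \<subseteq> inchworm_closure K \<Gamma>"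
  shows "\<psi> \<in> inchworm_closure K \<Gamma>"
proof -
  obtain D where D: "finite D" "D \<subseteq> \<Delta>" "E U D \<psi>" using finitary[OF E] by blast
  have fm: "D \<subseteq> fms L U" "\<psi> \<in> fms L U" using in_context[OF D(3)] by auto
  have "E U ((\<Gamma> \<union> D) \<inter> fms L U) \<psi>" by (rule weakening[OF D(3)]) (use fm in auto)
  then have "inchworm L E K (\<Gamma> \<union> D) \<psi>" by (rule inchworm.local[OF U fm(2)])
  moreover have "\<forall>\<chi>\<in>D. inchworm L E K \<Gamma> \<chi>" using D(2) \<Delta> by (auto simp: inchworm_closure_def)
  ultimately have "inchworm L E K \<Gamma> \<psi>" using inchworm_cut_finite[OF D(1)] by blast
  then show ?thesis using U fm(2) by (auto simp: inchworm_closure_def fms_over_def)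
qed

lemma closure_contains:
  assumes K: "\<And>U. U \<in> K \<Longrightarrow> is_ctx L U" and \<Gamma>: "\<Gamma> \<subseteq> fms_over L K"
  shows "\<Gamma> \<subseteq> inchworm_closure K \<Gamma>"
proof
  fix \<psi> assume \<psi>: "\<psi> \<in> \<Gamma>"
  then obtain U where U: "U \<in> K" "\<psi> \<in> fms L U" using \<Gamma> by (auto simp: fms_over_def)
  have "E U (\<Gamma> \<inter> fms L U) \<psi>" by (rule identity[OF K[OF U(1)]]) (use \<psi> U in auto)
  then show "\<psi> \<in> inchworm_closure K \<Gamma>"
    using inchworm.local[OF U] \<psi> \<Gamma> by (auto simp: inchworm_closure_def)
qed

text \<open>The list coding \<open>fm_list\<close> doubles as finite conjunction, ending in
  \<open>Top\<close>.\<close>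

lemma fm_list_derivable:
  assumes V: "is_ctx L V"
  shows "set \<phi>s \<subseteq> fms L V \<Longrightarrow> fm_list \<phi>s \<in> fms L V \<and> E V (set \<phi>s) (fm_list \<phi>s)"
proof (induction \<phi>s)
  case Nil
  then show ?case using top[OF V] by (simp add: fms_def)
next
  case (Cons \<phi> \<phi>s)
  then have IH: "fm_list \<phi>s \<in> fms L V" "E V (set \<phi>s) (fm_list \<phi>s)" and \<phi>: "\<phi> \<in> fms L V" by auto
  have "E V (insert (fm_list \<phi>s) {\<phi>}) (And \<phi> (fm_list \<phi>s))"
    using conjI[OF V \<phi> IH(1)] by (simp add: insert_commute)
  from cut[OF IH(2) this] show ?case using \<phi> IH(1) by (auto simp: fms_def)
qed

lemma sat_fm_list: "sat L M (fm_list \<phi>s) a \<longleftrightarrow> (\<forall>\<phi>\<in>set \<phi>s. sat L M \<phi> a)"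
  by (induction \<phi>s) auto

lemma extend_one:
  assumes K: "\<And>U. U \<in> K \<Longrightarrow> is_ctx L U" and M: "set_model L E M"
    and V: "insert x U \<in> K" "x \<notin> U"
    and \<Delta>: "finite \<Delta>" "\<Delta> \<subseteq> inchworm_closure K \<Gamma> \<inter> fms L (insert x U)"
      "\<forall>\<psi>\<in>inchworm_closure K \<Gamma> \<inter> fms L (insert x U). E (insert x U) \<Delta> \<psi>"
    and a: "assignment L M U a" "\<forall>\<psi>\<in>inchworm_closure K \<Gamma> \<inter> fms L U. sat L M \<psi> a"
  shows "\<exists>d. assignment L M (insert x U) (a(x := d)) \<and>
    (\<forall>\<psi>\<in>inchworm_closure K \<Gamma> \<inter> fms L (insert x U). sat L M \<psi> (a(x := d)))"
proof -
  let ?V = "insert x U"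
  have ctx: "is_ctx L ?V" "is_ctx L U" "x \<in> vars L" using K[OF V(1)] by (auto simp: is_ctx_def)
  obtain \<phi>s where \<phi>s: "set \<phi>s = \<Delta>" using finite_list[OF \<Delta>(1)] by blast
  define \<theta> where "\<theta> = fm_list \<phi>s"
  have \<theta>: "\<theta> \<in> fms L ?V" "E ?V \<Delta> \<theta>" using fm_list_derivable[OF ctx(1), of \<phi>s] \<phi>s \<Delta>(2) by (auto simp: \<theta>_def)
  have ex\<theta>: "Ex x \<theta> \<in> fms L U" using \<theta>(1) ctx(3) by (auto simp: fms_def)
  have "E U (insert (Ex x \<theta>) {}) (Ex x \<theta>)" by (rule identity[OF ctx(2)]) (use ex\<theta> in auto)
  then have "E ?V (insert \<theta> {}) (Ex x \<theta>)" using ex[OF ctx(2,3) V(2) \<theta>(1) _ ex\<theta>, of "{}"] by simp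
  \<comment> \<open>This formula belongs to the small context \<open>U\<close> but is derived over
    the larger face, where the formulas behind \<open>\<theta>\<close> live. It is the inchworm step
    that passes information down to \<open>U\<close>.\<close>
  from cut[OF \<theta>(2) this] have "E ?V \<Delta> (Ex x \<theta>)" by simp
  then have "Ex x \<theta> \<in> inchworm_closure K \<Gamma>" by (rule closure_closed[OF V(1)]) (use \<Delta>(2) in blast)
  then have "sat L M (Ex x \<theta>) a" using a(2) ex\<theta> by blast
  then obtain d where d: "d \<in> carr M (vsort L x)" "sat L M \<theta> (a(x := d))" by auto
  have as: "assignment L M ?V (a(x := d))" using a(1) d(1) by (auto simp: assignment_def)
  have "\<forall>\<psi>\<in>\<Delta>. sat L M \<psi> (a(x := d))" using d(2) \<phi>s by (simp add: \<theta>_def sat_fm_list)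
  then have "\<forall>\<psi>\<in>inchworm_closure K \<Gamma> \<inter> fms L ?V. sat L M \<psi> (a(x := d))"
    using M \<Delta>(3) as unfolding set_model_def by blast
  with as show ?thesis by blast
qed

lemma extend_assignment:
  assumes K: "simplicial_complex X K" "X \<subseteq> vars L" and M: "set_model L E M"
    and fin: "\<And>U. U \<in> K \<Longrightarrow> \<exists>\<Delta>. finite \<Delta> \<and> \<Delta> \<subseteq> inchworm_closure K \<Gamma> \<inter> fms L U \<and>
      (\<forall>\<psi>\<in>inchworm_closure K \<Gamma> \<inter> fms L U. E U \<Delta> \<psi>)"
    and a: "assignment L M U a" "\<forall>\<psi>\<in>inchworm_closure K \<Gamma> \<inter> fms L U. sat L M \<psi> a"
  shows "finite Y \<Longrightarrow> U \<inter> Y = {} \<Longrightarrow> U \<union> Y \<in> K \<Longrightarrow>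
    \<exists>b. assignment L M (U \<union> Y) b \<and> (\<forall>x\<in>U. b x = a x) \<and>
      (\<forall>\<psi>\<in>inchworm_closure K \<Gamma> \<inter> fms L (U \<union> Y). sat L M \<psi> b)"
proof (induction Y rule: finite_induct)
  case empty
  then show ?case using a by auto
next
  case (insert y Y)
  have ctx: "is_ctx L V" if "V \<in> K" for V using that K by (auto simp: simplicial_complex_def is_ctx_def)
  have eq: "U \<union> insert y Y = insert y (U \<union> Y)" by simp
  have V: "insert y (U \<union> Y) \<in> K" "y \<notin> U \<union> Y" using insert.prems insert.hyps by auto
  \<comment> \<open>The context with one variable less is a face because the complex is closed under
    subsets, so the induction hypothesis applies to it.\<close>
  then have "U \<union> Y \<in> K" using K(1) unfolding simplicial_complex_def by blast
  then obtain b where b: "assignment L M (U \<union> Y) b" "\<forall>x\<in>U. b x = a x"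
    "\<forall>\<psi>\<in>inchworm_closure K \<Gamma> \<inter> fms L (U \<union> Y). sat L M \<psi> b"
    using insert.IH insert.prems(1) by blast
  obtain \<Delta> where \<Delta>: "finite \<Delta>" "\<Delta> \<subseteq> inchworm_closure K \<Gamma> \<inter> fms L (insert y (U \<union> Y))"
      "\<forall>\<psi>\<in>inchworm_closure K \<Gamma> \<inter> fms L (insert y (U \<union> Y)). E (insert y (U \<union> Y)) \<Delta> \<psi>"
    using fin[OF V(1)] by blast
  from extend_one[OF ctx M V \<Delta> b(1,3)] obtain d where
    d: "assignment L M (insert y (U \<union> Y)) (b(y := d))"
      "\<forall>\<psi>\<in>inchworm_closure K \<Gamma> \<inter> fms L (insert y (U \<union> Y)). sat L M \<psi> (b(y := d))" by blast
  moreover have "\<forall>x\<in>U. (b(y := d)) x = a x" using b(2) V(2) by auto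
  ultimately show ?case unfolding eq by blast
qed

end

theorem theorem25:
  fixes X :: "'v set"
    and K :: "'v set set"
    and L :: "('s, 'f, 'r, 'v) signature"
    and E :: "'v set \<Rightarrow> ('f, 'r, 'v) fm set \<Rightarrow> ('f, 'r, 'v) fm \<Rightarrow> bool"
    and \<Gamma> :: "('f, 'r, 'v) fm set"
    and \<phi> :: "('f, 'r, 'v) fm"
  assumes "simplicial_complex X K"
    and "language L" and "X \<subseteq> vars L"
    and "regular_theory L E"
    and "\<And>\<Gamma>' U. \<Gamma>' \<subseteq> fms_over L K \<Longrightarrow> U \<in> K \<Longrightarrow>
      \<exists>\<Delta>. finite \<Delta> \<and> \<Delta> \<subseteq> \<Gamma>' \<inter> fms L U \<and> (\<forall>\<psi> \<in> \<Gamma>' \<inter> fms L U. E U \<Delta> \<psi>)"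
    and "\<Gamma> \<subseteq> fms_over L K"
    and "\<phi> \<in> fms_over L K"
  shows "(inchworm L E K \<Gamma> \<phi> \<longrightarrow> ns_valid TYPE(('o, 'm) cat) L E K \<Gamma> \<phi>) \<and>
    ((\<exists>i :: ('f, 'r, 'v) fm set \<Rightarrow> 'o. inj i) \<and> (\<exists>j :: ('f, 'r, 'v) fm set \<Rightarrow> 'm. inj j) \<longrightarrow>
     (inchworm L E K \<Gamma> \<phi> \<longleftrightarrow> ns_valid TYPE(('o, 'm) cat) L E K \<Gamma> \<phi>))"
proof -
  interpret regular_theory L E by fact
  have sound: "ns_valid TYPE(('o, 'm) cat) L E K \<Gamma> \<phi>" if "inchworm L E K \<Gamma> \<phi>"
    unfolding ns_valid_def no_signalling_model_def
    using inchworm_sound[OF assms(1,3) _ assms(2) _ _ that] by blast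
  have "inchworm L E K \<Gamma> \<phi>"
    if ci: "inj (ci :: ('f, 'r, 'v) fm set \<Rightarrow> 'o)" and cj: "inj (cj :: ('f, 'r, 'v) fm set \<Rightarrow> 'm)"
      and valid: "ns_valid TYPE(('o, 'm) cat) L E K \<Gamma> \<phi>" for ci cj
  proof (rule ccontr)
    assume not: "\<not> inchworm L E K \<Gamma> \<phi>"
    let ?C = "inchworm_closure K \<Gamma>"
    have ctx: "is_ctx L U" if "U \<in> K" for U
      using that assms(1,3) by (auto simp: simplicial_complex_def is_ctx_def)
    have C: "?C \<subseteq> fms_over L K" by (auto simp: inchworm_closure_def)
    obtain U where U: "U \<in> K" "\<phi> \<in> fms L U" using assms(7) by (auto simp: fms_over_def)
    have "\<not> E U (?C \<inter> fms L U) \<phi>"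
      using closure_closed[OF U(1), of "?C \<inter> fms L U" \<phi> \<Gamma>] not by (auto simp: inchworm_closure_def)
    then obtain M :: "(('f, ('f, 'r, 'v) fm) tm, 's, 'f, 'r) struct" and a
      where M: "set_model L E M" and a: "assignment L M U a" "\<forall>\<psi>\<in>?C \<inter> fms L U. sat L M \<psi> a" "\<not> sat L M \<phi> a"
      using set_completeness[OF ctx[OF U(1)] _ U(2)] by blast
    obtain i j code where "coded_sets (i :: ('f, ('f, 'r, 'v) fm) tm set \<Rightarrow> 'o)
      (j :: ('f, ('f, 'r, 'v) fm) tm set \<times> ('f, ('f, 'r, 'v) fm) tm set \<times>
        (('f, ('f, 'r, 'v) fm) tm \<times> ('f, ('f, 'r, 'v) fm) tm) set \<Rightarrow> 'm) code"
      using coded_sets_exists[OF ci cj] by blast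
    then interpret coded_sets i j code .
    interpret struct_interp i j code L M
      by unfold_locales (use M in \<open>simp add: set_model_def\<close>)
    have "no_signalling S I K (solution_sub ?C)"
    proof (rule no_signalling_solutions[OF ctx])
      fix V W b assume VW: "V \<in> K" "W \<in> K" "W \<subseteq> V" and b: "assignment L M W b" "\<forall>\<psi>\<in>?C \<inter> fms L W. sat L M \<psi> b"
      have "W \<union> (V - W) = V" "finite (V - W)" "W \<inter> (V - W) = {}"
        using VW ctx[OF VW(1)] by (auto simp: is_ctx_def)
      \<comment> \<open>The finiteness condition is used for the closure, which lies in
        \<open>fms_over L K\<close>, rather than for \<open>\<Gamma>\<close>.\<close>
      then show "\<exists>c. assignment L M V c \<and> (\<forall>x\<in>W. c x = b x) \<and> (\<forall>\<psi>\<in>?C \<inter> fms L V. sat L M \<psi> c)"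
        using extend_assignment[OF assms(1,3) M assms(5)[OF C] b, of "V - W"] VW(1) by simp
    qed
    moreover have "satisfies S L I K (solution_sub ?C) \<psi>" if "\<psi> \<in> \<Gamma>" for \<psi>
      using solutions_satisfy[OF ctx, of K \<psi> ?C] closure_contains[OF ctx assms(6)] that by blast
    ultimately have "no_signalling_model S L I K \<Gamma> (solution_sub ?C)"
      by (simp add: no_signalling_model_def)
    then have "satisfies S L I K (solution_sub ?C) \<phi>"
      using valid model_I[OF assms(4) M] regular_category_axioms unfolding ns_valid_def by blast
    then show False using solutions_refute[OF ctx U a] by blast
  qed
  with sound show ?thesis by blast
qed

end
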